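(* For every integer $n\ge 1$, $(sl_{n+1}^{+})_{q}$ is an adequate basic $T$-Lie algebra.
   Context: **$T$-Lie algebras.** Let $k$ be a commutative unitary ring, $\mathbb{N}=\{1,2,\ldots\}$, and let $L$ be a free $k$-module with a given totally ordered basis $\mathcal{B}$; $\otimes$ means $\otimes_k$. Let $L^{3}\subseteq L^{\otimes 3}$ be the $k$-span of the $x\otimes y\otimes z$ with $x<y<z$ in $\mathcal{B}$, and ${}^{3}L$ the $k$-span of those with $x>y>z$ in $\mathcal{B}$. $L$ together with $k$-linear maps $S,T,\langle,\rangle:L\otimes L\to L\otimes L$ and $[,]:L\otimes L\to L$ is a *$T$-Lie algebra with basis $\mathcal{B}$* (a *basic $T$-Lie algebra* ) if, with $S_{12}=S\otimes Id$, $S_{23}=Id\otimes S$: 1. (a) $S^2=Id$; (b) for all $x,y\in\mathcal{B}$, $S(x\otimes y)=q_{x,y}\,y\otimes x$ for some $q_{x,y}\in k$; (c) (multiplicativity) $S(Id\otimes[,])|_{L^3}=([,]\otimes Id)S_{23}S_{12}|_{L^3}$ and $S([,]\otimes Id)|_{L^3}=(Id\otimes[,])S_{12}S_{23}|_{L^3}$. 2. (stability) There is a strict grading of $L$ relative to $[,]$, i.e. a decomposition $L=\bigoplus_{\eta\in\mathbb{N}}L_\eta$ into $k$-submodules with $[L_{\eta_1},L_{\eta_2}]\subseteq L_{\eta_1+\eta_2-1}$ for all $\eta_1,\eta_2\in\mathbb{N}$, every element of $\mathcal{B}$ being homogeneous (write $\eta(x)=\eta$ for $x\in L_\eta$); and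 $\langle L_{\eta_1}\otimes L_{\eta_2}\rangle\subseteq\bigoplus_{\alpha+\beta\le\eta_1+\eta_2-1}L_\alpha\otimes L_\beta$ for all $\eta_1,\eta_2$. 3. $T=S+\langle,\rangle$. 4. (antisymmetry) $[,]T=-[,]$; $\langle,\rangle S=-\langle,\rangle$; $[,]\langle,\rangle=0$. 5. (Jacobi identity) $[,]\big((Id\otimes[,])S_{12}S_{23}-([,]\otimes Id)S_{23}S_{12}+(Id\otimes[,])S_{23}S_{12}\big)|_{{}^{3}L}=0$. **The object $(sl_{n+1}^+)_q$.** Let $\mathbb{K}$ be a field, $q=\exp(t)\in\mathbb{K}[[t]]$ (formal power series), $k=\mathbb{K}[q,q^{-1}]$. $(sl_{n+1}^{+})_q$ is the free $k$-module with basis $\mathcal{B}=\{e_{ij}\mid 1\le i<j\le n+1\}$ (symbols for the matrix units), totally ordered by: $e_{ab}<e_{uv}$ iff $a+b<u+v$, or $a+b=u+v$ and $b<v$. Its structure is: - $S(e_{ab}\otimes e_{uv})=q^{c_{ab,uv}}e_{uv}\otimes e_{ab}$ for $e_{ab}<e_{uv}$, where $c_{ab,uv}\in\mathbb{Z}$ is given by $[e_{aa}-e_{bb},e_{uv}]=c_{ab,uv}e_{uv}$ (matrix commutator); $S(x\otimes x)=x\otimes x$ for $x\in\mathcal{B}$; for $e_{ab}>e_{uv}$, $S$ is determined by $S^2=Id$. - Bracket: $[x,y]_q=[x,y]$ (matrix commutator) if $x<y$ in $\mathcal{B}$; $[x,x]_q=0$; for $x<y$ with $S(x\otimes y)=q^{c}y\otimes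 x$, $[y,x]_q=-q^{-c}[x,y]_q$ (as forced by antisymmetry). - $\langle e_{ij},e_{uv}\rangle=(q-q^{-1})e_{iv}\otimes e_{uj}$ if $i<u<j<v$; $=(q^{-1}-q)e_{uj}\otimes e_{iv}$ if $u<i<v<j$; $=0$ otherwise. - $T=S+\langle,\rangle$; grading $\eta(e_{ij})=i(j-i)$. **$q$-symmetric algebra.** For a basic $T$-Lie algebra $L$, $\mathcal{S}(L)$ is the tensor algebra of $L$ modulo the ideal generated by $x\otimes y-S(x\otimes y)$, $x,y\in\mathcal{B}$. Write $z_\lambda$ for the image of $x_\lambda\in\mathcal{B}$, and $z_\Sigma=z_{\lambda_1}\cdots z_{\lambda_u}$ for a sequence $\Sigma=(x_{\lambda_1}\le\cdots\le x_{\lambda_u})$ in $\mathcal{B}$ (in which $x$ may be repeated only if $q_{x,x}=1$), $z_\emptyset=1$. It is a standing fact in this setting that $\mathcal{S}(L)$ is a free $k$-module with basis the $z_\Sigma$. Put $\eta(\lambda)=\eta(x_\lambda)$, $\eta(\Sigma)=\sum_i\eta(x_{\lambda_i})$, $q_{\lambda\mu}=q_{x_\lambda,x_\mu}$, and write $x_\lambda\le\Sigma$ if $x_\lambda\le x_{\lambda_1}$ (or $\Sigma=\emptyset$). **The canonical map.** $\cdot:L\otimes\mathcal{S}(L)\to\mathcal{S}(L)$ is the $k$-linear map defined recursively on $\eta(\lambda)+\eta(\Sigma)$ by: $x_\lambda\cdot z_\Sigma=z_\lambda z_\Sigma$ if $x_\lambda\le\Sigma$; otherwise write $\Sigma=(x_\mu,N)$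 with $x_\mu\le N$, $x_\lambda>x_\mu$, and put $$x_\lambda\cdot z_\Sigma=q_{\lambda\mu}z_\mu z_\lambda z_N+q_{\lambda\mu}\,x_\mu\cdot(x_\lambda\cdot z_N-z_\lambda z_N)+\langle x_\lambda,x_\mu\rangle\cdot z_N+[x_\lambda,x_\mu]\cdot z_N.$$ Here and below $(a\otimes b)\cdot z$ means $a\cdot(b\cdot z)$, and $a\cdot b\cdot z=a\cdot(b\cdot z)$. **Adequate.** $L$ is *adequate* if for every $r$ the following holds: if $$x_{\lambda'}\cdot x_{\mu'}\cdot z_M-T(x_{\lambda'}\otimes x_{\mu'})\cdot z_M=[x_{\lambda'},x_{\mu'}]\cdot z_M$$ for all $x_{\lambda'},x_{\mu'}\in\mathcal{B}$ and $M$ with $\eta(\lambda')+\eta(\mu')+\eta(M)\le r$, then $$\begin{aligned}&\langle x_\lambda,x_\mu\rangle\cdot x_\gamma\cdot z_N-q_{\lambda\mu}[x_\mu,[x_\lambda,x_\gamma]]\cdot z_N\\&=q_{\mu\gamma}q_{\lambda\gamma}\langle x_\gamma,[x_\lambda,x_\mu]\rangle\cdot z_N+q_{\mu\gamma}q_{\lambda\gamma}x_\gamma\cdot\langle x_\lambda,x_\mu\rangle\cdot z_N\\&\quad+q_{\mu\gamma}\langle x_\lambda,x_\gamma\rangle\cdot x_\mu\cdot z_N-q_{\lambda\mu}x_\mu\cdot\langle x_\lambda,x_\gamma\rangle\cdot z_N\\&\quad+q_{\mu\gamma}[x_\lambda,x_\gamma]\cdot x_\mu\cdot z_N-q_{\lambda\mu}x_\mu\cdot[x_\lambda,x_\gamma]\cdot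 z_N\\&\quad+x_\lambda\cdot\langle x_\mu,x_\gamma\rangle\cdot z_N-q_{\lambda\mu}q_{\lambda\gamma}\langle x_\mu,x_\gamma\rangle\cdot x_\lambda\cdot z_N-q_{\lambda\gamma}q_{\lambda\mu}\langle[x_\mu,x_\gamma],x_\lambda\rangle\cdot z_N\end{aligned}$$ for all $x_\lambda>x_\mu>x_\gamma$ in $\mathcal{B}$ and $N$ with $x_\gamma\le N$ and $\eta(\lambda)+\eta(\mu)+\eta(\gamma)+\eta(N)\le r+1$.
   Formalization: In stability, [L_a,L_b] is only required to lie in the sum of the L_α with α ≤ a+b−1, not in L_{a+b−1} itself; the literal clause fails for n ≥ 3 (e.g. [e_13,e_34]=e_14 has degree 3, not 4) under any grading. K has characteristic 0, as exp(t) needs. *)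

theory Defs
  imports "HOL-Algebra.QuotRing" "HOL-Library.Poly_Mapping"
    "HOL-Computational_Algebra.Formal_Power_Series"
begin

section \<open>Free modules with a basis, and their tensor products\<close>

text \<open>
  The free \<open>k\<close>-module with basis \<open>B\<close> consists of the finitely supported functions on
  \<open>B\<close>.  Tensor products of free modules are taken in coordinates: \<open>L \<otimes> L\<close> is free on
  \<open>B \<times> B\<close> and \<open>L \<otimes> L \<otimes> L\<close> is free on \<open>B \<times> B \<times> B\<close> (nested to the right).
\<close>

abbreviation bvec :: "'b \<Rightarrow> 'b \<Rightarrow>\<^sub>0 'k::comm_ring_1" where
  "bvec x \<equiv> Poly_Mapping.single x 1"

definition smul :: "'k::comm_ring_1 \<Rightarrow> ('b \<Rightarrow>\<^sub>0 'k) \<Rightarrow> ('b \<Rightarrow>\<^sub>0 'k)" where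
  "smul c = Poly_Mapping.map ((*) c)"

definition free_module :: "'b set \<Rightarrow> ('b \<Rightarrow>\<^sub>0 'k::comm_ring_1) set" where
  "free_module B = {f. Poly_Mapping.keys f \<subseteq> B}"

definition linear_maps ::
    "('b \<Rightarrow>\<^sub>0 'k::comm_ring_1) set \<Rightarrow> ('c \<Rightarrow>\<^sub>0 'k) set \<Rightarrow> (('b \<Rightarrow>\<^sub>0 'k) \<Rightarrow> ('c \<Rightarrow>\<^sub>0 'k)) set" where
  "linear_maps M N = {f. (\<forall>u\<in>M. f u \<in> N)
     \<and> (\<forall>u\<in>M. \<forall>v\<in>M. f (u + v) = f u + f v)
     \<and> (\<forall>c. \<forall>u\<in>M. f (smul c u) = smul c (f u))}"

definition lin_ext :: "('b \<Rightarrow> ('c \<Rightarrow>\<^sub>0 'k)) \<Rightarrow> ('b \<Rightarrow>\<^sub>0 'k::comm_ring_1) \<Rightarrow> ('c \<Rightarrow>\<^sub>0 'k)" where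
  "lin_ext h u = (\<Sum>x\<in>Poly_Mapping.keys u. smul (Poly_Mapping.lookup u x) (h x))"

definition tens :: "('b \<Rightarrow>\<^sub>0 'k::comm_ring_1) \<Rightarrow> ('c \<Rightarrow>\<^sub>0 'k) \<Rightarrow> ('b \<times> 'c \<Rightarrow>\<^sub>0 'k)" where
  "tens u v = (\<Sum>x\<in>Poly_Mapping.keys u. \<Sum>y\<in>Poly_Mapping.keys v.
     Poly_Mapping.single (x, y) (Poly_Mapping.lookup u x * Poly_Mapping.lookup v y))"

text \<open>The tensor product \<open>f \<otimes> g\<close> of linear maps; it only inspects \<open>f\<close> and \<open>g\<close> on basis vectors.\<close>

definition tens_map ::
    "(('a \<Rightarrow>\<^sub>0 'k::comm_ring_1) \<Rightarrow> ('c \<Rightarrow>\<^sub>0 'k)) \<Rightarrow> (('b \<Rightarrow>\<^sub>0 'k) \<Rightarrow> ('d \<Rightarrow>\<^sub>0 'k))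
      \<Rightarrow> ('a \<times> 'b \<Rightarrow>\<^sub>0 'k) \<Rightarrow> ('c \<times> 'd \<Rightarrow>\<^sub>0 'k)" where
  "tens_map f g = lin_ext (\<lambda>(x, y). tens (f (bvec x)) (g (bvec y)))"

definition assoc_r :: "(('a \<times> 'b) \<times> 'c \<Rightarrow>\<^sub>0 'k::comm_ring_1) \<Rightarrow> ('a \<times> 'b \<times> 'c \<Rightarrow>\<^sub>0 'k)" where
  "assoc_r = lin_ext (\<lambda>((x, y), z). bvec (x, y, z))"

definition assoc_l :: "('a \<times> 'b \<times> 'c \<Rightarrow>\<^sub>0 'k::comm_ring_1) \<Rightarrow> (('a \<times> 'b) \<times> 'c \<Rightarrow>\<^sub>0 'k)" where
  "assoc_l = lin_ext (\<lambda>(x, y, z). bvec ((x, y), z))"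

definition op12 ::
    "(('b \<times> 'b \<Rightarrow>\<^sub>0 'k::comm_ring_1) \<Rightarrow> ('b \<times> 'b \<Rightarrow>\<^sub>0 'k)) \<Rightarrow> ('b \<times> 'b \<times> 'b \<Rightarrow>\<^sub>0 'k) \<Rightarrow> ('b \<times> 'b \<times> 'b \<Rightarrow>\<^sub>0 'k)" where
  "op12 f u = assoc_r (tens_map f id (assoc_l u))"

definition op23 ::
    "(('b \<times> 'b \<Rightarrow>\<^sub>0 'k::comm_ring_1) \<Rightarrow> ('b \<times> 'b \<Rightarrow>\<^sub>0 'k)) \<Rightarrow> ('b \<times> 'b \<times> 'b \<Rightarrow>\<^sub>0 'k) \<Rightarrow> ('b \<times> 'b \<times> 'b \<Rightarrow>\<^sub>0 'k)" where
  "op23 f = tens_map id f"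

definition br_id ::
    "(('b \<times> 'b \<Rightarrow>\<^sub>0 'k::comm_ring_1) \<Rightarrow> ('b \<Rightarrow>\<^sub>0 'k)) \<Rightarrow> ('b \<times> 'b \<times> 'b \<Rightarrow>\<^sub>0 'k) \<Rightarrow> ('b \<times> 'b \<Rightarrow>\<^sub>0 'k)" where
  "br_id b u = tens_map b id (assoc_l u)"

definition id_br ::
    "(('b \<times> 'b \<Rightarrow>\<^sub>0 'k::comm_ring_1) \<Rightarrow> ('b \<Rightarrow>\<^sub>0 'k)) \<Rightarrow> ('b \<times> 'b \<times> 'b \<Rightarrow>\<^sub>0 'k) \<Rightarrow> ('b \<times> 'b \<Rightarrow>\<^sub>0 'k)" where
  "id_br b = tens_map id b"


section \<open>Basic T-Lie algebras\<close>

text \<open>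
  The grading is part of the data, given by the degrees of the basis elements: if every
  basis element is homogeneous then \<open>L\<^sub>\<eta>\<close> is the span of the basis elements of degree \<open>\<eta>\<close>.
\<close>

record (overloaded) ('b, 'k) tlie_data =
  tbasis :: "'b set"
  tless :: "'b \<Rightarrow> 'b \<Rightarrow> bool"
  tS :: "('b \<times> 'b \<Rightarrow>\<^sub>0 'k) \<Rightarrow> ('b \<times> 'b \<Rightarrow>\<^sub>0 'k)"
  tT :: "('b \<times> 'b \<Rightarrow>\<^sub>0 'k) \<Rightarrow> ('b \<times> 'b \<Rightarrow>\<^sub>0 'k)"
  tpair :: "('b \<times> 'b \<Rightarrow>\<^sub>0 'k) \<Rightarrow> ('b \<times> 'b \<Rightarrow>\<^sub>0 'k)"
  tbr :: "('b \<times> 'b \<Rightarrow>\<^sub>0 'k) \<Rightarrow> ('b \<Rightarrow>\<^sub>0 'k)"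
  tdeg :: "'b \<Rightarrow> nat"

definition degree_part :: "('b, 'k::comm_ring_1) tlie_data \<Rightarrow> nat \<Rightarrow> 'b set" where
  "degree_part A d = {x \<in> tbasis A. tdeg A x = d}"

text \<open>
  In \<open>stable_br\<close> the bracket lands in the sum of the \<open>L\<^sub>\<alpha>\<close> with \<open>\<alpha> \<le> \<eta>\<^sub>1 + \<eta>\<^sub>2 - 1\<close>, as in
  \<open>stable_pair\<close>.  Asking for the single component of degree \<open>\<eta>\<^sub>1 + \<eta>\<^sub>2 - 1\<close> would exclude
  the degrees \<open>\<eta>(e\<^sub>i\<^sub>j) = i (j - i)\<close> of \<open>(sl\<^sub>n\<^sub>+\<^sub>1\<^sup>+)\<^sub>q\<close>, \<open>n \<ge> 3\<close>: \<open>[e\<^sub>1\<^sub>3, e\<^sub>3\<^sub>4] = e\<^sub>1\<^sub>4\<close> with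
  degrees 2, 3 and 3.  No other degrees would do either, as additivity of \<open>\<eta> - 1\<close> on
  brackets contradicts \<open>stable_pair\<close> for \<open>e\<^sub>1\<^sub>3\<close> and \<open>e\<^sub>2\<^sub>4\<close>.
\<close>

locale basic_T_Lie_algebra =
  fixes A :: "('b, 'k::comm_ring_1) tlie_data"
  assumes order_irrefl: "irreflp_on (tbasis A) (tless A)"
    and order_trans: "transp_on (tbasis A) (tless A)"
    and order_total: "totalp_on (tbasis A) (tless A)"
    and S_linear: "tS A \<in> linear_maps (free_module (tbasis A \<times> tbasis A)) (free_module (tbasis A \<times> tbasis A))"
    and T_linear: "tT A \<in> linear_maps (free_module (tbasis A \<times> tbasis A)) (free_module (tbasis A \<times> tbasis A))"
    and pair_linear: "tpair A \<in> linear_maps (free_module (tbasis A \<times> tbasis A)) (free_module (tbasis A \<times> tbasis A))"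
    and br_linear: "tbr A \<in> linear_maps (free_module (tbasis A \<times> tbasis A)) (free_module (tbasis A))"
    and S_involution: "\<forall>u \<in> free_module (tbasis A \<times> tbasis A). tS A (tS A u) = u"
    and S_diagonal: "\<forall>x \<in> tbasis A. \<forall>y \<in> tbasis A. \<exists>q. tS A (bvec (x, y)) = smul q (bvec (y, x))"
    and multiplicative_right:
      "\<forall>u \<in> free_module {(x, y, z). x \<in> tbasis A \<and> y \<in> tbasis A \<and> z \<in> tbasis A \<and> tless A x y \<and> tless A y z}.
         tS A (id_br (tbr A) u) = br_id (tbr A) (op23 (tS A) (op12 (tS A) u))"
    and multiplicative_left:
      "\<forall>u \<in> free_module {(x, y, z). x \<in> tbasis A \<and> y \<in> tbasis A \<and> z \<in> tbasis A \<and> tless A x y \<and> tless A y z}.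
         tS A (br_id (tbr A) u) = id_br (tbr A) (op12 (tS A) (op23 (tS A) u))"
    and deg_pos: "\<forall>x \<in> tbasis A. tdeg A x \<ge> 1"
    and stable_br:
      "\<forall>d1\<ge>1. \<forall>d2\<ge>1. \<forall>u \<in> free_module (degree_part A d1 \<times> degree_part A d2).
         tbr A u \<in> free_module {x \<in> tbasis A. tdeg A x \<le> d1 + d2 - 1}"
    and stable_pair:
      "\<forall>d1\<ge>1. \<forall>d2\<ge>1. \<forall>u \<in> free_module (degree_part A d1 \<times> degree_part A d2).
         tpair A u \<in> free_module {(x, y). x \<in> tbasis A \<and> y \<in> tbasis A \<and> tdeg A x + tdeg A y \<le> d1 + d2 - 1}"
    and T_eq: "\<forall>u \<in> free_module (tbasis A \<times> tbasis A). tT A u = tS A u + tpair A u"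
    and br_T: "\<forall>u \<in> free_module (tbasis A \<times> tbasis A). tbr A (tT A u) = - tbr A u"
    and pair_S: "\<forall>u \<in> free_module (tbasis A \<times> tbasis A). tpair A (tS A u) = - tpair A u"
    and br_pair: "\<forall>u \<in> free_module (tbasis A \<times> tbasis A). tbr A (tpair A u) = 0"
    and jacobi:
      "\<forall>u \<in> free_module {(x, y, z). x \<in> tbasis A \<and> y \<in> tbasis A \<and> z \<in> tbasis A \<and> tless A y x \<and> tless A z y}.
         tbr A (id_br (tbr A) (op12 (tS A) (op23 (tS A) u))
                - br_id (tbr A) (op23 (tS A) (op12 (tS A) u))
                + id_br (tbr A) (op23 (tS A) (op12 (tS A) u))) = 0"

text \<open>The scalar \<open>q\<^sub>x\<^sub>,\<^sub>y\<close> with \<open>S (x \<otimes> y) = q\<^sub>x\<^sub>,\<^sub>y (y \<otimes> x)\<close>.\<close>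

definition q_coeff :: "('b, 'k::comm_ring_1) tlie_data \<Rightarrow> 'b \<Rightarrow> 'b \<Rightarrow> 'k" where
  "q_coeff A x y = Poly_Mapping.lookup (tS A (bvec (x, y))) (y, x)"


section \<open>The q-symmetric algebra\<close>

text \<open>The tensor algebra is free on the words in \<open>B\<close>, with concatenation as product.\<close>

definition tensor_algebra :: "'b set \<Rightarrow> ('b list \<Rightarrow>\<^sub>0 'k::comm_ring_1) ring" where
  "tensor_algebra B =
     \<lparr>carrier = free_module (lists B),
      monoid.mult = (\<lambda>f g. lin_ext (\<lambda>(v, w). bvec (v @ w)) (tens f g)),
      one = bvec [],
      zero = 0,
      add = (+)\<rparr>"

definition sym_ideal :: "('b, 'k::comm_ring_1) tlie_data \<Rightarrow> ('b list \<Rightarrow>\<^sub>0 'k) set" where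
  "sym_ideal A = genideal (tensor_algebra (tbasis A))
     {lin_ext (\<lambda>(v, w). bvec [v, w]) (bvec (x, y) - tS A (bvec (x, y))) | x y.
        x \<in> tbasis A \<and> y \<in> tbasis A}"

definition sym_algebra :: "('b, 'k::comm_ring_1) tlie_data \<Rightarrow> ('b list \<Rightarrow>\<^sub>0 'k) set ring" where
  "sym_algebra A = tensor_algebra (tbasis A) Quot sym_ideal A"

definition sym_class :: "('b, 'k::comm_ring_1) tlie_data \<Rightarrow> ('b list \<Rightarrow>\<^sub>0 'k) \<Rightarrow> ('b list \<Rightarrow>\<^sub>0 'k) set" where
  "sym_class A f = sym_ideal A +>\<^bsub>tensor_algebra (tbasis A)\<^esub> f"

text \<open>The \<open>k\<close>-module structure: \<open>c\<close> acts as multiplication by the class of \<open>c \<cdot> 1\<close>.\<close>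

definition sym_scale ::
    "('b, 'k::comm_ring_1) tlie_data \<Rightarrow> 'k \<Rightarrow> ('b list \<Rightarrow>\<^sub>0 'k) set \<Rightarrow> ('b list \<Rightarrow>\<^sub>0 'k) set" where
  "sym_scale A c s = sym_class A (smul c (bvec [])) \<otimes>\<^bsub>sym_algebra A\<^esub> s"

definition zgen :: "('b, 'k::comm_ring_1) tlie_data \<Rightarrow> 'b \<Rightarrow> ('b list \<Rightarrow>\<^sub>0 'k) set" where
  "zgen A x = sym_class A (bvec [x])"

definition zmon :: "('b, 'k::comm_ring_1) tlie_data \<Rightarrow> 'b list \<Rightarrow> ('b list \<Rightarrow>\<^sub>0 'k) set" where
  "zmon A \<Sigma> = foldr (\<lambda>x s. zgen A x \<otimes>\<^bsub>sym_algebra A\<^esub> s) \<Sigma> \<one>\<^bsub>sym_algebra A\<^esub>"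

definition sequences :: "('b, 'k::comm_ring_1) tlie_data \<Rightarrow> 'b list set" where
  "sequences A = {\<Sigma> \<in> lists (tbasis A).
     sorted_wrt (\<lambda>x y. tless A x y \<or> (x = y \<and> q_coeff A x x = 1)) \<Sigma>}"

definition seq_deg :: "('b, 'k::comm_ring_1) tlie_data \<Rightarrow> 'b list \<Rightarrow> nat" where
  "seq_deg A \<Sigma> = sum_list (map (tdeg A) \<Sigma>)"

definition below :: "('b, 'k::comm_ring_1) tlie_data \<Rightarrow> 'b \<Rightarrow> 'b list \<Rightarrow> bool" where
  "below A x \<Sigma> \<longleftrightarrow> (case \<Sigma> of [] \<Rightarrow> True | y # _ \<Rightarrow> tless A x y \<or> x = y)"


section \<open>The canonical map and adequacy\<close>

text \<open>
  Linear maps \<open>L \<otimes> S(L) \<rightarrow> S(L)\<close> are written as bilinear maps of two arguments; \<open>act2\<close> is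
  the induced action of \<open>L \<otimes> L\<close>, namely \<open>(a \<otimes> b) \<cdot> s = a \<cdot> (b \<cdot> s)\<close>.
\<close>

type_synonym ('b, 'k) action =
  "('b \<Rightarrow>\<^sub>0 'k) \<Rightarrow> ('b list \<Rightarrow>\<^sub>0 'k) set \<Rightarrow> ('b list \<Rightarrow>\<^sub>0 'k) set"

definition act2 ::
    "('b, 'k::comm_ring_1) tlie_data \<Rightarrow> ('b, 'k) action
      \<Rightarrow> ('b \<times> 'b \<Rightarrow>\<^sub>0 'k) \<Rightarrow> ('b list \<Rightarrow>\<^sub>0 'k) set \<Rightarrow> ('b list \<Rightarrow>\<^sub>0 'k) set" where
  "act2 A act w s = finsum (sym_algebra A)
     (\<lambda>(a, b). sym_scale A (Poly_Mapping.lookup w (a, b)) (act (bvec a) (act (bvec b) s)))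
     (Poly_Mapping.keys w)"

definition bilinear_action :: "('b, 'k::comm_ring_1) tlie_data \<Rightarrow> ('b, 'k) action \<Rightarrow> bool" where
  "bilinear_action A act \<longleftrightarrow>
     (\<forall>l \<in> free_module (tbasis A). \<forall>s \<in> carrier (sym_algebra A).
        act l s \<in> carrier (sym_algebra A)
        \<and> (\<forall>l' \<in> free_module (tbasis A). act (l + l') s = act l s \<oplus>\<^bsub>sym_algebra A\<^esub> act l' s)
        \<and> (\<forall>s' \<in> carrier (sym_algebra A).
             act l (s \<oplus>\<^bsub>sym_algebra A\<^esub> s') = act l s \<oplus>\<^bsub>sym_algebra A\<^esub> act l s')
        \<and> (\<forall>c. act (smul c l) s = sym_scale A c (act l s)
             \<and> act l (sym_scale A c s) = sym_scale A c (act l s)))"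

context
  fixes A :: "('b, 'k::comm_ring_1) tlie_data"
    and act :: "('b, 'k) action" (infixr "\<bullet>" 75)
begin

abbreviation (input) splus (infixl "\<boxplus>" 65) where "s \<boxplus> t \<equiv> s \<oplus>\<^bsub>sym_algebra A\<^esub> t"
abbreviation (input) sminus (infixl "\<boxminus>" 65) where "s \<boxminus> t \<equiv> s \<ominus>\<^bsub>sym_algebra A\<^esub> t"
abbreviation (input) stimes (infixl "\<boxtimes>" 70) where "s \<boxtimes> t \<equiv> s \<otimes>\<^bsub>sym_algebra A\<^esub> t"
abbreviation (input) sscale (infixr "\<diamondop>" 74) where "c \<diamondop> s \<equiv> sym_scale A c s"
abbreviation (input) llact (infixr "\<bullet>\<bullet>" 75) where "w \<bullet>\<bullet> s \<equiv> act2 A act w s"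
abbreviation (input) lbr ("\<lbrakk>_, _\<rbrakk>") where "\<lbrakk>u, v\<rbrakk> \<equiv> tbr A (tens u v)"
abbreviation (input) lpair ("\<llangle>_, _\<rrangle>") where "\<llangle>u, v\<rrangle> \<equiv> tpair A (tens u v)"

definition canonical_map :: bool where
  "canonical_map \<longleftrightarrow>
     bilinear_action A act
     \<and> (\<forall>x \<in> tbasis A. \<forall>\<Sigma> \<in> sequences A. below A x \<Sigma> \<longrightarrow>
          bvec x \<bullet> zmon A \<Sigma> = zgen A x \<boxtimes> zmon A \<Sigma>)
     \<and> (\<forall>x \<in> tbasis A. \<forall>y N. y # N \<in> sequences A \<longrightarrow> tless A y x \<longrightarrow>
          bvec x \<bullet> zmon A (y # N) =
            q_coeff A x y \<diamondop> (zgen A y \<boxtimes> zgen A x \<boxtimes> zmon A N)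
            \<boxplus> q_coeff A x y \<diamondop> (bvec y \<bullet> (bvec x \<bullet> zmon A N \<boxminus> zgen A x \<boxtimes> zmon A N))
            \<boxplus> \<llangle>bvec x, bvec y\<rrangle> \<bullet>\<bullet> zmon A N
            \<boxplus> \<lbrakk>bvec x, bvec y\<rbrakk> \<bullet> zmon A N)"

definition action_identity :: "nat \<Rightarrow> bool" where
  "action_identity r \<longleftrightarrow>
     (\<forall>x \<in> tbasis A. \<forall>y \<in> tbasis A. \<forall>M \<in> sequences A.
        tdeg A x + tdeg A y + seq_deg A M \<le> r \<longrightarrow>
        bvec x \<bullet> bvec y \<bullet> zmon A M \<boxminus> tT A (tens (bvec x) (bvec y)) \<bullet>\<bullet> zmon A M
          = \<lbrakk>bvec x, bvec y\<rbrakk> \<bullet> zmon A M)"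

definition adequacy_identity :: "'b \<Rightarrow> 'b \<Rightarrow> 'b \<Rightarrow> 'b list \<Rightarrow> bool" where
  "adequacy_identity l m g N \<longleftrightarrow>
     (let x = bvec l; y = bvec m; w = bvec g; z = zmon A N;
          qlm = q_coeff A l m; qlg = q_coeff A l g; qmg = q_coeff A m g in
      \<llangle>x, y\<rrangle> \<bullet>\<bullet> w \<bullet> z \<boxminus> qlm \<diamondop> \<lbrakk>y, \<lbrakk>x, w\<rbrakk>\<rbrakk> \<bullet> z
      = (qmg * qlg) \<diamondop> \<llangle>w, \<lbrakk>x, y\<rbrakk>\<rrangle> \<bullet>\<bullet> z \<boxplus> (qmg * qlg) \<diamondop> w \<bullet> \<llangle>x, y\<rrangle> \<bullet>\<bullet> z
        \<boxplus> qmg \<diamondop> \<llangle>x, w\<rrangle> \<bullet>\<bullet> y \<bullet> z \<boxminus> qlm \<diamondop> y \<bullet> \<llangle>x, w\<rrangle> \<bullet>\<bullet> z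
        \<boxplus> qmg \<diamondop> \<lbrakk>x, w\<rbrakk> \<bullet> y \<bullet> z \<boxminus> qlm \<diamondop> y \<bullet> \<lbrakk>x, w\<rbrakk> \<bullet> z
        \<boxplus> x \<bullet> \<llangle>y, w\<rrangle> \<bullet>\<bullet> z \<boxminus> (qlm * qlg) \<diamondop> \<llangle>y, w\<rrangle> \<bullet>\<bullet> x \<bullet> z
        \<boxminus> (qlg * qlm) \<diamondop> \<llangle>\<lbrakk>y, w\<rbrakk>, x\<rrangle> \<bullet>\<bullet> z)"

definition adequate_action :: bool where
  "adequate_action \<longleftrightarrow>
     (\<forall>r. action_identity r \<longrightarrow>
        (\<forall>l \<in> tbasis A. \<forall>m \<in> tbasis A. \<forall>g \<in> tbasis A. \<forall>N \<in> sequences A.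
           tless A m l \<longrightarrow> tless A g m \<longrightarrow> below A g N \<longrightarrow>
           tdeg A l + tdeg A m + tdeg A g + seq_deg A N \<le> r + 1 \<longrightarrow>
           adequacy_identity l m g N))"

end

text \<open>
  For a basic T-Lie algebra the recursion in \<open>canonical_map\<close> has exactly one solution on
  \<open>L\<close> and \<open>S(L)\<close>; values outside these carriers are left open.
\<close>

definition adequate :: "('b, 'k::comm_ring_1) tlie_data \<Rightarrow> bool" where
  "adequate A \<longleftrightarrow> (\<exists>act. canonical_map A act) \<and> (\<forall>act. canonical_map A act \<longrightarrow> adequate_action A act)"


section \<open>The ring of Laurent polynomials in \<open>q = exp t\<close>\<close>

text \<open>\<open>K[q, q\<^sup>-\<^sup>1]\<close> as a subring of \<open>K[[t]]\<close>; the series \<open>exp t\<close> requires characteristic 0.\<close>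

inductive_set q_laurent_set :: "'a::field_char_0 fps set" where
  "fps_const c \<in> q_laurent_set"
| "fps_exp 1 \<in> q_laurent_set"
| "inverse (fps_exp 1) \<in> q_laurent_set"
| "f \<in> q_laurent_set \<Longrightarrow> g \<in> q_laurent_set \<Longrightarrow> f + g \<in> q_laurent_set"
| "f \<in> q_laurent_set \<Longrightarrow> g \<in> q_laurent_set \<Longrightarrow> f * g \<in> q_laurent_set"

lemma q_laurent_set_0: "0 \<in> q_laurent_set"
  using q_laurent_set.intros(1)[of 0] by simp

lemma q_laurent_set_1: "1 \<in> q_laurent_set"
  using q_laurent_set.intros(1)[of 1] by simp

lemma q_laurent_set_uminus: "f \<in> q_laurent_set \<Longrightarrow> - f \<in> q_laurent_set"
  using q_laurent_set.intros(5)[OF q_laurent_set.intros(1)[of "- 1"], of f]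
  by (simp flip: fps_const_neg)

lemma q_laurent_set_diff: "f \<in> q_laurent_set \<Longrightarrow> g \<in> q_laurent_set \<Longrightarrow> f - g \<in> q_laurent_set"
  using q_laurent_set.intros(4)[OF _ q_laurent_set_uminus] by fastforce

typedef (overloaded) 'a q_laurent = "q_laurent_set :: 'a::field_char_0 fps set"
  using q_laurent_set_0 by blast

setup_lifting type_definition_q_laurent

instantiation q_laurent :: (field_char_0) comm_ring_1
begin

lift_definition zero_q_laurent :: "'a q_laurent" is 0 by (rule q_laurent_set_0)
lift_definition one_q_laurent :: "'a q_laurent" is 1 by (rule q_laurent_set_1)
lift_definition plus_q_laurent :: "'a q_laurent \<Rightarrow> 'a q_laurent \<Rightarrow> 'a q_laurent" is "(+)"
  by (rule q_laurent_set.intros(4))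
lift_definition times_q_laurent :: "'a q_laurent \<Rightarrow> 'a q_laurent \<Rightarrow> 'a q_laurent" is "(*)"
  by (rule q_laurent_set.intros(5))
lift_definition uminus_q_laurent :: "'a q_laurent \<Rightarrow> 'a q_laurent" is uminus
  by (rule q_laurent_set_uminus)
lift_definition minus_q_laurent :: "'a q_laurent \<Rightarrow> 'a q_laurent \<Rightarrow> 'a q_laurent" is "(-)"
  by (rule q_laurent_set_diff)

instance
  by standard (transfer; simp add: algebra_simps)+

end

lift_definition qvar :: "'a::field_char_0 q_laurent" is "fps_exp 1"
  by (rule q_laurent_set.intros(2))

lift_definition qvar_inv :: "'a::field_char_0 q_laurent" is "inverse (fps_exp 1)"
  by (rule q_laurent_set.intros(3))

definition qpow :: "int \<Rightarrow> 'a::field_char_0 q_laurent" where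
  "qpow c = (if c \<ge> 0 then qvar ^ nat c else qvar_inv ^ nat (- c))"


section \<open>The object \<open>(sl\<^sub>n\<^sub>+\<^sub>1\<^sup>+)\<^sub>q\<close>\<close>

text \<open>
  Integer \<open>(n + 1) \<times> (n + 1)\<close> matrices, with rows and columns indexed by \<open>{1..n+1}\<close>.  The pair
  \<open>(i, j)\<close> stands for the basis symbol \<open>e\<^sub>i\<^sub>j\<close>, and \<open>mat_unit i j\<close> is the matrix unit.
\<close>

definition mat_unit :: "nat \<Rightarrow> nat \<Rightarrow> nat \<Rightarrow> nat \<Rightarrow> int" where
  "mat_unit i j = (\<lambda>r s. if r = i \<and> s = j then 1 else 0)"

definition mat_commutator :: "nat \<Rightarrow> (nat \<Rightarrow> nat \<Rightarrow> int) \<Rightarrow> (nat \<Rightarrow> nat \<Rightarrow> int) \<Rightarrow> nat \<Rightarrow> nat \<Rightarrow> int" where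
  "mat_commutator n X Y = (\<lambda>r s. (\<Sum>k=1..n+1. X r k * Y k s) - (\<Sum>k=1..n+1. Y r k * X k s))"

definition sl_basis :: "nat \<Rightarrow> (nat \<times> nat) set" where
  "sl_basis n = {(i, j). 1 \<le> i \<and> i < j \<and> j \<le> n + 1}"

definition sl_less :: "nat \<times> nat \<Rightarrow> nat \<times> nat \<Rightarrow> bool" where
  "sl_less = (\<lambda>(a, b) (u, v). a + b < u + v \<or> (a + b = u + v \<and> b < v))"

definition sl_c :: "nat \<Rightarrow> nat \<times> nat \<Rightarrow> nat \<times> nat \<Rightarrow> int" where
  "sl_c n = (\<lambda>(a, b) (u, v). THE c.
     mat_commutator n (\<lambda>r s. mat_unit a a r s - mat_unit b b r s) (mat_unit u v)
       = (\<lambda>r s. c * mat_unit u v r s))"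

definition sl_S_basis :: "nat \<Rightarrow> nat \<times> nat \<Rightarrow> nat \<times> nat \<Rightarrow> ((nat \<times> nat) \<times> (nat \<times> nat) \<Rightarrow>\<^sub>0 'a::field_char_0 q_laurent)" where
  "sl_S_basis n x y =
     (if x = y then bvec (x, x)
      else if sl_less x y then smul (qpow (sl_c n x y)) (bvec (y, x))
      else smul (qpow (- sl_c n y x)) (bvec (y, x)))"

definition sl_commutator :: "nat \<Rightarrow> nat \<times> nat \<Rightarrow> nat \<times> nat \<Rightarrow> (nat \<times> nat \<Rightarrow>\<^sub>0 'a::field_char_0 q_laurent)" where
  "sl_commutator n x y = (\<Sum>(i, j) \<in> sl_basis n.
     Poly_Mapping.single (i, j)
       (of_int (mat_commutator n (mat_unit (fst x) (snd x)) (mat_unit (fst y) (snd y)) i j)))"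

definition sl_br_basis :: "nat \<Rightarrow> nat \<times> nat \<Rightarrow> nat \<times> nat \<Rightarrow> (nat \<times> nat \<Rightarrow>\<^sub>0 'a::field_char_0 q_laurent)" where
  "sl_br_basis n x y =
     (if x = y then 0
      else if sl_less x y then sl_commutator n x y
      else smul (- qpow (- sl_c n y x)) (sl_commutator n y x))"

definition sl_pair_basis :: "nat \<times> nat \<Rightarrow> nat \<times> nat \<Rightarrow> ((nat \<times> nat) \<times> (nat \<times> nat) \<Rightarrow>\<^sub>0 'a::field_char_0 q_laurent)" where
  "sl_pair_basis = (\<lambda>(i, j) (u, v).
     if i < u \<and> u < j \<and> j < v then smul (qvar - qvar_inv) (bvec ((i, v), (u, j)))
     else if u < i \<and> i < v \<and> v < j then smul (qvar_inv - qvar) (bvec ((u, j), (i, v)))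
     else 0)"

definition sl_q :: "nat \<Rightarrow> (nat \<times> nat, 'a::field_char_0 q_laurent) tlie_data" where
  "sl_q n =
     \<lparr>tbasis = sl_basis n,
      tless = sl_less,
      tS = lin_ext (\<lambda>(x, y). sl_S_basis n x y),
      tT = (\<lambda>u. lin_ext (\<lambda>(x, y). sl_S_basis n x y) u + lin_ext (\<lambda>(x, y). sl_pair_basis x y) u),
      tpair = lin_ext (\<lambda>(x, y). sl_pair_basis x y),
      tbr = lin_ext (\<lambda>(x, y). sl_br_basis n x y),
      tdeg = (\<lambda>(i, j). i * (j - i))\<rparr>"

end

theory Submission
  imports Defs
begin

text \<open>
  Put \<open>\<rho>(x, y) = \<langle>x, y\<rangle> + [x, y]\<close>.  In a basic T-Lie algebra, the relation
  \<open>x y = q\<^bsub>x,y\<^esub> y x + \<rho>(x, y)\<close> in degree at most \<open>r\<close>, applied to the pairs \<open>(w, [x, y])\<close> and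
  \<open>([y, w], x)\<close>, together with multiplicativity and the Jacobi identity turns the adequacy identity
  for \<open>x > y > w\<close> into the vanishing of the obstruction of the overlap \<open>x y w\<close> in the sense of
  Bergman's diamond lemma.  This obstruction only changes by a unit when two of its arguments are
  exchanged, so the order of the basis no longer matters: for root vectors \<open>e\<^sub>i\<^sub>j\<close> it suffices to
  treat intervals \<open>(i, j)\<close> in lexicographic order.  There the relations depend only on the relative
  position of two intervals, and rewriting to lexicographic normal form resolves all
  configurations of three intervals; every word that occurs has smaller degree than the overlap.

  The canonical map exists because sorted monomials form a basis of the q-symmetric algebra: words
  act on the free module on sorted sequences by twisted insertion, and this action respects
  the defining relations.
\<close>

section \<open>Linear extension and tensor products\<close>

text \<open>If the relations were available for the word \<open>x y w\<close> itself, its overlap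
  would vanish at once, since both reductions compute the same composite of operators. Adequacy
  supplies them only in degree at most \<open>r\<close>, while the overlap may have degree
  \<open>r + 1\<close>. They become applicable only after a bracket or a pairing has lowered the
  degree, so vectors carry the degree of the operators still to be applied to them.

  The canonical map lives on a quotient and is constrained only on its carriers. Every solution of
  the recursion is therefore replaced by its values on sorted monomials, which turns equations
  between cosets into equations between finitely supported functions. This passage rests on the
  freeness of the q-symmetric algebra, so that standing fact is proved rather than assumed.\<close>

lemma lookup_smul [simp]: "Poly_Mapping.lookup (smul c u) x = c * Poly_Mapping.lookup u x"
  by (simp add: smul_def Poly_Mapping.map.rep_eq when_def)

interpretation smul: module smul
  by standard (auto intro!: poly_mapping_eqI simp: lookup_add algebra_simps)

lemma keys_smul: "Poly_Mapping.keys (smul c u) \<subseteq> Poly_Mapping.keys u"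
  by (auto simp: in_keys_iff)

lemma smul_minus_one [simp]: "smul (- 1) u = - u"
  by (metis smul.scale_minus_left smul.scale_one)

lemma smul_single: "smul c (Poly_Mapping.single x d) = Poly_Mapping.single x (c * d)"
  by (rule poly_mapping_eqI) (simp add: lookup_single when_def)

lemma keys_bvec: "Poly_Mapping.keys (bvec x :: 'b \<Rightarrow>\<^sub>0 'k::comm_ring_1) \<subseteq> {x}"
  by simp

text \<open>Supports of sums and multiples can shrink, so linear extensions are compared over a
  common finite index set.\<close>

lemma lin_ext_superset:
  assumes "finite S" "Poly_Mapping.keys u \<subseteq> S"
  shows "lin_ext h u = (\<Sum>x\<in>S. smul (Poly_Mapping.lookup u x) (h x))"
  unfolding lin_ext_def using assms by (intro sum.mono_neutral_left) (auto simp: in_keys_iff)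

lemma lin_ext_0 [simp]: "lin_ext h 0 = 0"
  by (simp add: lin_ext_def)

lemma lin_ext_add [simp]: "lin_ext h (u + v) = lin_ext h u + lin_ext h v"
proof -
  let ?S = "Poly_Mapping.keys u \<union> Poly_Mapping.keys v"
  have "Poly_Mapping.keys (u + v) \<subseteq> ?S" by (rule Poly_Mapping.keys_add)
  then show ?thesis
    by (simp add: lin_ext_superset[of ?S] lookup_add smul.scale_left_distrib sum.distrib)
qed

lemma lin_ext_smul [simp]: "lin_ext h (smul c u) = smul c (lin_ext h u)"
  using keys_smul[of c u]
  by (simp add: lin_ext_superset[of "Poly_Mapping.keys u"] smul.scale_sum_right)

lemma lin_ext_uminus [simp]: "lin_ext h (- u) = - lin_ext h u"
  using lin_ext_smul[of h "- 1" u] by simp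

lemma lin_ext_diff [simp]: "lin_ext h (u - v) = lin_ext h u - lin_ext h v"
  using lin_ext_add[of h u "- v"] by simp

lemma lin_ext_sum: "lin_ext h (sum f S) = (\<Sum>x\<in>S. lin_ext h (f x))"
  by (induction S rule: infinite_finite_induct) auto

lemma lin_ext_single [simp]: "lin_ext h (Poly_Mapping.single x c) = smul c (h x)"
  by (subst lin_ext_superset[of "{x}"]) auto

lemma lin_ext_cong:
  "(\<And>x. x \<in> Poly_Mapping.keys u \<Longrightarrow> f x = g x) \<Longrightarrow> lin_ext f u = lin_ext g u"
  by (simp add: lin_ext_def)

lemma lin_ext_bvec_id [simp]: "lin_ext bvec u = u"
  by (rule poly_mapping_eqI)
    (simp add: lin_ext_def smul_single lookup_sum lookup_single when_def in_keys_iff sum.delta')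

lemma lin_ext_comp: "lin_ext g (lin_ext f u) = lin_ext (\<lambda>x. lin_ext g (f x)) u"
  by (simp add: lin_ext_def[of f] lin_ext_def[of "\<lambda>x. lin_ext g (f x)"] lin_ext_sum)

lemma lin_ext_const_0 [simp]: "lin_ext (\<lambda>x. 0) u = 0"
  by (simp add: lin_ext_def)

lemma lin_ext_fun_add: "lin_ext (\<lambda>x. f x + g x) u = lin_ext f u + lin_ext g u"
  by (simp add: lin_ext_def smul.scale_right_distrib sum.distrib)

lemma lin_ext_fun_smul: "lin_ext (\<lambda>x. smul c (f x)) u = smul c (lin_ext f u)"
  by (simp add: lin_ext_def smul.scale_sum_right mult.commute)

lemma lin_ext_fun_uminus: "lin_ext (\<lambda>x. - f x) u = - lin_ext f u"
  using lin_ext_fun_smul[of "- 1" f u] by simp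

lemma lin_ext_fun_diff: "lin_ext (\<lambda>x. f x - g x) u = lin_ext f u - lin_ext g u"
  by (simp add: lin_ext_def smul.scale_right_diff_distrib sum_subtractf)

lemma lin_ext_swap:
  "lin_ext (\<lambda>x. lin_ext (\<lambda>y. h x y) v) u = lin_ext (\<lambda>y. lin_ext (\<lambda>x. h x y) u) v"
  unfolding lin_ext_def smul.scale_sum_right smul.scale_scale
  by (subst sum.swap) (simp add: mult.commute)

section \<open>Submodules spanned by part of the basis\<close>

lemma free_module_0 [simp]: "0 \<in> free_module B"
  by (simp add: free_module_def)

lemma free_module_add [simp]: "u \<in> free_module B \<Longrightarrow> v \<in> free_module B \<Longrightarrow> u + v \<in> free_module B"
  using Poly_Mapping.keys_add[of u v] by (auto simp: free_module_def)

lemma free_module_smul [simp]: "u \<in> free_module B \<Longrightarrow> smul c u \<in> free_module B"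
  using keys_smul[of c u] by (auto simp: free_module_def)

lemma free_module_uminus [simp]: "u \<in> free_module B \<Longrightarrow> - u \<in> free_module B"
  using free_module_smul[of u B "- 1"] by simp

lemma free_module_diff [simp]: "u \<in> free_module B \<Longrightarrow> v \<in> free_module B \<Longrightarrow> u - v \<in> free_module B"
  using free_module_add[of u B "- v"] by simp

lemma free_module_sum: "(\<And>x. x \<in> S \<Longrightarrow> f x \<in> free_module B) \<Longrightarrow> sum f S \<in> free_module B"
  by (induction S rule: infinite_finite_induct) auto

lemma free_module_bvec [simp]: "x \<in> B \<Longrightarrow> bvec x \<in> free_module B"
  using keys_bvec[of x] by (auto simp: free_module_def)

lemma free_module_mono: "B \<subseteq> C \<Longrightarrow> u \<in> free_module B \<Longrightarrow> u \<in> free_module C"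
  by (auto simp: free_module_def)

lemma free_module_keysD: "u \<in> free_module B \<Longrightarrow> x \<in> Poly_Mapping.keys u \<Longrightarrow> x \<in> B"
  by (auto simp: free_module_def)

lemma free_module_lin_ext:
  assumes "u \<in> free_module B" "\<And>x. x \<in> B \<Longrightarrow> h x \<in> free_module C"
  shows "lin_ext h u \<in> free_module C"
  unfolding lin_ext_def using assms
  by (intro free_module_sum free_module_smul) (auto dest: free_module_keysD)

lemma lin_ext_cong_free_module:
  assumes "u \<in> free_module B" "\<And>x. x \<in> B \<Longrightarrow> f x = g x"
  shows "lin_ext f u = lin_ext g u"
  using assms by (intro lin_ext_cong) (auto dest: free_module_keysD)

text \<open>The structure maps are constrained only on the free module of the basis, so additivity
  may be used only for partial sums that stay inside it; the induction therefore runs over finite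
  subsets of \<open>B\<close>.\<close>

lemma linear_maps_eq_lin_ext:
  assumes f: "f \<in> linear_maps (free_module B) M" and u: "u \<in> free_module B"
  shows "f u = lin_ext (\<lambda>x. f (bvec x)) u"
proof -
  have f_add: "f (v + w) = f v + f w" if "v \<in> free_module B" "w \<in> free_module B" for v w
    using f that by (auto simp: linear_maps_def)
  have f_smul: "f (smul c v) = smul c (f v)" if "v \<in> free_module B" for c v
    using f that by (auto simp: linear_maps_def)
  have f_0: "f 0 = 0"
    using f_smul[of 0 0] by simp
  have "f (\<Sum>x\<in>S. smul (c x) (bvec x)) = (\<Sum>x\<in>S. smul (c x) (f (bvec x)))"
    if "finite S" "S \<subseteq> B" for S c
    using that
  proof (induction S rule: finite_induct)
    case (insert x S)
    then have "f (smul (c x) (bvec x) + (\<Sum>x\<in>S. smul (c x) (bvec x)))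
        = f (smul (c x) (bvec x)) + f (\<Sum>x\<in>S. smul (c x) (bvec x))"
      by (intro f_add free_module_sum free_module_smul free_module_bvec) auto
    moreover have "f (smul (c x) (bvec x)) = smul (c x) (f (bvec x))"
      using insert.prems by (intro f_smul) auto
    ultimately show ?case
      using insert by simp
  qed (simp add: f_0)
  from this[of "Poly_Mapping.keys u" "Poly_Mapping.lookup u"] show ?thesis
    using u lin_ext_bvec_id[of u, unfolded lin_ext_def] by (simp add: lin_ext_def free_module_def)
qed

section \<open>Tensor products and the tensor algebra in coordinates\<close>

lemma tens_eq_lin_ext: "tens u v = lin_ext (\<lambda>x. lin_ext (\<lambda>y. bvec (x, y)) v) u"
  by (simp add: tens_def lin_ext_def smul.scale_sum_right smul_single)

lemma tens_bvec [simp]: "tens (bvec x) (bvec y) = (bvec (x, y) :: _ \<Rightarrow>\<^sub>0 'k::comm_ring_1)"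
  by (simp add: tens_eq_lin_ext)

lemma tens_bilinear [simp]:
  "tens (u + u') v = tens u v + tens u' v" "tens u (v + v') = tens u v + tens u v'"
  "tens (smul c u) v = smul c (tens u v)" "tens u (smul c v) = smul c (tens u v)"
  "tens 0 v = 0" "tens u 0 = 0" "tens (- u) v = - tens u v" "tens u (- v) = - tens u v"
  by (simp_all add: tens_eq_lin_ext lin_ext_fun_add lin_ext_fun_smul lin_ext_fun_uminus)

lemma free_module_tens:
  assumes "u \<in> free_module B" "v \<in> free_module C"
  shows "tens u v \<in> free_module (B \<times> C)"
  unfolding tens_eq_lin_ext using assms by (intro free_module_lin_ext) auto

lemma tens_map_bvec [simp]: "tens_map f g (bvec (x, y)) = tens (f (bvec x)) (g (bvec y))"
  by (simp add: tens_map_def)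

lemma assoc_bvec [simp]:
  "assoc_l (bvec (x, y, z)) = bvec ((x, y), z)" "assoc_r (bvec ((x, y), z)) = bvec (x, y, z)"
  by (simp_all add: assoc_l_def assoc_r_def)

text \<open>The product of the tensor algebra without the detour through \<open>tens\<close>, so
  that associativity follows from composing linear extensions.\<close>

definition conc :: "('b list \<Rightarrow>\<^sub>0 'k::comm_ring_1) \<Rightarrow> ('b list \<Rightarrow>\<^sub>0 'k) \<Rightarrow> ('b list \<Rightarrow>\<^sub>0 'k)" where
  "conc f g = lin_ext (\<lambda>v. lin_ext (\<lambda>w. bvec (v @ w)) g) f"

lemma mult_tensor_algebra [simp]: "f \<otimes>\<^bsub>tensor_algebra B\<^esub> g = conc f g"
  by (simp add: tensor_algebra_def conc_def tens_eq_lin_ext lin_ext_comp)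

lemma tensor_algebra_sel [simp]:
  "carrier (tensor_algebra B) = free_module (lists B)" "\<one>\<^bsub>tensor_algebra B\<^esub> = bvec []"
  "\<zero>\<^bsub>tensor_algebra B\<^esub> = 0" "f \<oplus>\<^bsub>tensor_algebra B\<^esub> g = f + g"
  by (simp_all add: tensor_algebra_def)

lemma conc_bilinear [simp]:
  "conc (f + f') g = conc f g + conc f' g" "conc f (g + g') = conc f g + conc f g'"
  "conc (smul c f) g = smul c (conc f g)" "conc f (smul c g) = smul c (conc f g)"
  "conc (f - f') g = conc f g - conc f' g" "conc f (g - g') = conc f g - conc f g'"
  by (simp_all add: conc_def lin_ext_fun_add lin_ext_fun_smul lin_ext_fun_diff)

lemma conc_bvec [simp]: "conc (bvec v) (bvec w) = (bvec (v @ w) :: _ \<Rightarrow>\<^sub>0 'k::comm_ring_1)"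
  by (simp add: conc_def)

lemma free_module_conc:
  "f \<in> free_module (lists B) \<Longrightarrow> g \<in> free_module (lists B) \<Longrightarrow> conc f g \<in> free_module (lists B)"
  unfolding conc_def by (intro free_module_lin_ext[of _ "lists B"]) auto

lemma conc_assoc: "conc (conc f g) h = conc f (conc g h)"
  by (simp add: conc_def lin_ext_comp)

lemma conc_Nil [simp]: "conc (bvec []) g = g" "conc f (bvec []) = f"
  by (simp_all add: conc_def)

lemma ring_tensor_algebra: "ring (tensor_algebra B :: ('b list \<Rightarrow>\<^sub>0 'k::comm_ring_1) ring)"
proof (rule ringI)
  show "abelian_group (tensor_algebra B :: ('b list \<Rightarrow>\<^sub>0 'k) ring)"
  proof (rule abelian_groupI)
    fix f :: "'b list \<Rightarrow>\<^sub>0 'k" assume "f \<in> carrier (tensor_algebra B)"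
    then show "\<exists>g\<in>carrier (tensor_algebra B). g \<oplus>\<^bsub>tensor_algebra B\<^esub> f = \<zero>\<^bsub>tensor_algebra B\<^esub>"
      by (intro bexI[of _ "- f"]) auto
  qed (auto simp: algebra_simps)
  show "monoid (tensor_algebra B :: ('b list \<Rightarrow>\<^sub>0 'k) ring)"
    by (rule monoidI) (auto simp: conc_assoc free_module_conc)
qed auto

section \<open>The q-symmetric algebra in the basis of sorted monomials\<close>

text \<open>The involution \<open>S\<close> forces \<open>q_coeff A x x\<close> to square to 1. If
  it differs from 1, the relator of \<open>x\<close> with itself makes a nonzero scalar annihilate
  \<open>z_x^2\<close>; with the value 1 this relator is zero, and all weakly increasing words are
  sorted monomials.\<close>

locale unital_T_Lie_algebra = basic_T_Lie_algebra A
  for A :: "('b, 'k::comm_ring_1) tlie_data" +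
  assumes q_diag: "x \<in> tbasis A \<Longrightarrow> q_coeff A x x = 1"

text \<open>\<open>qins A x \<Sigma>\<close> are the coordinates of \<open>z\<^sub>x z\<^sub>\<Sigma>\<close> in the basis of sorted monomials.\<close>

primrec qins :: "('b, 'k::comm_ring_1) tlie_data \<Rightarrow> 'b \<Rightarrow> 'b list \<Rightarrow> ('b list \<Rightarrow>\<^sub>0 'k)" where
  "qins A x [] = bvec [x]"
| "qins A x (y # N) =
     (if tless A x y \<or> x = y then bvec (x # y # N)
      else smul (q_coeff A x y) (lin_ext (\<lambda>M. bvec (y # M)) (qins A x N)))"

definition qmul :: "('b, 'k::comm_ring_1) tlie_data \<Rightarrow> 'b \<Rightarrow> ('b list \<Rightarrow>\<^sub>0 'k) \<Rightarrow> ('b list \<Rightarrow>\<^sub>0 'k)" where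
  "qmul A x = lin_ext (qins A x)"

text \<open>The candidate for the left regular representation, built on a module that is free by
  construction; \<open>foldr\<close> lets the last letter act first, as left multiplication
  requires.\<close>

definition word_act ::
    "('b, 'k::comm_ring_1) tlie_data \<Rightarrow> ('b list \<Rightarrow>\<^sub>0 'k) \<Rightarrow> ('b list \<Rightarrow>\<^sub>0 'k) \<Rightarrow> ('b list \<Rightarrow>\<^sub>0 'k)" where
  "word_act A f v = lin_ext (\<lambda>w. foldr (qmul A) w v) f"

lemma qmul_linear [simp]:
  "qmul A x (u + v) = qmul A x u + qmul A x v" "qmul A x (u - v) = qmul A x u - qmul A x v"
  "qmul A x (smul c u) = smul c (qmul A x u)" "qmul A x 0 = 0"
  "qmul A x (bvec \<Sigma>) = qins A x \<Sigma>"
  by (simp_all add: qmul_def)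

lemma foldr_qmul_linear [simp]:
  "foldr (qmul A) w (u + v) = foldr (qmul A) w u + foldr (qmul A) w v"
  "foldr (qmul A) w (smul c u) = smul c (foldr (qmul A) w u)"
  "foldr (qmul A) w 0 = 0"
  by (induction w) simp_all

lemma qmul_lin_ext: "qmul A x (lin_ext h u) = lin_ext (\<lambda>y. qmul A x (h y)) u"
  by (simp add: qmul_def lin_ext_comp)

lemma foldr_qmul_lin_ext:
  "foldr (qmul A) w (lin_ext h u) = lin_ext (\<lambda>y. foldr (qmul A) w (h y)) u"
  by (induction w) (simp_all add: qmul_lin_ext)

lemma word_act_linear [simp]:
  "word_act A (f + g) v = word_act A f v + word_act A g v"
  "word_act A (f - g) v = word_act A f v - word_act A g v"
  "word_act A (- f) v = - word_act A f v"
  "word_act A (smul c f) v = smul c (word_act A f v)"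
  "word_act A 0 v = 0" "word_act A f 0 = 0"
  "word_act A (bvec w) v = foldr (qmul A) w v"
  by (simp_all add: word_act_def)

lemma word_act_conc: "word_act A (conc f g) v = word_act A f (word_act A g v)"
  by (simp add: word_act_def conc_def lin_ext_comp foldr_qmul_lin_ext)

lemma qmul_Cons:
  "tless A x z \<or> x = z \<Longrightarrow>
     qmul A x (lin_ext (\<lambda>M. bvec (z # M)) v) = lin_ext (\<lambda>M. bvec (x # z # M)) v"
  "\<not> (tless A x z \<or> x = z) \<Longrightarrow>
     qmul A x (lin_ext (\<lambda>M. bvec (z # M)) v)
       = smul (q_coeff A x z) (lin_ext (\<lambda>M. bvec (z # M)) (qmul A x v))"
  by (simp_all add: qmul_def lin_ext_comp lin_ext_fun_smul)

context unital_T_Lie_algebra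
begin

abbreviation "B \<equiv> tbasis A"
abbreviation "V \<equiv> free_module (sequences A) :: ('b list \<Rightarrow>\<^sub>0 'k) set"
abbreviation q where "q x y \<equiv> q_coeff A x y"
abbreviation prec (infix "\<prec>" 50) where "x \<prec> y \<equiv> tless A x y"

section \<open>The scalars of S, the order of the basis and twisted insertion\<close>

lemma S_bvec: "x \<in> B \<Longrightarrow> y \<in> B \<Longrightarrow> tS A (bvec (x, y)) = smul (q x y) (bvec (y, x))"
proof -
  assume "x \<in> B" "y \<in> B"
  then obtain c where "tS A (bvec (x, y)) = smul c (bvec (y, x))"
    using S_diagonal by blast
  then show ?thesis by (simp add: q_coeff_def)
qed

lemma S_smul: "x \<in> B \<Longrightarrow> y \<in> B \<Longrightarrow> tS A (smul c (bvec (x, y))) = smul (c * q x y) (bvec (y, x))"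
proof -
  assume "x \<in> B" "y \<in> B"
  then have "tS A (smul c (bvec (x, y))) = smul c (tS A (bvec (x, y)))"
    using S_linear by (simp only: linear_maps_def mem_Collect_eq free_module_bvec mem_Times_iff fst_conv snd_conv)
  with S_bvec[OF \<open>x \<in> B\<close> \<open>y \<in> B\<close>] show ?thesis by simp
qed

lemma q_inverse: "x \<in> B \<Longrightarrow> y \<in> B \<Longrightarrow> q x y * q y x = 1"
proof -
  assume xy: "x \<in> B" "y \<in> B"
  then have "bvec (x, y) = tS A (smul (q x y) (bvec (y, x)))"
    using S_involution by (simp flip: S_bvec)
  also have "\<dots> = smul (q x y * q y x) (bvec (x, y))"
    using xy by (simp add: S_smul)
  finally have "Poly_Mapping.lookup (bvec (x, y) :: _ \<Rightarrow>\<^sub>0 'k) (x, y)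
      = Poly_Mapping.lookup (smul (q x y * q y x) (bvec (x, y))) (x, y)" by (rule arg_cong)
  then show ?thesis by simp
qed

lemma prec_irrefl: "x \<in> B \<Longrightarrow> \<not> x \<prec> x"
  using irreflp_onD[OF order_irrefl] by blast

lemma prec_trans: "x \<in> B \<Longrightarrow> y \<in> B \<Longrightarrow> z \<in> B \<Longrightarrow> x \<prec> y \<Longrightarrow> y \<prec> z \<Longrightarrow> x \<prec> z"
  using transp_onD[OF order_trans] by blast

lemma prec_total: "x \<in> B \<Longrightarrow> y \<in> B \<Longrightarrow> x \<prec> y \<or> x = y \<or> y \<prec> x"
  using totalp_onD[OF order_total] by blast

lemma prec_asym: "x \<in> B \<Longrightarrow> y \<in> B \<Longrightarrow> x \<prec> y \<Longrightarrow> \<not> y \<prec> x"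
  using prec_trans prec_irrefl by blast

lemma sequences_iff: "\<Sigma> \<in> sequences A \<longleftrightarrow> \<Sigma> \<in> lists B \<and> sorted_wrt (\<lambda>x y. x \<prec> y \<or> x = y) \<Sigma>"
  unfolding sequences_def using q_diag
  by (auto intro: sorted_wrt_mono_rel[rotated])

lemma sequences_Nil [simp]: "[] \<in> sequences A"
  by (simp add: sequences_iff)

lemma sequences_Cons:
  "y # N \<in> sequences A \<longleftrightarrow> y \<in> B \<and> N \<in> sequences A \<and> (\<forall>x\<in>set N. y \<prec> x \<or> y = x)"
  by (auto simp: sequences_iff)

lemma sequences_subset_lists: "\<Sigma> \<in> sequences A \<Longrightarrow> set \<Sigma> \<subseteq> B"
  by (auto simp: sequences_iff)

text \<open>Tracking the multiset serves two ends: the inserted letter keeps the old head minimal,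
  which gives sortedness, and insertion preserves the degree of a word, which the filtration uses
  later.\<close>

lemma keys_qins:
  assumes "x \<in> B" "\<Sigma> \<in> sequences A" "M \<in> Poly_Mapping.keys (qins A x \<Sigma>)"
  shows "M \<in> sequences A \<and> mset M = add_mset x (mset \<Sigma>)"
  using assms(2,3)
proof (induction \<Sigma> arbitrary: M)
  case Nil
  then show ?case using assms(1) by (auto simp: sequences_Cons split: if_splits)
next
  case (Cons y N)
  show ?case
  proof (cases "x \<prec> y \<or> x = y")
    case True
    with Cons.prems have "M = x # y # N" by (auto split: if_splits)
    moreover have "x \<prec> z \<or> x = z" if "z \<in> set N" for z
      using that True Cons.prems assms(1) sequences_subset_lists[of N] prec_trans[of x y z]
      by (auto simp: sequences_Cons)
    ultimately show ?thesis
      using True Cons.prems assms(1) by (auto simp: sequences_Cons)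
  next
    case False
    have "Poly_Mapping.keys (qins A x N) \<subseteq> {M. M \<in> sequences A \<and> mset M = add_mset x (mset N)}"
      using Cons by (auto simp: sequences_Cons)
    then have "qins A x N \<in> free_module {M. M \<in> sequences A \<and> mset M = add_mset x (mset N)}"
      by (simp add: free_module_def)
    moreover have "y # M \<in> sequences A \<and> mset (y # M) = add_mset x (mset (y # N))"
      if "M \<in> sequences A \<and> mset M = add_mset x (mset N)" for M
    proof -
      have "set M = insert x (set N)"
        using that by (metis set_mset_add_mset_insert set_mset_mset)
      then show ?thesis
        using that False Cons.prems assms(1) prec_total[of x y] by (auto simp: sequences_Cons)
    qed
    ultimately have "lin_ext (\<lambda>M. bvec (y # M)) (qins A x N)
        \<in> free_module {M. M \<in> sequences A \<and> mset M = add_mset x (mset (y # N))}"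
      by (intro free_module_lin_ext) auto
    then have "qins A x (y # N) \<in> free_module {M. M \<in> sequences A \<and> mset M = add_mset x (mset (y # N))}"
      using False by simp
    then show ?thesis using Cons.prems(2) by (auto dest: free_module_keysD)
  qed
qed

lemma qins_in_V: "x \<in> B \<Longrightarrow> \<Sigma> \<in> sequences A \<Longrightarrow> qins A x \<Sigma> \<in> V"
  using keys_qins by (auto simp: free_module_def)

lemma qmul_in_V: "x \<in> B \<Longrightarrow> v \<in> V \<Longrightarrow> qmul A x v \<in> V"
  unfolding qmul_def by (rule free_module_lin_ext) (auto intro: qins_in_V)

lemma foldr_qmul_in_V: "w \<in> lists B \<Longrightarrow> v \<in> V \<Longrightarrow> foldr (qmul A) w v \<in> V"
  by (induction w) (auto intro: qmul_in_V)

lemma word_act_in_V: "f \<in> free_module (lists B) \<Longrightarrow> v \<in> V \<Longrightarrow> word_act A f v \<in> V"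
  unfolding word_act_def by (rule free_module_lin_ext) (auto intro: foldr_qmul_in_V)

lemma qins_below: "below A x \<Sigma> \<Longrightarrow> qins A x \<Sigma> = bvec (x # \<Sigma>)"
  by (cases \<Sigma>) (auto simp: below_def)

text \<open>A head below both letters gives the same two factors in either order of insertion, and
  the induction passes over it. The orders differ only in that the larger \<open>y\<close> has to
  pass \<open>x\<close> when it comes second.\<close>

lemma qmul_qins_less:
  assumes "x \<in> B" "y \<in> B" "x \<prec> y" "\<Sigma> \<in> sequences A"
  shows "qmul A y (qins A x \<Sigma>) = smul (q y x) (qmul A x (qins A y \<Sigma>))"
  using assms(4)
proof (induction \<Sigma>)
  case Nil
  then show ?case using assms prec_asym[of x y] prec_irrefl by auto
next
  case (Cons z N)
  then have z: "z \<in> B" and N: "N \<in> sequences A" by (auto simp: sequences_Cons)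
  note IH = Cons.IH[OF N]
  have yx: "\<not> (y \<prec> x \<or> y = x)" using assms prec_asym[of x y] prec_irrefl by auto
  consider "y \<prec> z \<or> y = z" | "\<not> (y \<prec> z \<or> y = z)" "x \<prec> z \<or> x = z" | "\<not> (y \<prec> z \<or> y = z)" "\<not> (x \<prec> z \<or> x = z)"
    by blast
  then show ?case
  proof cases
    case 1
    then have "x \<prec> z" using assms z prec_trans by blast
    with 1 yx assms(3) show ?thesis by auto
  next
    case 2
    have "qmul A y (qins A x (z # N)) = smul (q y x * q y z) (lin_ext (\<lambda>M. bvec (x # z # M)) (qins A y N))"
      using 2 yx by (simp add: lin_ext_comp)
    moreover have "qmul A x (qins A y (z # N)) = smul (q y z) (lin_ext (\<lambda>M. bvec (x # z # M)) (qins A y N))"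
      using 2 by (simp add: qmul_Cons(1))
    ultimately show ?thesis by simp
  next
    case 3
    have "qmul A y (qins A x (z # N))
        = smul (q x z * q y z) (lin_ext (\<lambda>M. bvec (z # M)) (qmul A y (qins A x N)))"
      using 3 by (simp add: qmul_Cons(2))
    moreover have "qmul A x (qins A y (z # N))
        = smul (q y z * q x z) (lin_ext (\<lambda>M. bvec (z # M)) (qmul A x (qins A y N)))"
      using 3 by (simp add: qmul_Cons(2))
    ultimately show ?thesis
      using IH by (simp add: mult_ac)
  qed
qed

lemma qmul_qins:
  assumes "x \<in> B" "y \<in> B" "\<Sigma> \<in> sequences A"
  shows "qmul A x (qins A y \<Sigma>) = smul (q x y) (qmul A y (qins A x \<Sigma>))"
proof -
  consider "y \<prec> x" | "x = y" | "x \<prec> y" using prec_total assms by blast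
  then show ?thesis
  proof cases
    case 1 then show ?thesis using qmul_qins_less assms by blast
  next
    case 2 then show ?thesis using q_diag assms by simp
  next
    case 3 then show ?thesis using qmul_qins_less[of x y \<Sigma>] assms q_inverse[of x y] by simp
  qed
qed

lemma qmul_commute:
  assumes "x \<in> B" "y \<in> B" "v \<in> V"
  shows "qmul A x (qmul A y v) = smul (q x y) (qmul A y (qmul A x v))"
proof -
  have "qmul A x (qmul A y v) = lin_ext (\<lambda>\<Sigma>. qmul A x (qins A y \<Sigma>)) v"
    by (subst qmul_def[of A y]) (rule qmul_lin_ext)
  also have "\<dots> = lin_ext (\<lambda>\<Sigma>. smul (q x y) (qmul A y (qins A x \<Sigma>))) v"
    by (rule lin_ext_cong_free_module[OF assms(3) qmul_qins[OF assms(1,2)]])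
  also have "\<dots> = smul (q x y) (qmul A y (qmul A x v))"
    by (subst qmul_def[of A x]) (simp add: qmul_lin_ext lin_ext_fun_smul)
  finally show ?thesis .
qed

lemma foldr_qmul_sequences: "\<Sigma> \<in> sequences A \<Longrightarrow> foldr (qmul A) \<Sigma> (bvec []) = bvec \<Sigma>"
proof (induction \<Sigma>)
  case (Cons y N)
  then have "below A y N" by (cases N) (auto simp: sequences_Cons below_def)
  with Cons show ?case by (simp add: sequences_Cons qins_below)
qed simp

lemma word_act_V: "v \<in> V \<Longrightarrow> word_act A v (bvec []) = v"
  unfolding word_act_def
  by (subst lin_ext_cong_free_module[where g = bvec]) (auto simp: foldr_qmul_sequences)

lemma V_subset_tensor: "v \<in> V \<Longrightarrow> v \<in> free_module (lists B)"
  by (erule free_module_mono[rotated]) (auto simp: sequences_iff)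

section \<open>The ideal of relations and normal forms\<close>

abbreviation "R \<equiv> tensor_algebra B :: ('b list \<Rightarrow>\<^sub>0 'k) ring"

definition relator :: "'b \<Rightarrow> 'b \<Rightarrow> ('b list \<Rightarrow>\<^sub>0 'k)" where
  "relator x y = bvec [x, y] - smul (q x y) (bvec [y, x])"

lemma sym_ideal_eq: "sym_ideal A = genideal R {relator x y | x y. x \<in> B \<and> y \<in> B}"
proof -
  have "lin_ext (\<lambda>(v, w). bvec [v, w]) (bvec (x, y) - tS A (bvec (x, y))) = relator x y"
    if "x \<in> B" "y \<in> B" for x y
    using that by (simp add: S_bvec relator_def)
  then show ?thesis
    unfolding sym_ideal_def by (intro arg_cong[of _ _ "genideal R"]) (auto, metis)
qed

lemma relators_subset: "{relator x y | x y. x \<in> B \<and> y \<in> B} \<subseteq> carrier R"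
  by (auto simp: relator_def)

lemma sym_ideal_ideal: "ideal (sym_ideal A) R"
  unfolding sym_ideal_eq by (rule ring.genideal_ideal[OF ring_tensor_algebra relators_subset])

lemma a_inv_R: "f \<in> carrier R \<Longrightarrow> \<ominus>\<^bsub>R\<^esub> f = - f"
  by (rule abelian_group.minus_equality[OF ring.is_abelian_group[OF ring_tensor_algebra]]) auto

lemma a_minus_R: "f \<in> carrier R \<Longrightarrow> g \<in> carrier R \<Longrightarrow> f \<ominus>\<^bsub>R\<^esub> g = f - g"
  by (simp add: a_minus_def a_inv_R)

text \<open>Annihilators of modules are two-sided ideals; this one therefore contains the whole
  ideal of relations as soon as it contains the relators.\<close>

lemma annihilator_ideal: "ideal {f \<in> carrier R. \<forall>v\<in>V. word_act A f v = 0} R"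
proof (rule idealI[OF ring_tensor_algebra])
  show "subgroup {f \<in> carrier R. \<forall>v\<in>V. word_act A f v = 0} (add_monoid R)"
  proof (rule group.subgroupI)
    show "Group.group (add_monoid R)"
      using abelian_group.a_group[OF ring.is_abelian_group[OF ring_tensor_algebra]] .
    show "{f \<in> carrier R. \<forall>v\<in>V. word_act A f v = 0} \<noteq> {}"
      by (auto intro!: exI[of _ 0])
    fix f assume "f \<in> {f \<in> carrier R. \<forall>v\<in>V. word_act A f v = 0}"
    then show "inv\<^bsub>add_monoid R\<^esub> f \<in> {f \<in> carrier R. \<forall>v\<in>V. word_act A f v = 0}"
      using a_inv_R[of f] unfolding a_inv_def by auto
  qed auto
qed (auto simp: word_act_conc word_act_in_V free_module_conc)

lemma word_act_sym_ideal:
  assumes "f \<in> sym_ideal A" "v \<in> V"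
  shows "word_act A f v = 0"
proof -
  have "{relator x y | x y. x \<in> B \<and> y \<in> B} \<subseteq> {f \<in> carrier R. \<forall>v\<in>V. word_act A f v = 0}"
  proof clarify
    fix x y assume xy: "x \<in> B" "y \<in> B"
    have "word_act A (relator x y) v = 0" if "v \<in> V" for v
      using qmul_commute[OF xy that] by (simp add: relator_def)
    with xy relators_subset show "relator x y \<in> carrier R \<and> (\<forall>v\<in>V. word_act A (relator x y) v = 0)"
      by blast
  qed
  then have "sym_ideal A \<subseteq> {f \<in> carrier R. \<forall>v\<in>V. word_act A f v = 0}"
    unfolding sym_ideal_eq by (rule ring.genideal_minimal[OF ring_tensor_algebra annihilator_ideal])
  with assms show ?thesis by auto
qed

abbreviation "S \<equiv> sym_algebra A"

lemma sym_ideal_closed: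
  "f \<in> sym_ideal A \<Longrightarrow> g \<in> sym_ideal A \<Longrightarrow> f + g \<in> sym_ideal A"
  "0 \<in> sym_ideal A"
  "f \<in> carrier R \<Longrightarrow> g \<in> sym_ideal A \<Longrightarrow> conc f g \<in> sym_ideal A"
  "f \<in> sym_ideal A \<Longrightarrow> g \<in> carrier R \<Longrightarrow> conc f g \<in> sym_ideal A"
  using additive_subgroup.a_closed[OF ideal.axioms(1)[OF sym_ideal_ideal], of f g]
    additive_subgroup.zero_closed[OF ideal.axioms(1)[OF sym_ideal_ideal]]
    ideal.I_l_closed[OF sym_ideal_ideal, of g f] ideal.I_r_closed[OF sym_ideal_ideal, of f g]
  by simp_all

lemma sym_ideal_smul: "f \<in> sym_ideal A \<Longrightarrow> smul c f \<in> sym_ideal A"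
  using sym_ideal_closed(3)[of "smul c (bvec [])" f] by simp

lemma sym_ideal_sum: "(\<And>x. x \<in> K \<Longrightarrow> f x \<in> sym_ideal A) \<Longrightarrow> sum f K \<in> sym_ideal A"
  by (induction K rule: infinite_finite_induct) (auto simp: sym_ideal_closed)

lemma sym_ideal_lin_ext:
  "u \<in> free_module C \<Longrightarrow> (\<And>x. x \<in> C \<Longrightarrow> h x \<in> sym_ideal A) \<Longrightarrow> lin_ext h u \<in> sym_ideal A"
  unfolding lin_ext_def by (intro sym_ideal_sum sym_ideal_smul) (auto dest: free_module_keysD)

lemma relator_sym_ideal: "x \<in> B \<Longrightarrow> y \<in> B \<Longrightarrow> relator x y \<in> sym_ideal A"
  unfolding sym_ideal_eq using ring.genideal_self[OF ring_tensor_algebra relators_subset] by blast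

lemma conc_single: "conc (bvec [y]) u = lin_ext (\<lambda>M. bvec (y # M)) u"
  by (simp add: conc_def)

text \<open>Each letter that is passed costs one relator multiplied by the rest of the word, so
  insertion is left multiplication modulo the ideal.\<close>

lemma qins_congruent:
  assumes "x \<in> B" "\<Sigma> \<in> sequences A"
  shows "bvec (x # \<Sigma>) - qins A x \<Sigma> \<in> sym_ideal A"
  using assms(2)
proof (induction \<Sigma>)
  case Nil
  then show ?case by (simp add: sym_ideal_closed)
next
  case (Cons y N)
  then have y: "y \<in> B" and N: "N \<in> sequences A" by (auto simp: sequences_Cons)
  show ?case
  proof (cases "x \<prec> y \<or> x = y")
    case True
    then show ?thesis by (simp add: sym_ideal_closed)
  next
    case False
    have "bvec (x # y # N) - qins A x (y # N)
        = conc (relator x y) (bvec N) + smul (q x y) (conc (bvec [y]) (bvec (x # N) - qins A x N))"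
      using False by (simp add: relator_def conc_single smul.scale_right_diff_distrib)
    moreover have "bvec N \<in> carrier R"
      using N by (simp add: sequences_iff)
    ultimately show ?thesis
      using Cons.IH[OF N] y assms(1) relator_sym_ideal[of x y]
      by (simp add: sym_ideal_closed sym_ideal_smul del: conc_bilinear)
  qed
qed

lemma qmul_congruent:
  assumes "x \<in> B" "v \<in> V"
  shows "conc (bvec [x]) v - qmul A x v \<in> sym_ideal A"
proof -
  have "conc (bvec [x]) v - qmul A x v = lin_ext (\<lambda>\<Sigma>. bvec (x # \<Sigma>) - qins A x \<Sigma>) v"
    by (simp add: conc_single qmul_def lin_ext_fun_diff)
  then show ?thesis
    using sym_ideal_lin_ext[OF assms(2)] qins_congruent[OF assms(1)] by simp
qed

lemma word_congruent:
  "w \<in> lists B \<Longrightarrow> bvec w - foldr (qmul A) w (bvec []) \<in> sym_ideal A"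
proof (induction w)
  case Nil
  then show ?case by (simp add: sym_ideal_closed)
next
  case (Cons x w)
  let ?v = "foldr (qmul A) w (bvec [])"
  have "?v \<in> V"
    using Cons.prems by (intro foldr_qmul_in_V) auto
  then have "conc (bvec [x]) (bvec w - ?v) + (conc (bvec [x]) ?v - qmul A x ?v) \<in> sym_ideal A"
    using Cons by (intro sym_ideal_closed(1,3) qmul_congruent) auto
  then show ?case by simp
qed

text \<open>Acting on the empty word sorts a tensor by successive insertions, each of which changes
  it only within the ideal: the spanning half of the basis statement.\<close>

lemma congruent_normal_form:
  assumes "f \<in> carrier R"
  shows "f - word_act A f (bvec []) \<in> sym_ideal A"
proof -
  have "f - word_act A f (bvec []) = lin_ext (\<lambda>w. bvec w - foldr (qmul A) w (bvec [])) f"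
    by (simp add: word_act_def lin_ext_fun_diff)
  then show ?thesis
    using assms sym_ideal_lin_ext[of f "lists B"] word_congruent by simp
qed

lemma sym_class_eq_iff:
  assumes "f \<in> carrier R" "g \<in> carrier R"
  shows "sym_class A f = sym_class A g \<longleftrightarrow> f - g \<in> sym_ideal A"
  using ring.quotient_eq_iff_same_a_r_cos[OF ring_tensor_algebra sym_ideal_ideal assms] assms
  by (simp add: sym_class_def a_minus_R)

text \<open>Elements of the ideal act as zero, in particular on the empty word, where a combination
  of sorted monomials returns itself: the independence half of the basis statement.\<close>

lemma sym_class_inj: "u \<in> V \<Longrightarrow> v \<in> V \<Longrightarrow> sym_class A u = sym_class A v \<longleftrightarrow> u = v"
proof
  assume uv: "u \<in> V" "v \<in> V" "sym_class A u = sym_class A v"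
  then have "u - v \<in> sym_ideal A"
    using sym_class_eq_iff[of u v] V_subset_tensor by simp
  then have "word_act A (u - v) (bvec []) = 0"
    by (rule word_act_sym_ideal) simp
  then show "u = v"
    using uv by (simp add: word_act_V)
qed simp

lemma sym_class_hom: "sym_class A \<in> ring_hom R S"
  using ideal.rcos_ring_hom[OF sym_ideal_ideal] by (simp add: sym_class_def[abs_def] sym_algebra_def)

section \<open>Computing in the quotient by coordinates\<close>

lemma ring_sym_algebra: "ring S"
  unfolding sym_algebra_def by (rule ideal.quotient_is_ring[OF sym_ideal_ideal])

lemma sym_class_carrier: "f \<in> carrier R \<Longrightarrow> sym_class A f \<in> carrier S"
  by (rule ring_hom_closed[OF sym_class_hom])

lemma sym_class_carrier_V [simp]: "v \<in> V \<Longrightarrow> sym_class A v \<in> carrier S"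
  using sym_class_carrier V_subset_tensor by simp

lemma sym_class_add: "f \<in> carrier R \<Longrightarrow> g \<in> carrier R \<Longrightarrow> sym_class A f \<oplus>\<^bsub>S\<^esub> sym_class A g = sym_class A (f + g)"
  using ring_hom_add[OF sym_class_hom, of f g] by simp

lemma sym_class_mult: "f \<in> carrier R \<Longrightarrow> g \<in> carrier R \<Longrightarrow> sym_class A f \<otimes>\<^bsub>S\<^esub> sym_class A g = sym_class A (conc f g)"
  using ring_hom_mult[OF sym_class_hom, of f g] by simp

lemma sym_class_minus:
  assumes "f \<in> carrier R" "g \<in> carrier R"
  shows "sym_class A f \<ominus>\<^bsub>S\<^esub> sym_class A g = sym_class A (f - g)"
proof -
  interpret ring_hom_ring R S "sym_class A"
    by (intro ring_hom_ringI2 ring_tensor_algebra ring_sym_algebra sym_class_hom)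
  have "sym_class A (f \<ominus>\<^bsub>R\<^esub> g) = sym_class A f \<ominus>\<^bsub>S\<^esub> sym_class A g"
    unfolding a_minus_def using assms hom_add[of f "\<ominus>\<^bsub>R\<^esub> g"] hom_a_inv[of g] R.a_inv_closed[of g] by simp
  then show ?thesis using assms by (simp add: a_minus_R)
qed

lemma sym_class_V [simp]:
  assumes "u \<in> V" "v \<in> V"
  shows "sym_class A u \<oplus>\<^bsub>S\<^esub> sym_class A v = sym_class A (u + v)"
    and "sym_class A u \<ominus>\<^bsub>S\<^esub> sym_class A v = sym_class A (u - v)"
  using assms V_subset_tensor by (simp_all add: sym_class_add sym_class_minus)

lemma sym_scale_class [simp]: "v \<in> V \<Longrightarrow> sym_scale A c (sym_class A v) = sym_class A (smul c v)"
  unfolding sym_scale_def using V_subset_tensor by (simp add: sym_class_mult)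

lemma zgen_mult_class [simp]:
  assumes "x \<in> B" "v \<in> V"
  shows "zgen A x \<otimes>\<^bsub>S\<^esub> sym_class A v = sym_class A (qmul A x v)"
  using assms V_subset_tensor[of v] V_subset_tensor[OF qmul_in_V[of x v]] qmul_congruent[of x v]
  by (simp add: zgen_def sym_class_mult sym_class_eq_iff free_module_conc)

text \<open>The leading product in the recursion is bracketed to the left, while coordinates
  describe left multiplication by one generator at a time.\<close>

lemma zgen_zgen_mult_class [simp]:
  assumes "x \<in> B" "y \<in> B" "v \<in> V"
  shows "zgen A y \<otimes>\<^bsub>S\<^esub> zgen A x \<otimes>\<^bsub>S\<^esub> sym_class A v = sym_class A (qmul A y (qmul A x v))"
proof -
  have "zgen A y \<otimes>\<^bsub>S\<^esub> zgen A x \<otimes>\<^bsub>S\<^esub> sym_class A v = zgen A y \<otimes>\<^bsub>S\<^esub> (zgen A x \<otimes>\<^bsub>S\<^esub> sym_class A v)"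
    using assms by (intro monoid.m_assoc[OF ring.is_monoid[OF ring_sym_algebra]])
      (auto simp: zgen_def intro: sym_class_carrier)
  with assms qmul_in_V show ?thesis by simp
qed

lemma zmon_eq_class [simp]: "\<Sigma> \<in> sequences A \<Longrightarrow> zmon A \<Sigma> = sym_class A (bvec \<Sigma>)"
proof (induction \<Sigma>)
  case Nil
  then show ?case
    using ring_hom_one[OF sym_class_hom] by (simp add: zmon_def)
next
  case (Cons y N)
  then have "below A y N" by (cases N) (auto simp: sequences_Cons below_def)
  with Cons show ?case by (simp add: zmon_def sequences_Cons qins_below)
qed

lemma sym_algebra_exhaust: "s \<in> carrier S \<Longrightarrow> \<exists>v\<in>V. s = sym_class A v"
proof -
  assume "s \<in> carrier S"
  then obtain f where f: "f \<in> carrier R" "s = sym_class A f"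
    by (auto simp: sym_algebra_def FactRing_def A_RCOSETS_def' sym_class_def)
  have "word_act A f (bvec []) \<in> V"
    using f word_act_in_V[of f "bvec []"] by simp
  moreover have "sym_class A f = sym_class A (word_act A f (bvec []))"
    using f congruent_normal_form[of f] V_subset_tensor[OF calculation] by (simp add: sym_class_eq_iff)
  ultimately show ?thesis using f by blast
qed

definition coord :: "('b list \<Rightarrow>\<^sub>0 'k) set \<Rightarrow> ('b list \<Rightarrow>\<^sub>0 'k)" where
  "coord s = (THE v. v \<in> V \<and> s = sym_class A v)"

lemma coord_class [simp]: "v \<in> V \<Longrightarrow> coord (sym_class A v) = v"
  unfolding coord_def by (rule the_equality) (auto simp: sym_class_inj)

lemma class_coord [simp]: "s \<in> carrier S \<Longrightarrow> sym_class A (coord s) = s"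
  and coord_in_V [simp]: "s \<in> carrier S \<Longrightarrow> coord s \<in> V"
  by (auto dest!: sym_algebra_exhaust)

lemma finsum_sym_class:
  assumes "finite K" "\<And>i. i \<in> K \<Longrightarrow> g i \<in> V"
  shows "finsum S (\<lambda>i. sym_class A (g i)) K = sym_class A (\<Sum>i\<in>K. g i)"
  using assms
proof (induction K rule: finite_induct)
  case empty
  interpret ring_hom_ring R S "sym_class A"
    by (intro ring_hom_ringI2 ring_tensor_algebra ring_sym_algebra sym_class_hom)
  show ?case using hom_zero by simp
next
  case (insert i K)
  interpret S: ring S by (rule ring_sym_algebra)
  have "sum g K \<in> V"
    using insert by (intro free_module_sum) auto
  with insert show ?case
    by (subst S.finsum_insert) auto
qed

end

section \<open>The canonical map in coordinates\<close>

text \<open>The actions of \<open>L\<close> and \<open>L \<otimes> L\<close> on coordinate vectors given by a family \<open>Y x \<Sigma>\<close> of values \<open>x \<cdot> z\<^sub>\<Sigma>\<close>.\<close>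

definition vact :: "('b \<Rightarrow> 'b list \<Rightarrow> ('b list \<Rightarrow>\<^sub>0 'k::comm_ring_1)) \<Rightarrow> ('b \<Rightarrow>\<^sub>0 'k) \<Rightarrow> ('b list \<Rightarrow>\<^sub>0 'k) \<Rightarrow> ('b list \<Rightarrow>\<^sub>0 'k)" where
  "vact Y l v = lin_ext (\<lambda>x. lin_ext (Y x) v) l"

definition tact :: "('b \<Rightarrow> 'b list \<Rightarrow> ('b list \<Rightarrow>\<^sub>0 'k::comm_ring_1)) \<Rightarrow> ('b \<times> 'b \<Rightarrow>\<^sub>0 'k) \<Rightarrow> ('b list \<Rightarrow>\<^sub>0 'k) \<Rightarrow> ('b list \<Rightarrow>\<^sub>0 'k)" where
  "tact Y w v = lin_ext (\<lambda>(a, b). vact Y (bvec a) (vact Y (bvec b) v)) w"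

lemma vact_bilinear [simp]:
  "vact Y (l + l') v = vact Y l v + vact Y l' v" "vact Y l (u + v) = vact Y l u + vact Y l v"
  "vact Y (l - l') v = vact Y l v - vact Y l' v" "vact Y l (u - v) = vact Y l u - vact Y l v"
  "vact Y (- l) v = - vact Y l v" "vact Y l (- v) = - vact Y l v"
  "vact Y (smul c l) v = smul c (vact Y l v)" "vact Y l (smul c v) = smul c (vact Y l v)"
  "vact Y 0 v = 0" "vact Y l 0 = 0"
  "vact Y (bvec x) (bvec \<Sigma>) = Y x \<Sigma>"
  by (simp_all add: vact_def lin_ext_fun_add lin_ext_fun_diff lin_ext_fun_smul lin_ext_fun_uminus)

lemma vact_lin_ext:
  "vact Y (lin_ext h u) v = lin_ext (\<lambda>x. vact Y (h x) v) u"
  "vact Y l (lin_ext g v) = lin_ext (\<lambda>x. vact Y l (g x)) v"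
  by (simp_all add: vact_def lin_ext_comp lin_ext_swap[of _ v l])

lemma tact_bilinear [simp]:
  "tact Y (w + w') v = tact Y w v + tact Y w' v" "tact Y w (u + v) = tact Y w u + tact Y w v"
  "tact Y (w - w') v = tact Y w v - tact Y w' v" "tact Y w (u - v) = tact Y w u - tact Y w v"
  "tact Y (- w) v = - tact Y w v" "tact Y w (- v) = - tact Y w v"
  "tact Y (smul c w) v = smul c (tact Y w v)" "tact Y w (smul c v) = smul c (tact Y w v)"
  "tact Y 0 v = 0" "tact Y w 0 = 0"
  "tact Y (bvec (x, y)) v = vact Y (bvec x) (vact Y (bvec y) v)"
  by (simp_all add: tact_def lin_ext_fun_add lin_ext_fun_diff lin_ext_fun_smul lin_ext_fun_uminus
      case_prod_unfold)

lemma tact_lin_ext: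
  "tact Y (lin_ext h u) v = lin_ext (\<lambda>x. tact Y (h x) v) u"
  "tact Y w (lin_ext g v) = lin_ext (\<lambda>x. tact Y w (g x)) v"
  by (simp_all add: tact_def lin_ext_comp vact_lin_ext case_prod_unfold lin_ext_swap[of _ v w])

lemma tact_tens: "tact Y (tens l l') v = vact Y l (vact Y l' v)"
  by (simp add: tact_def tens_eq_lin_ext lin_ext_comp vact_def)

text \<open>One unfolding of the recursion as an operator on families; canonical maps correspond to
  its fixed points. \<open>hd\<close> and \<open>tl\<close> are read only if \<open>below\<close>
  fails, which excludes the empty sequence.\<close>

definition canon_step ::
    "('b, 'k::comm_ring_1) tlie_data \<Rightarrow> ('b \<Rightarrow> 'b list \<Rightarrow> ('b list \<Rightarrow>\<^sub>0 'k)) \<Rightarrow> 'b \<Rightarrow> 'b list \<Rightarrow> ('b list \<Rightarrow>\<^sub>0 'k)" where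
  "canon_step A Y x \<Sigma> = (if below A x \<Sigma> then qins A x \<Sigma> else
     smul (q_coeff A x (hd \<Sigma>)) (qmul A (hd \<Sigma>) (qins A x (tl \<Sigma>)))
     + smul (q_coeff A x (hd \<Sigma>)) (vact Y (bvec (hd \<Sigma>)) (Y x (tl \<Sigma>) - qins A x (tl \<Sigma>)))
     + tact Y (tpair A (bvec (x, hd \<Sigma>))) (bvec (tl \<Sigma>))
     + vact Y (tbr A (bvec (x, hd \<Sigma>))) (bvec (tl \<Sigma>)))"

context unital_T_Lie_algebra
begin

abbreviation "L \<equiv> free_module B :: ('b \<Rightarrow>\<^sub>0 'k) set"
abbreviation "L2 \<equiv> free_module (B \<times> B) :: ('b \<times> 'b \<Rightarrow>\<^sub>0 'k) set"

lemma tS_L2 [simp]: "w \<in> L2 \<Longrightarrow> tS A w \<in> L2"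
  and tT_L2 [simp]: "w \<in> L2 \<Longrightarrow> tT A w \<in> L2"
  and tpair_L2 [simp]: "w \<in> L2 \<Longrightarrow> tpair A w \<in> L2"
  and tbr_L [simp]: "w \<in> L2 \<Longrightarrow> tbr A w \<in> L"
  using S_linear T_linear pair_linear br_linear by (auto simp: linear_maps_def)

definition closed_family :: "('b \<Rightarrow> 'b list \<Rightarrow> ('b list \<Rightarrow>\<^sub>0 'k)) \<Rightarrow> bool" where
  "closed_family Y \<longleftrightarrow> (\<forall>x\<in>B. \<forall>\<Sigma>\<in>sequences A. Y x \<Sigma> \<in> V)"

definition canonical_family :: "('b \<Rightarrow> 'b list \<Rightarrow> ('b list \<Rightarrow>\<^sub>0 'k)) \<Rightarrow> bool" where
  "canonical_family Y \<longleftrightarrow> closed_family Y \<and> (\<forall>x\<in>B. \<forall>\<Sigma>\<in>sequences A. Y x \<Sigma> = canon_step A Y x \<Sigma>)"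

definition represents :: "('b \<Rightarrow> 'b list \<Rightarrow> ('b list \<Rightarrow>\<^sub>0 'k)) \<Rightarrow> ('b, 'k) action \<Rightarrow> bool" where
  "represents Y act \<longleftrightarrow> closed_family Y \<and> (\<forall>l\<in>L. \<forall>v\<in>V. act l (sym_class A v) = sym_class A (vact Y l v))"

lemma closed_familyD: "closed_family Y \<Longrightarrow> x \<in> B \<Longrightarrow> \<Sigma> \<in> sequences A \<Longrightarrow> Y x \<Sigma> \<in> V"
  by (simp add: closed_family_def)

lemma vact_in_V: "closed_family Y \<Longrightarrow> l \<in> L \<Longrightarrow> v \<in> V \<Longrightarrow> vact Y l v \<in> V"
  unfolding vact_def by (intro free_module_lin_ext[of _ B] free_module_lin_ext[of _ "sequences A"])
    (auto intro: closed_familyD)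

lemma tact_in_V: "closed_family Y \<Longrightarrow> w \<in> L2 \<Longrightarrow> v \<in> V \<Longrightarrow> tact Y w v \<in> V"
  unfolding tact_def by (intro free_module_lin_ext[of _ "B \<times> B"]) (auto intro!: vact_in_V)

lemma represents_act:
  "represents Y act \<Longrightarrow> l \<in> L \<Longrightarrow> v \<in> V \<Longrightarrow> act l (sym_class A v) = sym_class A (vact Y l v)"
  by (simp add: represents_def)

lemma represents_act2:
  assumes "represents Y act" "w \<in> L2" "v \<in> V"
  shows "act2 A act w (sym_class A v) = sym_class A (tact Y w v)"
proof -
  have cl: "closed_family Y" using assms(1) by (simp add: represents_def)
  have key: "fst p \<in> B" "snd p \<in> B" if "p \<in> Poly_Mapping.keys w" for p
    using free_module_keysD[OF assms(2) that] by auto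
  have "act2 A act w (sym_class A v) = finsum S (\<lambda>p. sym_class A
      (smul (Poly_Mapping.lookup w p) (vact Y (bvec (fst p)) (vact Y (bvec (snd p)) v)))) (Poly_Mapping.keys w)"
    unfolding act2_def case_prod_unfold
  proof (rule abelian_monoid.finsum_cong')
    show "abelian_monoid S"
      using ring_sym_algebra by (simp add: ring.is_abelian_group abelian_group.axioms(1))
  qed (auto simp: represents_act[OF assms(1)] assms(3) key vact_in_V[OF cl])
  also have "\<dots> = sym_class A (\<Sum>p\<in>Poly_Mapping.keys w.
      smul (Poly_Mapping.lookup w p) (vact Y (bvec (fst p)) (vact Y (bvec (snd p)) v)))"
    by (rule finsum_sym_class) (auto simp: assms(3) key vact_in_V[OF cl])
  also have "\<dots> = sym_class A (tact Y w v)"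
    by (simp add: tact_def lin_ext_def case_prod_unfold)
  finally show ?thesis .
qed

lemma bilinear_actionD:
  assumes "bilinear_action A act" "l \<in> L" "s \<in> carrier S"
  shows "act l s \<in> carrier S"
    and "l' \<in> L \<Longrightarrow> act (l + l') s = act l s \<oplus>\<^bsub>S\<^esub> act l' s"
    and "s' \<in> carrier S \<Longrightarrow> act l (s \<oplus>\<^bsub>S\<^esub> s') = act l s \<oplus>\<^bsub>S\<^esub> act l s'"
    and "act (smul c l) s = sym_scale A c (act l s)"
    and "act l (sym_scale A c s) = sym_scale A c (act l s)"
  using assms unfolding bilinear_action_def by blast+

text \<open>The action is expanded twice: in the element of \<open>L\<close> for a fixed vector, and
  in the vector for a fixed basis element.\<close>

lemma bilinear_action_represents:
  assumes act: "bilinear_action A act"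
  shows "represents (\<lambda>x \<Sigma>. coord (act (bvec x) (sym_class A (bvec \<Sigma>)))) act"
proof -
  let ?Y = "\<lambda>x \<Sigma>. coord (act (bvec x) (sym_class A (bvec \<Sigma>)))"
  note actD = bilinear_actionD[OF act]
  have cl: "closed_family ?Y"
    by (simp add: closed_family_def actD(1))
  have lin_r: "(\<lambda>v. coord (act l (sym_class A v))) \<in> linear_maps V V" if "l \<in> L" for l
    unfolding linear_maps_def
  proof (intro CollectI conjI ballI allI)
    fix u v c assume uv: "u \<in> V" "v \<in> V"
    show "coord (act l (sym_class A (u + v))) = coord (act l (sym_class A u)) + coord (act l (sym_class A v))"
    proof -
      have "act l (sym_class A (u + v)) = act l (sym_class A u) \<oplus>\<^bsub>S\<^esub> act l (sym_class A v)"
        using actD(3)[OF that, of "sym_class A u" "sym_class A v"] uv by simp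
      also have "\<dots> = sym_class A (coord (act l (sym_class A u)) + coord (act l (sym_class A v)))"
        using uv that actD(1)[of l] by (simp flip: sym_class_V(1))
      finally show ?thesis using uv that actD(1)[of l] by simp
    qed
  next
    fix u c assume u: "u \<in> V"
    show "coord (act l (sym_class A (smul c u))) = smul c (coord (act l (sym_class A u)))"
    proof -
      have "act l (sym_class A (smul c u)) = sym_scale A c (act l (sym_class A u))"
        using actD(5)[OF that, of "sym_class A u" c] u by simp
      also have "\<dots> = sym_class A (smul c (coord (act l (sym_class A u))))"
        using u that actD(1)[of l] by (simp flip: sym_scale_class)
      finally show ?thesis using u that actD(1)[of l] by simp
    qed
  qed (use that actD(1) in auto)
  have lin_l: "(\<lambda>l. coord (act l (sym_class A v))) \<in> linear_maps L V" if "v \<in> V" for v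
    unfolding linear_maps_def
  proof (intro CollectI conjI ballI allI)
    fix l l' assume l: "l \<in> L" "l' \<in> L"
    show "coord (act (l + l') (sym_class A v)) = coord (act l (sym_class A v)) + coord (act l' (sym_class A v))"
    proof -
      have "act (l + l') (sym_class A v) = act l (sym_class A v) \<oplus>\<^bsub>S\<^esub> act l' (sym_class A v)"
        using actD(2)[of l "sym_class A v" l'] l that by simp
      also have "\<dots> = sym_class A (coord (act l (sym_class A v)) + coord (act l' (sym_class A v)))"
        using l that actD(1) by (simp flip: sym_class_V(1))
      finally show ?thesis using l that actD(1) by simp
    qed
  next
    fix l c assume l: "l \<in> L"
    show "coord (act (smul c l) (sym_class A v)) = smul c (coord (act l (sym_class A v)))"
    proof -
      have "act (smul c l) (sym_class A v) = sym_scale A c (act l (sym_class A v))"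
        using actD(4)[of l "sym_class A v" c] l that by simp
      also have "\<dots> = sym_class A (smul c (coord (act l (sym_class A v))))"
        using l that actD(1) by (simp flip: sym_scale_class)
      finally show ?thesis using l that actD(1) by simp
    qed
  qed (use that actD(1) in auto)
  have "act l (sym_class A v) = sym_class A (vact ?Y l v)" if "l \<in> L" "v \<in> V" for l v
  proof -
    have "coord (act l (sym_class A v)) = lin_ext (\<lambda>x. coord (act (bvec x) (sym_class A v))) l"
      using linear_maps_eq_lin_ext[OF lin_l that(1)] that(2) by simp
    also have "\<dots> = vact ?Y l v"
      unfolding vact_def using that linear_maps_eq_lin_ext[OF lin_r that(2)]
      by (intro lin_ext_cong_free_module[OF that(1)]) simp
    finally show ?thesis using that actD(1) class_coord by (metis sym_class_carrier_V)
  qed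
  with cl show ?thesis by (simp add: represents_def)
qed

lemma represents_bilinear:
  assumes "represents Y act"
  shows "bilinear_action A act"
  unfolding bilinear_action_def
proof (intro ballI)
  fix l s assume l: "l \<in> L" and "s \<in> carrier S"
  then obtain v where v: "v \<in> V" "s = sym_class A v" using sym_algebra_exhaust by blast
  have cl: "closed_family Y" using assms by (simp add: represents_def)
  note [simp] = represents_act[OF assms] vact_in_V[OF cl]
  have "act l (s \<oplus>\<^bsub>S\<^esub> s') = act l s \<oplus>\<^bsub>S\<^esub> act l s'" if s': "s' \<in> carrier S" for s'
  proof -
    obtain u where "u \<in> V" "s' = sym_class A u" using sym_algebra_exhaust[OF s'] by blast
    with l v show ?thesis by simp
  qed
  with l v show "act l s \<in> carrier S
      \<and> (\<forall>l'\<in>L. act (l + l') s = act l s \<oplus>\<^bsub>S\<^esub> act l' s)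
      \<and> (\<forall>s'\<in>carrier S. act l (s \<oplus>\<^bsub>S\<^esub> s') = act l s \<oplus>\<^bsub>S\<^esub> act l s')
      \<and> (\<forall>c. act (smul c l) s = sym_scale A c (act l s)
           \<and> act l (sym_scale A c s) = sym_scale A c (act l s))"
    by simp
qed

lemma canonical_map_iff_family:
  assumes rep: "represents Y act"
  shows "canonical_map A act \<longleftrightarrow> canonical_family Y"
proof -
  have cl: "closed_family Y" using rep by (simp add: represents_def)
  have in_V [simp]: "Y x \<Sigma> \<in> V" if "x \<in> B" "\<Sigma> \<in> sequences A" for x \<Sigma>
    using closed_familyD[OF cl that] .
  have 1: "bvec x \<in> L" "bvec \<Sigma> \<in> V" if "x \<in> B" "\<Sigma> \<in> sequences A" for x \<Sigma>
    using that by simp_all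
  note [simp] = represents_act[OF rep] represents_act2[OF rep] vact_in_V[OF cl] tact_in_V[OF cl] qmul_in_V qins_in_V
  have low: "act (bvec x) (zmon A \<Sigma>) = zgen A x \<otimes>\<^bsub>S\<^esub> zmon A \<Sigma> \<longleftrightarrow> Y x \<Sigma> = qins A x \<Sigma>"
    if "x \<in> B" "\<Sigma> \<in> sequences A" for x \<Sigma>
    using that by (simp add: sym_class_inj)
  have high: "act (bvec x) (zmon A (y # N)) =
            sym_scale A (q x y) (zgen A y \<otimes>\<^bsub>S\<^esub> zgen A x \<otimes>\<^bsub>S\<^esub> zmon A N)
            \<oplus>\<^bsub>S\<^esub> sym_scale A (q x y) (act (bvec y) (act (bvec x) (zmon A N) \<ominus>\<^bsub>S\<^esub> zgen A x \<otimes>\<^bsub>S\<^esub> zmon A N))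
            \<oplus>\<^bsub>S\<^esub> act2 A act (tpair A (tens (bvec x) (bvec y))) (zmon A N)
            \<oplus>\<^bsub>S\<^esub> act (tbr A (tens (bvec x) (bvec y))) (zmon A N)
       \<longleftrightarrow> Y x (y # N) = smul (q x y) (qmul A y (qins A x N))
            + smul (q x y) (vact Y (bvec y) (Y x N - qins A x N))
            + tact Y (tpair A (bvec (x, y))) (bvec N) + vact Y (tbr A (bvec (x, y))) (bvec N)"
    if "x \<in> B" "y # N \<in> sequences A" for x y N
  proof -
    have "y \<in> B" "N \<in> sequences A" using that by (auto simp: sequences_Cons)
    then show ?thesis
      using that by (simp add: sym_class_inj)
  qed
  \<comment> \<open>By totality, the case distinction in \<open>canon_step\<close> coincides with
    the two clauses of the canonical map.\<close>
  have not_below: "\<not> below A x \<Sigma> \<longleftrightarrow> (\<exists>y N. \<Sigma> = y # N \<and> y \<prec> x)" if "x \<in> B" "\<Sigma> \<in> sequences A" for x \<Sigma>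
    using that prec_total[of x "hd \<Sigma>"] prec_asym[of x "hd \<Sigma>"] prec_irrefl[of x]
    by (cases \<Sigma>) (auto simp: below_def sequences_Cons)
  have "canonical_map A act \<longleftrightarrow> (\<forall>x\<in>B. \<forall>\<Sigma>\<in>sequences A. below A x \<Sigma> \<longrightarrow> Y x \<Sigma> = qins A x \<Sigma>)
      \<and> (\<forall>x\<in>B. \<forall>y N. y # N \<in> sequences A \<longrightarrow> y \<prec> x \<longrightarrow>
           Y x (y # N) = smul (q x y) (qmul A y (qins A x N))
            + smul (q x y) (vact Y (bvec y) (Y x N - qins A x N))
            + tact Y (tpair A (bvec (x, y))) (bvec N) + vact Y (tbr A (bvec (x, y))) (bvec N))"
    unfolding canonical_map_def
    by (simp only: represents_bilinear[OF rep] low high simp_thms cong: ball_cong imp_cong)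
  also have "\<dots> \<longleftrightarrow> (\<forall>x\<in>B. \<forall>\<Sigma>\<in>sequences A. Y x \<Sigma> = canon_step A Y x \<Sigma>)"
    (is "?low \<and> ?high \<longleftrightarrow> ?step")
  proof
    assume ?step
    show "?low \<and> ?high"
    proof (intro conjI ballI allI impI)
      fix x y N assume x: "x \<in> B" "y # N \<in> sequences A" "y \<prec> x"
      then have "\<not> below A x (y # N)" using not_below by blast
      moreover have "Y x (y # N) = canon_step A Y x (y # N)" using \<open>?step\<close> x by blast
      ultimately show "Y x (y # N) = smul (q x y) (qmul A y (qins A x N))
            + smul (q x y) (vact Y (bvec y) (Y x N - qins A x N))
            + tact Y (tpair A (bvec (x, y))) (bvec N) + vact Y (tbr A (bvec (x, y))) (bvec N)"
        by (simp add: canon_step_def del: vact_bilinear)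
    qed (use \<open>?step\<close> in \<open>simp add: canon_step_def\<close>)
  next
    assume lh: "?low \<and> ?high"
    show ?step
    proof (intro ballI)
      fix x \<Sigma> assume x: "x \<in> B" and \<Sigma>: "\<Sigma> \<in> sequences A"
      show "Y x \<Sigma> = canon_step A Y x \<Sigma>"
      proof (cases "below A x \<Sigma>")
        case True
        with lh x \<Sigma> show ?thesis by (simp add: canon_step_def)
      next
        case False
        then obtain y N where "\<Sigma> = y # N" "y \<prec> x" using not_below[OF x \<Sigma>] by blast
        with lh x \<Sigma> False show ?thesis by (simp add: canon_step_def)
      qed
    qed
  qed
  finally show ?thesis
    using cl by (simp add: canonical_family_def)
qed

end

section \<open>Degree filtration\<close>

context unital_T_Lie_algebra
begin

text \<open>\<open>c\<close> is the degree of the operators still to be applied. The additive form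
  makes the module zero when \<open>c\<close> exceeds \<open>r\<close>; truncated subtraction
  \<open>r - c\<close> would still admit the empty sequence.\<close>

definition fil :: "nat \<Rightarrow> nat \<Rightarrow> ('b list \<Rightarrow>\<^sub>0 'k) set" where
  "fil r c = free_module {\<Sigma> \<in> sequences A. c + seq_deg A \<Sigma> \<le> r}"

text \<open>The recursion applies \<open>y\<close> to the difference of \<open>x\<close> acting on
  \<open>z_N\<close> and the product \<open>z_x z_N\<close>. The strict drop in degree of this
  difference keeps the nested argument within earlier degrees.\<close>

definition filtered :: "nat \<Rightarrow> ('b \<Rightarrow> 'b list \<Rightarrow> ('b list \<Rightarrow>\<^sub>0 'k)) \<Rightarrow> bool" where
  "filtered r Y \<longleftrightarrow> closed_family Y \<and> (\<forall>x\<in>B. \<forall>\<Sigma>\<in>sequences A.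
     tdeg A x + seq_deg A \<Sigma> \<le> r \<longrightarrow> Y x \<Sigma> - qins A x \<Sigma> \<in> fil (tdeg A x + seq_deg A \<Sigma>) 1)"

lemma fil_closed [simp]:
  "0 \<in> fil r c" "u \<in> fil r c \<Longrightarrow> v \<in> fil r c \<Longrightarrow> u + v \<in> fil r c"
  "u \<in> fil r c \<Longrightarrow> v \<in> fil r c \<Longrightarrow> u - v \<in> fil r c" "u \<in> fil r c \<Longrightarrow> smul k u \<in> fil r c"
  by (simp_all add: fil_def)

lemma fil_mono: "v \<in> fil r c \<Longrightarrow> r + c' \<le> r' + c \<Longrightarrow> v \<in> fil r' c'"
  unfolding fil_def by (erule free_module_mono[rotated]) auto

lemma bvec_fil: "\<Sigma> \<in> sequences A \<Longrightarrow> c + seq_deg A \<Sigma> \<le> r \<Longrightarrow> bvec \<Sigma> \<in> fil r c"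
  by (simp add: fil_def)

lemma seq_deg_Cons [simp]: "seq_deg A (y # N) = tdeg A y + seq_deg A N"
  by (simp add: seq_deg_def)

lemma qins_fil: "x \<in> B \<Longrightarrow> \<Sigma> \<in> sequences A \<Longrightarrow> qins A x \<Sigma> \<in> fil (tdeg A x + seq_deg A \<Sigma>) 0"
proof -
  assume "x \<in> B" "\<Sigma> \<in> sequences A"
  moreover have "seq_deg A M = tdeg A x + seq_deg A \<Sigma>" if "mset M = add_mset x (mset \<Sigma>)" for M
  proof -
    have "sum_mset (image_mset (tdeg A) (mset M)) = tdeg A x + sum_mset (image_mset (tdeg A) (mset \<Sigma>))"
      unfolding that by simp
    then show ?thesis by (simp add: seq_deg_def sum_mset_sum_list flip: mset_map)
  qed
  ultimately show ?thesis
    using keys_qins by (fastforce simp: fil_def free_module_def)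
qed

lemma filtered_value:
  assumes "filtered r Y" "x \<in> B" "\<Sigma> \<in> sequences A" "tdeg A x + seq_deg A \<Sigma> \<le> r"
  shows "Y x \<Sigma> \<in> fil (tdeg A x + seq_deg A \<Sigma>) 0"
proof -
  have "Y x \<Sigma> - qins A x \<Sigma> \<in> fil (tdeg A x + seq_deg A \<Sigma>) 1"
    using assms by (simp add: filtered_def)
  then have "Y x \<Sigma> - qins A x \<Sigma> + qins A x \<Sigma> \<in> fil (tdeg A x + seq_deg A \<Sigma>) 0"
    using assms by (intro fil_closed(2) qins_fil) (auto elim: fil_mono)
  then show ?thesis by simp
qed

lemma vact_fil:
  assumes Y: "filtered r Y" and l: "l \<in> free_module {x \<in> B. tdeg A x \<le> d}" and v: "v \<in> fil r (c + d)"
  shows "vact Y l v \<in> fil r c"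
proof -
  have "Y x \<Sigma> \<in> fil r c" if "x \<in> B" "tdeg A x \<le> d" "\<Sigma> \<in> sequences A" "c + d + seq_deg A \<Sigma> \<le> r" for x \<Sigma>
    by (rule fil_mono[OF filtered_value[OF Y that(1,3)]]) (use that in auto)
  then show ?thesis
    unfolding vact_def fil_def
    by (intro free_module_lin_ext[OF l] free_module_lin_ext[OF v[unfolded fil_def]]) (auto simp: fil_def)
qed

lemma vact_fil_basis:
  "filtered r Y \<Longrightarrow> x \<in> B \<Longrightarrow> v \<in> fil r (c + tdeg A x) \<Longrightarrow> vact Y (bvec x) v \<in> fil r c"
  by (rule vact_fil) auto

lemma tact_fil:
  assumes Y: "filtered r Y" and w: "w \<in> free_module {(x, y). x \<in> B \<and> y \<in> B \<and> tdeg A x + tdeg A y \<le> d}"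
    and v: "v \<in> fil r (c + d)"
  shows "tact Y w v \<in> fil r c"
  unfolding tact_def fil_def
proof (rule free_module_lin_ext[OF w], clarify, fold fil_def)
  fix a b assume ab: "a \<in> B" "b \<in> B" "tdeg A a + tdeg A b \<le> d"
  then have "v \<in> fil r (c + tdeg A a + tdeg A b)" using fil_mono[OF v] by simp
  then show "vact Y (bvec a) (vact Y (bvec b) v) \<in> fil r c"
    using ab by (intro vact_fil_basis[OF Y]) auto
qed

lemma vact_cong:
  assumes eq: "\<And>x \<Sigma>. x \<in> B \<Longrightarrow> \<Sigma> \<in> sequences A \<Longrightarrow> tdeg A x + seq_deg A \<Sigma> \<le> r \<Longrightarrow> Y x \<Sigma> = Z x \<Sigma>"
    and l: "l \<in> free_module {x \<in> B. tdeg A x \<le> d}" and v: "v \<in> fil r d"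
  shows "vact Y l v = vact Z l v"
  unfolding vact_def
  by (intro lin_ext_cong_free_module[OF l] lin_ext_cong_free_module[OF v[unfolded fil_def]] eq) auto

text \<open>The outer factor acts on a value of the inner one; \<open>filtered\<close> keeps this
  value in the range where the two families agree.\<close>

lemma tact_cong:
  assumes eq: "\<And>x \<Sigma>. x \<in> B \<Longrightarrow> \<Sigma> \<in> sequences A \<Longrightarrow> tdeg A x + seq_deg A \<Sigma> \<le> r \<Longrightarrow> Y x \<Sigma> = Z x \<Sigma>"
    and Y: "filtered r Y" and w: "w \<in> free_module {(x, y). x \<in> B \<and> y \<in> B \<and> tdeg A x + tdeg A y \<le> d}"
    and v: "v \<in> fil r d"
  shows "tact Y w v = tact Z w v"
  unfolding tact_def
proof (rule lin_ext_cong_free_module[OF w], clarify)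
  fix a b assume ab: "a \<in> B" "b \<in> B" "tdeg A a + tdeg A b \<le> d"
  then have v': "v \<in> fil r (tdeg A a + tdeg A b)" using fil_mono[OF v] by simp
  then have "vact Y (bvec b) v = vact Z (bvec b) v"
    using ab fil_mono[OF v', of "tdeg A b" r] by (intro vact_cong[OF eq, where d = "tdeg A b"]) auto
  moreover have "vact Y (bvec a) (vact Y (bvec b) v) = vact Z (bvec a) (vact Y (bvec b) v)"
    using ab vact_fil_basis[OF Y ab(2) v'] by (intro vact_cong[OF eq, where d = "tdeg A a"]) auto
  ultimately show "vact Y (bvec a) (vact Y (bvec b) v) = vact Z (bvec a) (vact Z (bvec b) v)"
    by simp
qed

text \<open>Positive degrees make the truncated \<open>- 1\<close> a genuine drop.\<close>

lemma pair_stable: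
  assumes "x \<in> B" "y \<in> B"
  shows "tpair A (bvec (x, y)) \<in> free_module {(a, b). a \<in> B \<and> b \<in> B \<and> tdeg A a + tdeg A b \<le> tdeg A x + tdeg A y - 1}"
    and "tbr A (bvec (x, y)) \<in> free_module {a \<in> B. tdeg A a \<le> tdeg A x + tdeg A y - 1}"
  using assms stable_pair[rule_format, of "tdeg A x" "tdeg A y" "bvec (x, y)"]
    stable_br[rule_format, of "tdeg A x" "tdeg A y" "bvec (x, y)"] deg_pos
  by (simp_all add: degree_part_def)

lemma not_belowE:
  assumes "\<not> below A x \<Sigma>" "x \<in> B" "\<Sigma> \<in> sequences A"
  obtains y N where "\<Sigma> = y # N" "y \<prec> x" "y \<in> B" "N \<in> sequences A" "below A y N"
proof (cases \<Sigma>)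
  case Nil
  with assms show ?thesis by (simp add: below_def)
next
  case (Cons y N)
  then have "below A y N" using assms by (cases N) (auto simp: below_def sequences_Cons)
  with Cons that assms prec_total[of x y] show ?thesis by (auto simp: below_def sequences_Cons)
qed

lemma canon_step_in_V:
  assumes Y: "closed_family Y" and x: "x \<in> B" and \<Sigma>: "\<Sigma> \<in> sequences A"
  shows "canon_step A Y x \<Sigma> \<in> V"
proof (cases "below A x \<Sigma>")
  case True
  with x \<Sigma> show ?thesis by (simp add: canon_step_def qins_in_V)
next
  case False
  then obtain y N where *: "\<Sigma> = y # N" "y \<in> B" "N \<in> sequences A"
    using not_belowE[OF _ x \<Sigma>] by metis
  then show ?thesis
    using False x by (auto simp: canon_step_def simp del: vact_bilinear intro!: free_module_add
        free_module_smul free_module_diff qmul_in_V qins_in_V vact_in_V[OF Y] tact_in_V[OF Y] closed_familyD[OF Y])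
qed

lemma canon_step_fil:
  assumes Y: "filtered r Y" and x: "x \<in> B" and \<Sigma>: "\<Sigma> \<in> sequences A" and deg: "tdeg A x + seq_deg A \<Sigma> \<le> Suc r"
  shows "canon_step A Y x \<Sigma> - qins A x \<Sigma> \<in> fil (tdeg A x + seq_deg A \<Sigma>) 1"
proof (cases "below A x \<Sigma>")
  case True
  then show ?thesis by (simp add: canon_step_def)
next
  case False
  then obtain y N where yN: "\<Sigma> = y # N" "y \<prec> x" "y \<in> B" "N \<in> sequences A" "below A y N"
    using not_belowE[OF _ x \<Sigma>] by metis
  let ?s = "tdeg A x + tdeg A y + seq_deg A N - 1"
  have pos: "tdeg A x \<ge> 1" "tdeg A y \<ge> 1" using x yN deg_pos by auto
  have Ys: "filtered ?s Y" using Y deg yN pos by (auto simp: filtered_def)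
  \<comment> \<open>Since \<open>y\<close> is below \<open>N\<close>, the sequence is
    \<open>y\<close> inserted into \<open>N\<close>. Commuting the two insertions identifies the
    product \<open>z_x z_\<Sigma>\<close> with the first term of \<open>canon_step\<close>, so the
    two cancel.\<close>
  have "qins A x \<Sigma> = qmul A x (qins A y N)"
    using yN by (simp add: qins_below)
  then have top: "qins A x \<Sigma> = smul (q x y) (qmul A y (qins A x N))"
    using qmul_qins[OF x yN(3,4)] by simp
  have "Y x N - qins A x N \<in> fil (tdeg A x + seq_deg A N) 1"
    using Y x yN deg pos by (simp add: filtered_def)
  then have 1: "vact Y (bvec y) (Y x N - qins A x N) \<in> fil ?s 0"
    using yN pos by (intro vact_fil_basis[OF Ys]) (auto elim!: fil_mono simp del: vact_bilinear)
  have N: "bvec N \<in> fil ?s (0 + (tdeg A x + tdeg A y - 1))"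
    using yN pos by (intro bvec_fil) auto
  have 2: "tact Y (tpair A (bvec (x, y))) (bvec N) \<in> fil ?s 0"
    by (rule tact_fil[OF Ys pair_stable(1)[OF x yN(3)] N])
  have 3: "vact Y (tbr A (bvec (x, y))) (bvec N) \<in> fil ?s 0"
    by (rule vact_fil[OF Ys pair_stable(2)[OF x yN(3)] N])
  have "smul (q x y) (vact Y (bvec y) (Y x N - qins A x N)) + tact Y (tpair A (bvec (x, y))) (bvec N)
      + vact Y (tbr A (bvec (x, y))) (bvec N) \<in> fil ?s 0"
    using 1 2 3 by (intro fil_closed)
  moreover have "canon_step A Y x \<Sigma> - qins A x \<Sigma>
      = smul (q x y) (vact Y (bvec y) (Y x N - qins A x N)) + tact Y (tpair A (bvec (x, y))) (bvec N)
        + vact Y (tbr A (bvec (x, y))) (bvec N)"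
    using False unfolding top by (simp add: canon_step_def yN(1) del: vact_bilinear)
  ultimately show ?thesis
    using pos yN by (auto elim!: fil_mono)
qed

text \<open>The leading term involves no value of the family, and each of the three corrections lies
  at least one degree lower, so a step in degree \<open>r + 1\<close> reads values only in degree at
  most \<open>r\<close>.\<close>

lemma canon_step_cong:
  assumes eq: "\<And>x \<Sigma>. x \<in> B \<Longrightarrow> \<Sigma> \<in> sequences A \<Longrightarrow> tdeg A x + seq_deg A \<Sigma> \<le> r \<Longrightarrow> Y x \<Sigma> = Z x \<Sigma>"
    and Y: "filtered r Y" and x: "x \<in> B" and \<Sigma>: "\<Sigma> \<in> sequences A" and deg: "tdeg A x + seq_deg A \<Sigma> \<le> Suc r"
  shows "canon_step A Y x \<Sigma> = canon_step A Z x \<Sigma>"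
proof (cases "below A x \<Sigma>")
  case True
  then show ?thesis by (simp add: canon_step_def)
next
  case False
  then obtain y N where yN: "\<Sigma> = y # N" "y \<prec> x" "y \<in> B" "N \<in> sequences A" "below A y N"
    using not_belowE[OF _ x \<Sigma>] by metis
  have pos: "tdeg A x \<ge> 1" "tdeg A y \<ge> 1" using x yN deg_pos by auto
  have YZ: "Y x N = Z x N" using eq x yN deg pos by simp
  have "Y x N - qins A x N \<in> fil (tdeg A x + seq_deg A N) 1"
    using Y x yN deg pos by (simp add: filtered_def)
  then have "Y x N - qins A x N \<in> fil r (tdeg A y)"
    by (rule fil_mono) (use deg yN in auto)
  then have 1: "vact Y (bvec y) (Y x N - qins A x N) = vact Z (bvec y) (Y x N - qins A x N)"
    using yN by (intro vact_cong[OF eq, where d = "tdeg A y"]) auto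
  have N: "bvec N \<in> fil r (tdeg A x + tdeg A y - 1)"
    using yN pos deg by (intro bvec_fil) auto
  have 2: "tact Y (tpair A (bvec (x, y))) (bvec N) = tact Z (tpair A (bvec (x, y))) (bvec N)"
    by (rule tact_cong[OF eq Y pair_stable(1)[OF x yN(3)] N])
  have 3: "vact Y (tbr A (bvec (x, y))) (bvec N) = vact Z (tbr A (bvec (x, y))) (bvec N)"
    by (rule vact_cong[OF eq pair_stable(2)[OF x yN(3)] N])
  show ?thesis
    using False 1 2 3 by (simp add: canon_step_def yN(1) YZ del: vact_bilinear)
qed

section \<open>Existence of the canonical map\<close>

definition canonical_upto :: "nat \<Rightarrow> ('b \<Rightarrow> 'b list \<Rightarrow> ('b list \<Rightarrow>\<^sub>0 'k)) \<Rightarrow> bool" where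
  "canonical_upto r Y \<longleftrightarrow> closed_family Y \<and> (\<forall>x\<in>B. \<forall>\<Sigma>\<in>sequences A.
     tdeg A x + seq_deg A \<Sigma> \<le> r \<longrightarrow> Y x \<Sigma> = canon_step A Y x \<Sigma>)"

lemma canonical_upto_filtered: "canonical_upto r Y \<Longrightarrow> filtered r Y"
proof (induction r)
  case 0
  then show ?case using deg_pos by (fastforce simp: filtered_def canonical_upto_def)
next
  case (Suc r)
  then have "filtered r Y" by (auto simp: canonical_upto_def)
  then have "Y x \<Sigma> - qins A x \<Sigma> \<in> fil (tdeg A x + seq_deg A \<Sigma>) 1"
    if "x \<in> B" "\<Sigma> \<in> sequences A" "tdeg A x + seq_deg A \<Sigma> \<le> Suc r" for x \<Sigma>
    using canon_step_fil[OF _ that] Suc.prems that by (metis canonical_upto_def)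
  then show ?case
    using Suc.prems by (auto simp: filtered_def canonical_upto_def)
qed

lemma canonical_family_filtered: "canonical_family Y \<Longrightarrow> filtered r Y"
  by (rule canonical_upto_filtered) (simp add: canonical_family_def canonical_upto_def)

text \<open>The recursion for the canonical map is nested and terminates only by the filtration property of
  its own values; iterating \<open>canon_step\<close> from \<open>0\<close> avoids this, as degree \<open>r\<close> is stable after \<open>r\<close> steps.\<close>

primrec approx_family :: "nat \<Rightarrow> 'b \<Rightarrow> 'b list \<Rightarrow> ('b list \<Rightarrow>\<^sub>0 'k)" where
  "approx_family 0 = (\<lambda>x \<Sigma>. 0)"
| "approx_family (Suc r) = canon_step A (approx_family r)"

lemma approx_family_canonical: "canonical_upto r (approx_family r)"
proof (induction r)
  case 0
  then show ?case using deg_pos by (fastforce simp: canonical_upto_def closed_family_def)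
next
  case (Suc r)
  then have cl: "closed_family (approx_family r)" by (simp add: canonical_upto_def)
  have agree: "approx_family r x \<Sigma> = approx_family (Suc r) x \<Sigma>"
    if "x \<in> B" "\<Sigma> \<in> sequences A" "tdeg A x + seq_deg A \<Sigma> \<le> r" for x \<Sigma>
    using Suc that by (simp add: canonical_upto_def)
  have "canon_step A (approx_family r) x \<Sigma> = canon_step A (approx_family (Suc r)) x \<Sigma>"
    if "x \<in> B" "\<Sigma> \<in> sequences A" "tdeg A x + seq_deg A \<Sigma> \<le> Suc r" for x \<Sigma>
    by (rule canon_step_cong[OF agree canonical_upto_filtered[OF Suc] that])
  then show ?case
    using canon_step_in_V[OF cl] by (simp add: canonical_upto_def closed_family_def)
qed

lemma approx_family_stable:
  assumes "x \<in> B" "\<Sigma> \<in> sequences A" "tdeg A x + seq_deg A \<Sigma> \<le> r"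
  shows "approx_family r x \<Sigma> = approx_family (tdeg A x + seq_deg A \<Sigma>) x \<Sigma>"
  using assms(3)
proof (induction r rule: dec_induct)
  case (step r)
  have "approx_family r x \<Sigma> = canon_step A (approx_family r) x \<Sigma>"
    using approx_family_canonical[of r] assms(1,2) step by (simp add: canonical_upto_def)
  with step show ?case by simp
qed simp

lemma canonical_family_exists: "\<exists>Y. canonical_family Y"
proof -
  \<comment> \<open>The diagonal of the approximations: each value is taken at the stage equal to
    its own degree.\<close>
  define Y where "Y x \<Sigma> = approx_family (tdeg A x + seq_deg A \<Sigma>) x \<Sigma>" for x \<Sigma>
  have "closed_family Y"
    using approx_family_canonical unfolding closed_family_def canonical_upto_def Y_def by blast
  moreover have "Y x \<Sigma> = canon_step A Y x \<Sigma>" if x: "x \<in> B" and \<Sigma>: "\<Sigma> \<in> sequences A" for x \<Sigma>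
  proof -
    let ?r = "tdeg A x + seq_deg A \<Sigma>"
    have "Y x \<Sigma> = canon_step A (approx_family ?r) x \<Sigma>"
      using approx_family_canonical[of ?r] x \<Sigma> by (simp add: canonical_upto_def Y_def)
    also have "\<dots> = canon_step A Y x \<Sigma>"
      using canon_step_cong[OF _ canonical_upto_filtered[OF approx_family_canonical[of ?r]] x \<Sigma>, of Y]
        approx_family_stable[where r = ?r, folded Y_def] by simp
    finally show ?thesis .
  qed
  ultimately show ?thesis by (auto simp: canonical_family_def)
qed

lemma canonical_map_exists: "\<exists>act. canonical_map A act"
proof -
  obtain Y where Y: "canonical_family Y" using canonical_family_exists by blast
  then have "closed_family Y" by (simp add: canonical_family_def)
  then have "represents Y (\<lambda>l s. sym_class A (vact Y l (coord s)))"
    by (simp add: represents_def)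
  with Y canonical_map_iff_family show ?thesis by blast
qed

end

section \<open>Adequacy as resolvability of overlaps\<close>

context unital_T_Lie_algebra
begin

abbreviation comm_act :: "('b \<Rightarrow> 'b list \<Rightarrow> ('b list \<Rightarrow>\<^sub>0 'k)) \<Rightarrow> 'b \<Rightarrow> 'b \<Rightarrow> ('b list \<Rightarrow>\<^sub>0 'k) \<Rightarrow> ('b list \<Rightarrow>\<^sub>0 'k)" where
  "comm_act Y x y v \<equiv> tact Y (tpair A (bvec (x, y))) v + vact Y (tbr A (bvec (x, y))) v"

text \<open>Compared with the action identity, \<open>T\<close> is split into \<open>S\<close> and
  the pairing, and the vector is arbitrary, because within an overlap the relations meet values of
  other operators.\<close>

definition relations_upto :: "nat \<Rightarrow> ('b \<Rightarrow> 'b list \<Rightarrow> ('b list \<Rightarrow>\<^sub>0 'k)) \<Rightarrow> bool" where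
  "relations_upto r Y \<longleftrightarrow> (\<forall>x\<in>B. \<forall>y\<in>B. \<forall>v\<in>fil r (tdeg A x + tdeg A y).
     vact Y (bvec x) (vact Y (bvec y) v) = smul (q x y) (vact Y (bvec y) (vact Y (bvec x) v)) + comm_act Y x y v)"

text \<open>Positive terms arise by reducing \<open>x y w\<close> to \<open>w y x\<close> starting
  with the pair \<open>x y\<close>, negative ones by starting with \<open>y w\<close>; the common
  leading term has been cancelled.\<close>

definition overlap :: "('b \<Rightarrow> 'b list \<Rightarrow> ('b list \<Rightarrow>\<^sub>0 'k)) \<Rightarrow> 'b \<Rightarrow> 'b \<Rightarrow> 'b \<Rightarrow> ('b list \<Rightarrow>\<^sub>0 'k) \<Rightarrow> ('b list \<Rightarrow>\<^sub>0 'k)" where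
  "overlap Y x y w v =
     smul (q x y * q x w) (comm_act Y y w (vact Y (bvec x) v)) + smul (q x y) (vact Y (bvec y) (comm_act Y x w v))
     + comm_act Y x y (vact Y (bvec w) v) - smul (q y w * q x w) (vact Y (bvec w) (comm_act Y x y v))
     - smul (q y w) (comm_act Y x w (vact Y (bvec y) v)) - vact Y (bvec x) (comm_act Y y w v)"

section \<open>Antisymmetry and exchange of arguments\<close>

lemma linear_tbr:
  assumes "u \<in> L2" "v \<in> L2"
  shows "tbr A (u + v) = tbr A u + tbr A v" "tbr A (smul c u) = smul c (tbr A u)"
  using assms br_linear by (auto simp: linear_maps_def)

lemma linear_L2_smul:
  assumes "u \<in> L2"
  shows "tS A (smul c u) = smul c (tS A u)" "tT A (smul c u) = smul c (tT A u)"
    "tpair A (smul c u) = smul c (tpair A u)" "tbr A (smul c u) = smul c (tbr A u)"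
  using assms S_linear T_linear pair_linear br_linear by (auto simp: linear_maps_def)

lemma linear_L2_uminus:
  assumes "u \<in> L2"
  shows "tS A (- u) = - tS A u" "tpair A (- u) = - tpair A u" "tbr A (- u) = - tbr A u"
  using linear_L2_smul[OF assms, of "- 1"] by simp_all

lemma pair_antisym:
  assumes "x \<in> B" "y \<in> B"
  shows "tpair A (bvec (y, x)) = smul (- q y x) (tpair A (bvec (x, y)))"
proof -
  have "smul (q x y) (tpair A (bvec (y, x))) = - tpair A (bvec (x, y))"
    using pair_S[rule_format, of "bvec (x, y)"] assms by (simp add: S_bvec linear_L2_smul)
  then have "smul (q y x * q x y) (tpair A (bvec (y, x))) = smul (q y x) (- tpair A (bvec (x, y)))"
    by (simp flip: smul.scale_scale)
  then show ?thesis using q_inverse[of y x] assms by simp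
qed

text \<open>The bracket annihilates the pairing, so \<open>[,] T = - [,]\<close> amounts to
  \<open>[,] S = - [,]\<close>.\<close>

lemma br_antisym:
  assumes "x \<in> B" "y \<in> B"
  shows "tbr A (bvec (y, x)) = smul (- q y x) (tbr A (bvec (x, y)))"
proof -
  have "tbr A (tS A (bvec (x, y)) + tpair A (bvec (x, y))) = - tbr A (bvec (x, y))"
    using br_T[rule_format, of "bvec (x, y)"] T_eq[rule_format, of "bvec (x, y)"] assms by simp
  then have "tbr A (tS A (bvec (x, y))) = - tbr A (bvec (x, y))"
    using assms br_pair by (simp add: linear_tbr)
  then have "smul (q x y) (tbr A (bvec (y, x))) = - tbr A (bvec (x, y))"
    using assms by (simp add: S_bvec linear_L2_smul)
  then have "smul (q y x * q x y) (tbr A (bvec (y, x))) = smul (q y x) (- tbr A (bvec (x, y)))"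
    by (simp flip: smul.scale_scale)
  then show ?thesis using q_inverse[of y x] assms by simp
qed

lemma comm_act_antisym:
  "x \<in> B \<Longrightarrow> y \<in> B \<Longrightarrow> comm_act Y y x v = smul (- q y x) (comm_act Y x y v)"
  by (simp add: pair_antisym[of x y] br_antisym[of x y] smul.scale_right_distrib)

text \<open>The first term is matched with the fifth and the second with the sixth, while the third
  and fourth change by antisymmetry; \<open>q y x * q x y = 1\<close> yields the common
  factor.\<close>

lemma overlap_swap12:
  assumes "x \<in> B" "y \<in> B" "w \<in> B"
  shows "overlap Y y x w v = smul (- q y x) (overlap Y x y w v)"
  using q_inverse[of y x] assms
  by (simp add: overlap_def comm_act_antisym[of x y] algebra_simps)

text \<open>Here the second term is matched with the fourth and the third with the fifth, while the
  first and sixth change by antisymmetry.\<close>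

lemma overlap_swap23:
  assumes "x \<in> B" "y \<in> B" "w \<in> B"
  shows "overlap Y x w y v = smul (- q w y) (overlap Y x y w v)"
  using q_inverse[of w y] assms
  by (simp add: overlap_def comm_act_antisym[of y w] algebra_simps)


section \<open>Multiplicativity and the Jacobi identity on basis vectors\<close>

lemma op_bvec:
  assumes "x \<in> B" "y \<in> B" "z \<in> B"
  shows "op12 (tS A) (bvec (x, y, z)) = smul (q x y) (bvec (y, x, z))"
    and "op23 (tS A) (bvec (x, y, z)) = smul (q y z) (bvec (x, z, y))"
  using assms
  by (simp_all add: op12_def op23_def S_bvec assoc_r_def)

lemma op_smul:
  "op12 (tS A) (smul c u) = smul c (op12 (tS A) u)" "op23 (tS A) (smul c u) = smul c (op23 (tS A) u)"
  "br_id (tbr A) (smul c u) = smul c (br_id (tbr A) u)" "id_br (tbr A) (smul c u) = smul c (id_br (tbr A) u)"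
  by (simp_all add: op12_def op23_def br_id_def id_br_def tens_map_def assoc_l_def assoc_r_def)

lemma br_id_bvec:
  "br_id (tbr A) (bvec (x, y, z)) = tens (tbr A (bvec (x, y))) (bvec z)"
  "id_br (tbr A) (bvec (x, y, z)) = tens (bvec x) (tbr A (bvec (y, z)))"
  by (simp_all add: br_id_def id_br_def)

lemma S_br_right:
  assumes "x \<in> B" "y \<in> B" "z \<in> B" "x \<prec> y" "y \<prec> z"
  shows "tS A (tens (bvec x) (tbr A (bvec (y, z)))) = smul (q x y * q x z) (tens (tbr A (bvec (y, z))) (bvec x))"
  using multiplicative_right[rule_format, of "bvec (x, y, z)"] assms
  by (simp add: op_bvec op_smul br_id_bvec)

lemma S_br_left:
  assumes "x \<in> B" "y \<in> B" "z \<in> B" "x \<prec> y" "y \<prec> z"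
  shows "tS A (tens (tbr A (bvec (x, y))) (bvec z)) = smul (q y z * q x z) (tens (bvec z) (tbr A (bvec (x, y))))"
  using multiplicative_left[rule_format, of "bvec (x, y, z)"] assms
  by (simp add: op_bvec op_smul br_id_bvec)

text \<open>In the third term of the axiom, antisymmetry turns \<open>[w, x]\<close> into
  \<open>[x, w]\<close> and cancels \<open>q x w\<close>; this is the double bracket that occurs in
  the adequacy identity.\<close>

lemma jacobi_bvec:
  assumes "x \<in> B" "y \<in> B" "w \<in> B" "y \<prec> x" "w \<prec> y"
  shows "smul (q y w * q x w) (tbr A (tens (bvec w) (tbr A (bvec (x, y)))))
    - smul (q x y * q x w) (tbr A (tens (tbr A (bvec (y, w))) (bvec x)))
    = smul (q x y) (tbr A (tens (bvec y) (tbr A (bvec (x, w)))))"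
proof -
  have L2: "tens (bvec y) (tbr A (bvec (x, w))) \<in> L2" "tens (bvec w) (tbr A (bvec (x, y))) \<in> L2"
    "tens (tbr A (bvec (y, w))) (bvec x) \<in> L2"
    using assms by (auto intro!: free_module_tens)
  have "tbr A (smul (q y w * q x w) (tens (bvec w) (tbr A (bvec (x, y))))
      - smul (q x y * q x w) (tens (tbr A (bvec (y, w))) (bvec x))
      + smul (q x y * q x w) (tens (bvec y) (tbr A (bvec (w, x))))) = 0"
    using jacobi[rule_format, of "bvec (x, y, w)"] assms by (simp add: op_bvec op_smul br_id_bvec)
  moreover have "smul (q x y * q x w) (tens (bvec y) (tbr A (bvec (w, x))))
      = smul (- q x y) (tens (bvec y) (tbr A (bvec (x, w))))"
    using assms q_inverse[of x w] by (simp add: br_antisym[of x w] mult.assoc)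
  ultimately have "tbr A (smul (q y w * q x w) (tens (bvec w) (tbr A (bvec (x, y))))
      + smul (- (q x y * q x w)) (tens (tbr A (bvec (y, w))) (bvec x))
      + smul (- q x y) (tens (bvec y) (tbr A (bvec (x, w))))) = 0"
    by simp
  then have "smul (q y w * q x w) (tbr A (tens (bvec w) (tbr A (bvec (x, y)))))
      + smul (- (q x y * q x w)) (tbr A (tens (tbr A (bvec (y, w))) (bvec x)))
      + smul (- q x y) (tbr A (tens (bvec y) (tbr A (bvec (x, w))))) = 0"
    using L2 by (simp only: linear_tbr free_module_add free_module_smul)
  then show ?thesis by (simp add: algebra_simps)
qed

text \<open>Meant for tensors such as \<open>w\<close> with \<open>[x, y]\<close>, where one factor
  is a linear combination; the bound \<open>d\<close> has to cover all of its terms.\<close>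

lemma relations_upto_L2:
  assumes rel: "relations_upto r Y" and w: "w \<in> free_module {(x, y). x \<in> B \<and> y \<in> B \<and> tdeg A x + tdeg A y \<le> d}"
    and v: "v \<in> fil r d"
  shows "tact Y w v = tact Y (tS A w) v + tact Y (tpair A w) v + vact Y (tbr A w) v"
proof -
  have wL2: "w \<in> L2" using w by (rule free_module_mono[rotated]) auto
  have S: "tS A w = lin_ext (\<lambda>p. tS A (bvec p)) w" and P: "tpair A w = lin_ext (\<lambda>p. tpair A (bvec p)) w"
    and Br: "tbr A w = lin_ext (\<lambda>p. tbr A (bvec p)) w"
    using linear_maps_eq_lin_ext[OF S_linear wL2] linear_maps_eq_lin_ext[OF pair_linear wL2]
      linear_maps_eq_lin_ext[OF br_linear wL2] by simp_all
  have "tact Y w v = lin_ext (\<lambda>p. tact Y (tS A (bvec p)) v + tact Y (tpair A (bvec p)) v + vact Y (tbr A (bvec p)) v) w"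
    unfolding tact_def[of Y w]
  proof (rule lin_ext_cong_free_module[OF w], clarify)
    fix x y assume xy: "x \<in> B" "y \<in> B" "tdeg A x + tdeg A y \<le> d"
    then have "v \<in> fil r (tdeg A x + tdeg A y)" using fil_mono[OF v] by simp
    then show "vact Y (bvec x) (vact Y (bvec y) v)
        = tact Y (tS A (bvec (x, y))) v + tact Y (tpair A (bvec (x, y))) v + vact Y (tbr A (bvec (x, y))) v"
      using rel xy by (simp add: relations_upto_def S_bvec add.assoc)
  qed
  then show ?thesis
    unfolding S P Br by (simp add: tact_lin_ext vact_lin_ext lin_ext_fun_add)
qed

lemma action_identity_relations:
  assumes rep: "represents Y act" and Y: "filtered r Y" and ai: "action_identity A act r"
  shows "relations_upto r Y"
  unfolding relations_upto_def
proof (intro ballI)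
  fix x y v assume x: "x \<in> B" and y: "y \<in> B" and v: "v \<in> fil r (tdeg A x + tdeg A y)"
  have cl: "closed_family Y" using rep by (simp add: represents_def)
  have basis: "vact Y (bvec x) (Y y M)
      = smul (q x y) (vact Y (bvec y) (Y x M)) + comm_act Y x y (bvec M)"
    if M: "M \<in> sequences A" "tdeg A x + tdeg A y + seq_deg A M \<le> r" for M
  proof -
    have "act (bvec x) (act (bvec y) (zmon A M)) \<ominus>\<^bsub>S\<^esub> act2 A act (tT A (tens (bvec x) (bvec y))) (zmon A M)
        = act (tbr A (tens (bvec x) (bvec y))) (zmon A M)"
      using ai x y M by (simp add: action_identity_def)
    then have "vact Y (bvec x) (Y y M) - tact Y (tT A (bvec (x, y))) (bvec M) = vact Y (tbr A (bvec (x, y))) (bvec M)"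
      using x y M closed_familyD[OF cl]
      by (simp add: represents_act[OF rep] represents_act2[OF rep] vact_in_V[OF cl] tact_in_V[OF cl] sym_class_inj)
    then show ?thesis
      using x y T_eq[rule_format, of "bvec (x, y)"] by (simp add: S_bvec algebra_simps)
  qed
  have "vact Y (bvec x) (vact Y (bvec y) v) = lin_ext (\<lambda>M. vact Y (bvec x) (Y y M)) v"
    using vact_lin_ext(2)[of Y "bvec y" bvec v] by (simp add: vact_lin_ext(2))
  also have "\<dots> = lin_ext (\<lambda>M. smul (q x y) (vact Y (bvec y) (Y x M)) + comm_act Y x y (bvec M)) v"
    using v unfolding fil_def by (rule lin_ext_cong_free_module) (simp add: basis)
  also have "\<dots> = smul (q x y) (vact Y (bvec y) (vact Y (bvec x) v)) + comm_act Y x y v"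
    using vact_lin_ext(2)[of Y "bvec x" bvec v] vact_lin_ext(2)[of Y "tbr A (bvec (x, y))" bvec v]
      tact_lin_ext(2)[of Y "tpair A (bvec (x, y))" bvec v]
    by (simp add: lin_ext_fun_add lin_ext_fun_smul vact_lin_ext(2))
  finally show "vact Y (bvec x) (vact Y (bvec y) v)
      = smul (q x y) (vact Y (bvec y) (vact Y (bvec x) v)) + comm_act Y x y v" .
qed

lemma adequacy_identity_vact:
  assumes rep: "represents Y act" and x: "x \<in> B" and y: "y \<in> B" and w: "w \<in> B" and N: "N \<in> sequences A"
  defines "X \<equiv> \<lambda>a. vact Y (bvec a)" and "P \<equiv> \<lambda>a b. tact Y (tpair A (bvec (a, b)))"
    and "Br \<equiv> \<lambda>a b. vact Y (tbr A (bvec (a, b)))" and "z \<equiv> bvec N"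
  shows "adequacy_identity A act x y w N \<longleftrightarrow>
      P x y (X w z) - smul (q x y) (vact Y (tbr A (tens (bvec y) (tbr A (bvec (x, w))))) z)
      = smul (q y w * q x w) (tact Y (tpair A (tens (bvec w) (tbr A (bvec (x, y))))) z)
        + smul (q y w * q x w) (X w (P x y z))
        + smul (q y w) (P x w (X y z)) - smul (q x y) (X y (P x w z))
        + smul (q y w) (Br x w (X y z)) - smul (q x y) (X y (Br x w z))
        + X x (P y w z) - smul (q x y * q x w) (P y w (X x z))
        - smul (q x w * q x y) (tact Y (tpair A (tens (tbr A (bvec (y, w))) (bvec x))) z)"
proof -
  have cl: "closed_family Y" using rep by (simp add: represents_def)
  have L2: "tens (bvec y) (tbr A (bvec (x, w))) \<in> L2" "tens (bvec w) (tbr A (bvec (x, y))) \<in> L2"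
    "tens (tbr A (bvec (y, w))) (bvec x) \<in> L2"
    using x y w by (auto intro!: free_module_tens)
  show ?thesis
    using x y w N L2 unfolding X_def P_def Br_def z_def
    by (simp add: adequacy_identity_def Let_def represents_act[OF rep] represents_act2[OF rep]
        vact_in_V[OF cl] tact_in_V[OF cl] closed_familyD[OF cl] sym_class_inj)
qed

text \<open>The overlap contains four single-bracket terms that the adequacy identity lacks, those
  with \<open>[x, y]\<close> and \<open>[y, w]\<close>. The two exchanges trade them for pairings
  and double brackets, and the Jacobi identity merges the two double brackets into one.\<close>

lemma adequacy_identity_iff_overlap:
  assumes rep: "represents Y act" and rel: "relations_upto r Y"
    and x: "x \<in> B" and y: "y \<in> B" and w: "w \<in> B" and N: "N \<in> sequences A"
    and yx: "y \<prec> x" and wy: "w \<prec> y"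
    and deg: "tdeg A x + tdeg A y + tdeg A w + seq_deg A N \<le> r + 1"
  shows "adequacy_identity A act x y w N \<longleftrightarrow> overlap Y x y w (bvec N) = 0"
proof -
  define z where "z = (bvec N :: 'b list \<Rightarrow>\<^sub>0 'k)"
  note pos = deg_pos[rule_format, OF x] deg_pos[rule_format, OF y] deg_pos[rule_format, OF w]
  \<comment> \<open>The bracket inside \<open>?u\<close> and \<open>?t\<close> has already lowered
    the degree by at least one, which turns the bound \<open>r + 1\<close> into the \<open>r\<close>
    of \<open>relations_upto\<close>.\<close>
  have z: "z \<in> fil r (tdeg A x + tdeg A y + tdeg A w - 1)"
    unfolding z_def using deg N pos by (intro bvec_fil) auto
  have br_deg: "tbr A (bvec (x, y)) \<in> free_module {a \<in> B. tdeg A a \<le> tdeg A x + tdeg A y - 1}"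
    "tbr A (bvec (y, w)) \<in> free_module {a \<in> B. tdeg A a \<le> tdeg A y + tdeg A w - 1}"
    using pair_stable(2) x y w by simp_all
  let ?u = "tens (bvec w) (tbr A (bvec (x, y)))"
  let ?t = "tens (tbr A (bvec (y, w))) (bvec x)"
  let ?D = "{(a, b). a \<in> B \<and> b \<in> B \<and> tdeg A a + tdeg A b \<le> tdeg A x + tdeg A y + tdeg A w - 1}"
  have "?u \<in> free_module ({w} \<times> {a \<in> B. tdeg A a \<le> tdeg A x + tdeg A y - 1})"
    using br_deg by (intro free_module_tens) auto
  then have u: "?u \<in> free_module ?D"
    by (rule free_module_mono[rotated]) (use w pos in auto)
  have "?t \<in> free_module ({a \<in> B. tdeg A a \<le> tdeg A y + tdeg A w - 1} \<times> {x})"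
    using br_deg by (intro free_module_tens) auto
  then have t: "?t \<in> free_module ?D"
    by (rule free_module_mono[rotated]) (use x pos in auto)
  have u': "tens (bvec w) (tbr A (bvec (y, x))) \<in> L2"
    using x y w by (auto intro!: free_module_tens)
  \<comment> \<open>Multiplicativity concerns the increasing triple \<open>w\<close>,
    \<open>y\<close>, \<open>x\<close>, hence the bracket \<open>[y, x]\<close>; the factor from
    antisymmetry is the same on both sides.\<close>
  have Su: "tS A ?u = smul (q w y * q w x) (tens (tbr A (bvec (x, y))) (bvec w))"
    using S_br_right[OF w y x wy yx] x y u' by (simp add: br_antisym[of y x] linear_L2_smul linear_L2_uminus mult_ac)
  have t': "tens (tbr A (bvec (w, y))) (bvec x) \<in> L2"
    using x y w by (auto intro!: free_module_tens)
  have St: "tS A ?t = smul (q y x * q w x) (tens (bvec x) (tbr A (bvec (y, w))))"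
    using S_br_left[OF w y x wy yx] y w t' by (simp add: br_antisym[of w y] linear_L2_smul linear_L2_uminus mult_ac)
  have 1: "vact Y (bvec w) (vact Y (tbr A (bvec (x, y))) z)
      = smul (q w y * q w x) (vact Y (tbr A (bvec (x, y))) (vact Y (bvec w) z)) + tact Y (tpair A ?u) z + vact Y (tbr A ?u) z"
    using relations_upto_L2[OF rel u z] by (simp add: Su tact_tens)
  have 2: "vact Y (tbr A (bvec (y, w))) (vact Y (bvec x) z)
      = smul (q y x * q w x) (vact Y (bvec x) (vact Y (tbr A (bvec (y, w))) z)) + tact Y (tpair A ?t) z + vact Y (tbr A ?t) z"
    using relations_upto_L2[OF rel t z] by (simp add: St tact_tens)
  have "q y w * q x w * (q w y * q w x) = (q w y * q y w) * (q w x * q x w)"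
    "q x y * q x w * (q y x * q w x) = (q y x * q x y) * (q w x * q x w)"
    by (simp_all add: mult_ac)
  then have qq: "q y w * q x w * (q w y * q w x) = 1" "q x y * q x w * (q y x * q w x) = 1"
    using q_inverse x y w by simp_all
  have br1: "smul (q y w * q x w) (vact Y (bvec w) (vact Y (tbr A (bvec (x, y))) z))
      = vact Y (tbr A (bvec (x, y))) (vact Y (bvec w) z)
        + smul (q y w * q x w) (tact Y (tpair A ?u) z) + smul (q y w * q x w) (vact Y (tbr A ?u) z)"
    unfolding 1 smul.scale_right_distrib smul.scale_scale
    unfolding qq(1) by simp
  have br2: "smul (q x y * q x w) (vact Y (tbr A (bvec (y, w))) (vact Y (bvec x) z))
      = vact Y (bvec x) (vact Y (tbr A (bvec (y, w))) z)
        + smul (q x y * q x w) (tact Y (tpair A ?t) z) + smul (q x y * q x w) (vact Y (tbr A ?t) z)"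
    unfolding 2 smul.scale_right_distrib smul.scale_scale
    unfolding qq(2) by simp
  have 3: "smul (q y w * q x w) (vact Y (tbr A ?u) z) - smul (q x y * q x w) (vact Y (tbr A ?t) z)
      = smul (q x y) (vact Y (tbr A (tens (bvec y) (tbr A (bvec (x, w))))) z)"
    using arg_cong[OF jacobi_bvec[OF x y w yx wy], of "\<lambda>l. vact Y l z"] by simp
  \<comment> \<open>With everything moved to one side, the equivalence of two equations becomes the
    equality of two differences.\<close>
  show ?thesis
    unfolding adequacy_identity_vact[OF rep x y w N] overlap_def z_def [symmetric]
      eq_iff_diff_eq_0[of "tact Y (tpair A (bvec (x, y))) (vact Y (bvec w) z) - _"]
    by (rule arg_cong[of _ _ "\<lambda>s. s = 0"]) (simp add: br1[unfolded mult.commute[of "q y w"]]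
        br2[unfolded mult.commute[of "q x y"]] 3[symmetric] algebra_simps)
qed


text \<open>The recursion enters only through \<open>filtered\<close>, so a concrete algebra can be
  treated without the quotient.\<close>

theorem adequateI:
  assumes "\<And>r Y x y w v. filtered r Y \<Longrightarrow> relations_upto r Y \<Longrightarrow> x \<in> B \<Longrightarrow> y \<in> B \<Longrightarrow> w \<in> B \<Longrightarrow>
     y \<prec> x \<Longrightarrow> w \<prec> y \<Longrightarrow> v \<in> fil (r + 1) (tdeg A x + tdeg A y + tdeg A w) \<Longrightarrow> overlap Y x y w v = 0"
  shows "adequate A"
  unfolding adequate_def
proof (intro conjI allI impI)
  show "\<exists>act. canonical_map A act" by (rule canonical_map_exists)
next
  fix act assume act: "canonical_map A act"
  then have "bilinear_action A act" by (simp add: canonical_map_def)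
  then obtain Y where rep: "represents Y act" using bilinear_action_represents by blast
  with act have Y: "canonical_family Y" by (simp add: canonical_map_iff_family)
  show "adequate_action A act"
    unfolding adequate_action_def
  proof (intro allI impI ballI)
    fix r x y w N
    assume "action_identity A act r" and x: "x \<in> B" and y: "y \<in> B" and w: "w \<in> B"
      and N: "N \<in> sequences A" and less: "y \<prec> x" "w \<prec> y"
      and deg: "tdeg A x + tdeg A y + tdeg A w + seq_deg A N \<le> r + 1"
    then have rel: "relations_upto r Y"
      using action_identity_relations[OF rep canonical_family_filtered[OF Y]] by blast
    have "overlap Y x y w (bvec N) = 0"
      by (rule assms[OF canonical_family_filtered[OF Y] rel x y w less])
        (rule bvec_fil[OF N], use deg in simp)
    then show "adequacy_identity A act x y w N"
      using adequacy_identity_iff_overlap[OF rep rel x y w N less deg] by simp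
  qed
qed

end

section \<open>Overlaps of intervals\<close>

text \<open>The straightening relations of root vectors in type A, as identities of operators that
  hold only on the part \<open>F e\<close> where total degree \<open>e\<close> is still admissible.
  Each rule moves the lexicographically later interval inwards.\<close>

locale interval_operators =
  fixes E :: "nat \<Rightarrow> nat \<Rightarrow> ('w \<Rightarrow>\<^sub>0 'k::comm_ring_1) \<Rightarrow> ('w \<Rightarrow>\<^sub>0 'k)"
    and F :: "nat \<Rightarrow> ('w \<Rightarrow>\<^sub>0 'k) set" and d :: "nat \<Rightarrow> nat \<Rightarrow> nat" and m :: nat and q qi :: 'k
  assumes q_qi: "q * qi = 1"
    and E_linear: "E i j (x + y) = E i j x + E i j y" "E i j (smul c x) = smul c (E i j x)"
    and E_F: "1 \<le> i \<Longrightarrow> i < j \<Longrightarrow> j \<le> m \<Longrightarrow> z \<in> F (e + d i j) \<Longrightarrow> E i j z \<in> F e"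
    and d_pos: "1 \<le> i \<Longrightarrow> i < j \<Longrightarrow> 0 < d i j"
    and d_adjacent: "1 \<le> i \<Longrightarrow> i < j \<Longrightarrow> j < k \<Longrightarrow> d i k < d i j + d j k"
    and d_crossing: "1 \<le> i \<Longrightarrow> i < u \<Longrightarrow> u < j \<Longrightarrow> j < v \<Longrightarrow> d i v + d u j < d i j + d u v"
    and E_left: "1 \<le> i \<Longrightarrow> i < j \<Longrightarrow> j < k \<Longrightarrow> k \<le> m \<Longrightarrow> z \<in> F (d i j + d i k) \<Longrightarrow>
      E i k (E i j z) = smul qi (E i j (E i k z))"
    and E_right: "1 \<le> i \<Longrightarrow> i < j \<Longrightarrow> j < k \<Longrightarrow> k \<le> m \<Longrightarrow> z \<in> F (d i k + d j k) \<Longrightarrow>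
      E j k (E i k z) = smul qi (E i k (E j k z))"
    and E_adjacent: "1 \<le> i \<Longrightarrow> i < j \<Longrightarrow> j < k \<Longrightarrow> k \<le> m \<Longrightarrow> z \<in> F (d i j + d j k) \<Longrightarrow>
      E j k (E i j z) = smul q (E i j (E j k z)) - smul q (E i k z)"
    and E_disjoint: "1 \<le> i \<Longrightarrow> i < j \<Longrightarrow> j < u \<Longrightarrow> u < k \<Longrightarrow> k \<le> m \<Longrightarrow> z \<in> F (d i j + d u k) \<Longrightarrow>
      E u k (E i j z) = E i j (E u k z)"
    and E_nested: "1 \<le> i \<Longrightarrow> i < u \<Longrightarrow> u < k \<Longrightarrow> k < j \<Longrightarrow> j \<le> m \<Longrightarrow> z \<in> F (d i j + d u k) \<Longrightarrow>
      E u k (E i j z) = E i j (E u k z)"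
    and E_crossing: "1 \<le> i \<Longrightarrow> i < u \<Longrightarrow> u < j \<Longrightarrow> j < k \<Longrightarrow> k \<le> m \<Longrightarrow> z \<in> F (d i j + d u k) \<Longrightarrow>
      E u k (E i j z) = E i j (E u k z) + smul (qi - q) (E i k (E u j z))"
begin

text \<open>\<open>E u v \<circ> E i j = twist i j u v (E i j \<circ> E u v) + comm i j u v\<close> for \<open>(i, j)\<close> lexicographically before \<open>(u, v)\<close>.\<close>

definition twist :: "nat \<Rightarrow> nat \<Rightarrow> nat \<Rightarrow> nat \<Rightarrow> 'k" where
  "twist i j u v = (if j = u then q else if i = u \<or> j = v then qi else 1)"

definition comm :: "nat \<Rightarrow> nat \<Rightarrow> nat \<Rightarrow> nat \<Rightarrow> ('w \<Rightarrow>\<^sub>0 'k) \<Rightarrow> ('w \<Rightarrow>\<^sub>0 'k)" where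
  "comm i j u v z = (if j = u then - smul q (E i v z)
     else if i < u \<and> u < j \<and> j < v then smul (qi - q) (E i v (E u j z)) else 0)"

lemma E_simps [simp]: "E i j 0 = 0" "E i j (- u) = - E i j u" "E i j (u - v) = E i j u - E i j v"
  "E i j (u + v) = E i j u + E i j v" "E i j (smul c u) = smul c (E i j u)"
proof -
  show *: "E i j 0 = 0" for i j using E_linear(2)[of i j 0 0] by simp
  show m: "E i j (- u) = - E i j u" for u using E_linear(2)[of i j "- 1" u] by simp
  show "E i j (u - v) = E i j u - E i j v" using E_linear(1)[of i j u "- v"] m by simp
qed (rule E_linear)+

lemma q_cancel [simp]: "q * qi = 1" "qi * q = 1" "q * (qi * x) = x" "qi * (q * x) = x"
  using q_qi by (simp_all add: mult.commute[of qi]) (metis mult.assoc mult.commute mult_1)+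

text \<open>In this order: common left end, common right end, adjacent, disjoint, nested,
  crossing.\<close>

lemma interval_pair_cases:
  fixes i j u v :: nat
  assumes "i < j" "u < v" "i < u \<or> i = u \<and> j < v"
  obtains "i = u" "j < v" | "i < u" "j = v" | "j = u" | "j < u" | "i < u" "v < j" | "i < u" "u < j" "j < v"
  using assms by linarith

text \<open>Membership in \<open>F c\<close> is given only strictly below the total degree, so no
  rule applies to the full three-letter word. Every term of the overlap contains a commutator,
  though, and its crossing or adjacency step supplies the missing degree.\<close>

lemma overlap_zero:
  assumes lt: "1 \<le> i" "i < j" "j \<le> m" "u < v" "v \<le> m" "p < s" "s \<le> m"
    and lex: "i < u \<or> i = u \<and> j < v" "u < p \<or> u = p \<and> v < s"
    and z: "\<And>c. c < d i j + d u v + d p s \<Longrightarrow> z \<in> F c"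
  shows "smul (twist u v p s * twist i j p s) (comm i j u v (E p s z)) + smul (twist u v p s) (E u v (comm i j p s z))
     + comm u v p s (E i j z) - smul (twist i j u v * twist i j p s) (E i j (comm u v p s z))
     - smul (twist i j u v) (comm i j p s (E u v z)) - E p s (comm i j u v z) = 0"
proof -
  have lex': "i < p \<or> i = p \<and> j < s" using lex by linarith
  \<comment> \<open>The factor \<open>smul 1\<close> makes the two commutation rules non-permutative, so that the simplifier
    applies them unconditionally instead of by its term order.\<close>
  have disjoint: "E u k (E i j z) = smul 1 (E i j (E u k z))"
    if "1 \<le> i" "i < j" "j < u" "u < k" "k \<le> m" "z \<in> F (d i j + d u k)" for i j u k z
    using E_disjoint[OF that] by simp
  have nested: "E u k (E i j z) = smul 1 (E i j (E u k z))"
    if "1 \<le> i" "i < u" "u < k" "k < j" "j \<le> m" "z \<in> F (d i j + d u k)" for i j u k z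
    using E_nested[OF that] by simp
  have pos: "0 < d i j" "0 < d u v" "0 < d p s" "1 \<le> u" "1 \<le> p"
    using lt lex by (auto intro!: d_pos)
  \<comment> \<open>The words whose degree has to be bounded in some configuration: each arises from the overlap by
    crossing and adjacency steps, which lower the degree.\<close>
  have mem:
    "u < p \<longrightarrow> p < v \<longrightarrow> v < s \<longrightarrow> z \<in> F (d i j + d u s + d p v)"
    "i < p \<longrightarrow> p < j \<longrightarrow> j < s \<longrightarrow> z \<in> F (d i s + d u v + d p j)"
    "i < u \<longrightarrow> u < j \<longrightarrow> j < v \<longrightarrow> z \<in> F (d i v + d u j + d p s)"
    "u < p \<longrightarrow> p < v \<longrightarrow> v < s \<longrightarrow> z \<in> F (d i j + d p v)"
    "i < p \<longrightarrow> p < j \<longrightarrow> j < s \<longrightarrow> z \<in> F (d u v + d p j)"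
    "i < u \<longrightarrow> u < j \<longrightarrow> j < v \<longrightarrow> z \<in> F (d u j + d p s)"
    "j = u \<longrightarrow> z \<in> F (d i v + d p s)"
    "j = p \<longrightarrow> z \<in> F (d i s + d u v)"
    "v = p \<longrightarrow> z \<in> F (d i j + d u s)"
    using lt pos d_crossing[of u p v s] d_crossing[of i p j s] d_crossing[of i u j v]
      d_adjacent[of i u v] d_adjacent[of i p s] d_adjacent[of u p s] by (auto intro!: z)
  have mem':
    "u < p \<longrightarrow> p < j \<longrightarrow> j < v \<longrightarrow> j < s \<longrightarrow> z \<in> F (d i v + d u s + d p j)"
    "i < u \<longrightarrow> u < j \<longrightarrow> j < v \<longrightarrow> i < p \<longrightarrow> p < v \<longrightarrow> v < s \<longrightarrow> z \<in> F (d u j + d p v)"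
    "j = p \<longrightarrow> u < p \<longrightarrow> j < v \<longrightarrow> z \<in> F (d i v + d u s)"
    using lt lex pos d_crossing[of i u j v] d_crossing[of u p j s] d_crossing[of i p j s] d_crossing[of i p v s]
      d_adjacent[of u p s] d_adjacent[of i p s] by (auto intro!: z)
  note rels = E_left E_right E_adjacent disjoint nested E_crossing
  show ?thesis
    \<comment> \<open>Arithmetic discards the incompatible combinations of the three relative
      positions. In the others both reductions are rewritten to lexicographic normal form, where the
      coefficients agree by \<open>q * qi = 1\<close>.\<close>
    by (rule interval_pair_cases[OF lt(2) lt(4) lex(1)]; rule interval_pair_cases[OF lt(2) lt(6) lex'];
        rule interval_pair_cases[OF lt(4) lt(6) lex(2)]; (use lt in linarith)?;
        insert lt; (simp add: twist_def comm_def)?; insert mem mem'; simp?;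
        (simp add: rels E_F ac_simps)?; (simp add: algebra_simps)?)
qed

end

section \<open>The algebra of positive root vectors\<close>

lemma qvar_inverse [simp]: "qvar * qvar_inv = 1"
  by transfer (simp add: inverse_mult_eq_1')

lemma qpow_simps [simp]: "qpow 0 = 1" "qpow 1 = qvar" "qpow (- 1) = qvar_inv"
  by (simp_all add: qpow_def)

lemma qpow_Suc: "qpow (c + 1) = qvar * qpow c"
proof (cases "c \<ge> 0")
  case True
  then show ?thesis by (simp add: qpow_def nat_add_distrib)
next
  case False
  then have "nat (- c) = Suc (nat (- (c + 1)))" by simp
  then show ?thesis
    using False by (auto simp: qpow_def simp flip: mult.assoc)
qed

lemma qpow_add: "qpow (a + b) = (qpow a * qpow b :: 'a::field_char_0 q_laurent)"
proof (induction a rule: int_induct[where k = 0])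
  case base
  then show ?case by simp
next
  case (step1 i)
  then show ?case using qpow_Suc[of "i + b", where 'a = 'a] qpow_Suc[of i, where 'a = 'a] by (simp add: algebra_simps)
next
  case (step2 i)
  have pred: "qpow (c - 1) = (qvar_inv * qpow c :: 'a q_laurent)" for c
    using qpow_Suc[of "c - 1", where 'a = 'a] by (simp add: mult.assoc[symmetric] mult.commute[of qvar_inv])
  show ?case using step2 pred[of "i + b"] pred[of i] by (simp add: algebra_simps)
qed

text \<open>The inner product of the roots \<open>\<epsilon>\<^sub>a - \<epsilon>\<^sub>b\<close> and \<open>\<epsilon>\<^sub>u - \<epsilon>\<^sub>v\<close>.\<close>

definition root_form :: "nat \<times> nat \<Rightarrow> nat \<times> nat \<Rightarrow> int" where
  "root_form = (\<lambda>(a, b) (u, v). of_bool (a = u) + of_bool (b = v) - of_bool (a = v) - of_bool (b = u))"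

lemma root_form_simp [simp]:
  "root_form (a, b) (u, v) = of_bool (a = u) + of_bool (b = v) - of_bool (a = v) - of_bool (b = u)"
  by (simp add: root_form_def)

lemma root_form_sym: "root_form x y = root_form y x"
  by (cases x, cases y) (auto simp: eq_commute)

lemma sum_mat_unit:
  assumes "1 \<le> u" "u \<le> n + 1" "1 \<le> v" "v \<le> n + 1"
  shows "(\<Sum>k=1..n+1. f k * mat_unit u v k s) = (if s = v then f u else 0)"
    and "(\<Sum>k=1..n+1. mat_unit u v r k * f k) = (if r = u then f v else 0)"
proof -
  have "f k * mat_unit u v k s = (if k = u then (if s = v then f u else 0) else 0)" for k
    by (simp add: mat_unit_def)
  then show "(\<Sum>k=1..n+1. f k * mat_unit u v k s) = (if s = v then f u else 0)"
    using assms by (simp del: sum.cl_ivl_Suc)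
  have "mat_unit u v r k * f k = (if k = v then (if r = u then f v else 0) else 0)" for k
    by (simp add: mat_unit_def)
  then show "(\<Sum>k=1..n+1. mat_unit u v r k * f k) = (if r = u then f v else 0)"
    using assms by (simp del: sum.cl_ivl_Suc)
qed

text \<open>Commutation with a diagonal matrix multiplies \<open>e_uv\<close> by the difference of
  its diagonal entries at \<open>u\<close> and \<open>v\<close>. Reading the entry at
  \<open>(u, v)\<close> shows that the factor is unique, which settles the definite
  description.\<close>

lemma sl_c_eq:
  assumes "x \<in> sl_basis n" "y \<in> sl_basis n"
  shows "sl_c n x y = root_form x y"
proof -
  obtain a b u v where xy: "x = (a, b)" "y = (u, v)" by (cases x, cases y)
  then have u: "1 \<le> u" "u \<le> n + 1" "1 \<le> v" "v \<le> n + 1"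
    using assms by (auto simp: sl_basis_def)
  have eq: "mat_commutator n (\<lambda>r s. mat_unit a a r s - mat_unit b b r s) (mat_unit u v)
      = (\<lambda>r s. root_form x y * mat_unit u v r s)"
    unfolding mat_commutator_def sum_mat_unit[OF u]
    using assms by (intro ext) (auto simp: xy sl_basis_def mat_unit_def)
  have uniq: "c = c'" if "(\<lambda>r s. c * mat_unit u v r s) = (\<lambda>r s. c' * mat_unit u v r s)" for c c'
    using fun_cong[OF fun_cong[OF that, of u], of v] by (simp add: mat_unit_def)
  have "sl_c n x y = (THE c. mat_commutator n (\<lambda>r s. mat_unit a a r s - mat_unit b b r s) (mat_unit u v)
      = (\<lambda>r s. c * mat_unit u v r s))"
    by (simp add: sl_c_def xy)
  also have "\<dots> = root_form x y"
    by (rule the_equality, rule eq) (rule uniq, simp only: eq)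
  finally show ?thesis .
qed

text \<open>For an increasing pair \<open>v = a\<close> is impossible, as it would give
  \<open>u + v < a + b\<close>; so at most one of the two matrix products survives.\<close>

lemma sl_commutator_eq:
  assumes "(a, b) \<in> sl_basis n" "(u, v) \<in> sl_basis n" "v \<noteq> a"
  shows "sl_commutator n (a, b) (u, v) = (if b = u then bvec (a, v) else 0)"
proof -
  have u: "1 \<le> u" "u \<le> n + 1" "1 \<le> v" "v \<le> n + 1" and a: "1 \<le> a" "a \<le> n + 1" "1 \<le> b" "b \<le> n + 1"
    using assms by (auto simp: sl_basis_def)
  have "mat_commutator n (mat_unit a b) (mat_unit u v) i j = of_bool (b = u \<and> (i, j) = (a, v))" for i j
    unfolding mat_commutator_def sum_mat_unit(1)[OF u] sum_mat_unit(1)[OF a]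
    using assms by (auto simp: sl_basis_def mat_unit_def)
  then have "sl_commutator n (a, b) (u, v)
      = (\<Sum>p\<in>sl_basis n. if p = (a, v) then (if b = u then bvec (a, v) else 0) else 0)"
    unfolding sl_commutator_def by (intro sum.cong) (auto simp: of_bool_def split: if_splits)
  moreover have "finite (sl_basis n)"
    by (rule finite_subset[of _ "{..n+1} \<times> {..n+1}"]) (auto simp: sl_basis_def)
  ultimately show ?thesis
    using assms by (auto simp: sl_basis_def)
qed

text \<open>Adjacent intervals have roots with inner product -1, so for a decreasing pair the factor
  \<open>- q^(-c)\<close> is \<open>- q\<close>.\<close>

lemma sl_br_basis_eq:
  assumes "(a, b) \<in> sl_basis n" "(u, v) \<in> sl_basis n"
  shows "sl_br_basis n (a, b) (u, v)
    = (if b = u then bvec (a, v) else if v = a then smul (- qvar) (bvec (u, b)) else 0)"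
  using assms
  by (auto simp: sl_br_basis_def sl_less_def sl_commutator_eq sl_c_eq sl_basis_def)

definition sl_coeff :: "nat \<times> nat \<Rightarrow> nat \<times> nat \<Rightarrow> 'a::field_char_0 q_laurent" where
  "sl_coeff x y = (if x = y then 1 else if sl_less x y then qpow (root_form x y) else qpow (- root_form x y))"

lemma sl_S_basis_eq:
  assumes "x \<in> sl_basis n" "y \<in> sl_basis n"
  shows "sl_S_basis n x y = smul (sl_coeff x y) (bvec (y, x))"
  using assms by (simp add: sl_S_basis_def sl_coeff_def sl_c_eq root_form_sym[of y x])

section \<open>The structure maps as linear extensions\<close>

lemma sl_q_simps [simp]:
  "tbasis (sl_q n) = sl_basis n" "tless (sl_q n) = sl_less" "tdeg (sl_q n) (i, j) = i * (j - i)"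
  "tpair (sl_q n) (bvec (x, y)) = sl_pair_basis x y"
  "tbr (sl_q n) (bvec (x, y)) = sl_br_basis n x y"
  "tS (sl_q n) (bvec (x, y)) = sl_S_basis n x y"
  by (simp_all add: sl_q_def)

lemma q_coeff_sl_q:
  "x \<in> sl_basis n \<Longrightarrow> y \<in> sl_basis n \<Longrightarrow> q_coeff (sl_q n) x y = sl_coeff x y"
  by (simp add: q_coeff_def sl_S_basis_eq)

lemma sl_q_lin_ext:
  "tS (sl_q n) = lin_ext (\<lambda>(x, y). sl_S_basis n x y)"
  "tpair (sl_q n) = lin_ext (\<lambda>(x, y). sl_pair_basis x y)"
  "tbr (sl_q n) = lin_ext (\<lambda>(x, y). sl_br_basis n x y)"
  "tT (sl_q n) = (\<lambda>u. tS (sl_q n) u + tpair (sl_q n) u)"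
  by (simp_all add: sl_q_def)

lemma sl_q_linear [simp]:
  "tS (sl_q n) (u + v) = tS (sl_q n) u + tS (sl_q n) v" "tS (sl_q n) (smul c u) = smul c (tS (sl_q n) u)"
  "tpair (sl_q n) (u + v) = tpair (sl_q n) u + tpair (sl_q n) v" "tpair (sl_q n) (smul c u) = smul c (tpair (sl_q n) u)"
  "tbr (sl_q n) (w + w') = tbr (sl_q n) w + tbr (sl_q n) w'" "tbr (sl_q n) (smul c w) = smul c (tbr (sl_q n) w)"
  "tbr (sl_q n) (w - w') = tbr (sl_q n) w - tbr (sl_q n) w'"
  "tbr (sl_q n) (- w) = - tbr (sl_q n) w" "tS (sl_q n) (- w) = - tS (sl_q n) w"
  "tS (sl_q n) 0 = 0" "tpair (sl_q n) 0 = 0" "tbr (sl_q n) 0 = 0"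
  by (simp_all add: sl_q_lin_ext)

text \<open>The structure maps of \<open>sl_q\<close> are linear on all finitely supported
  functions, so identities between their composites reduce to basis vectors.\<close>

lemma linear_maps_cong:
  assumes "f \<in> linear_maps UNIV UNIV" "g \<in> linear_maps UNIV UNIV"
    and u: "u \<in> free_module C" and eq: "\<And>x. x \<in> C \<Longrightarrow> f (bvec x) = g (bvec x)"
  shows "f u = g u"
proof -
  have "f \<in> linear_maps (free_module C) UNIV" "g \<in> linear_maps (free_module C) UNIV"
    using assms(1,2) by (auto simp: linear_maps_def)
  from this[THEN linear_maps_eq_lin_ext, OF u] show ?thesis
    using lin_ext_cong_free_module[OF u eq] by simp
qed

lemma lin_ext_linear_maps:
  "(\<And>x. x \<in> B \<Longrightarrow> h x \<in> free_module C) \<Longrightarrow> lin_ext h \<in> linear_maps (free_module B) (free_module C)"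
  by (auto simp: linear_maps_def intro: free_module_lin_ext)

lemma sl_coeff_inverse [simp]:
  assumes "x \<in> sl_basis n" "y \<in> sl_basis n"
  shows "sl_coeff x y * sl_coeff y x = (1 :: 'a::field_char_0 q_laurent)"
  using qpow_add[of "root_form x y" "- root_form x y", where 'a = 'a]
  by (cases x, cases y) (auto simp: sl_coeff_def root_form_sym[of y x] sl_less_def mult.commute)

lemma sl_pair_basis_eq:
  "sl_pair_basis (i, j) (u, v) =
    (if i < u \<and> u < j \<and> j < v then smul (qvar - qvar_inv) (bvec ((i, v), (u, j)))
     else if u < i \<and> i < v \<and> v < j then smul (qvar_inv - qvar) (bvec ((u, j), (i, v)))
     else 0)"
  by (simp add: sl_pair_basis_def)

text \<open>The right side exceeds the left by \<open>(u - i) * (v - j)\<close>.\<close>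

lemma crossing_degree:
  fixes i u j v :: nat
  assumes "i < u" "u < j" "j < v"
  shows "i * (v - i) + u * (j - u) < i * (j - i) + u * (v - u)"
proof -
  obtain a b c where "u = i + Suc a" "j = u + Suc b" "v = j + Suc c"
    using assms by (metis less_imp_Suc_add add_Suc_right)
  then show ?thesis by (simp add: algebra_simps)
qed

text \<open>The right side exceeds the left by \<open>(j - i) * (k - j)\<close>.\<close>

lemma adjacent_degree:
  fixes i j k :: nat
  assumes "i < j" "j < k"
  shows "i * (k - i) < i * (j - i) + j * (k - j)"
proof -
  obtain a b where "j = i + Suc a" "k = j + Suc b"
    using assms by (metis less_imp_Suc_add add_Suc_right)
  then show ?thesis by (simp add: algebra_simps)
qed

lemma op_bvec_simps:
  "op12 f (bvec (x, y, z)) = assoc_r (tens (f (bvec (x, y))) (bvec z))"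
  "op23 f (bvec (x, y, z)) = tens (bvec x) (f (bvec (y, z)))"
  "br_id b (bvec (x, y, z)) = tens (b (bvec (x, y))) (bvec z)"
  "id_br b (bvec (x, y, z)) = tens (bvec x) (b (bvec (y, z)))"
  "assoc_r (smul c w) = smul c (assoc_r w)"
  "op12 f (smul c u) = smul c (op12 f u)" "op23 f (smul c u) = smul c (op23 f u)"
  "br_id b (smul c u) = smul c (br_id b u)" "id_br b (smul c u) = smul c (id_br b u)"
  "op12 f (u + v) = op12 f u + op12 f v" "op23 f (u + v) = op23 f u + op23 f v"
  "br_id b (u + v) = br_id b u + br_id b v" "id_br b (u + v) = id_br b u + id_br b v"
  by (simp_all add: op12_def op23_def br_id_def id_br_def tens_map_def assoc_l_def assoc_r_def)

lemma sl_coeff_eq: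
  "sl_less x y \<Longrightarrow> sl_coeff x y = qpow (root_form x y)"
  "sl_less x y \<Longrightarrow> sl_coeff y x = qpow (- root_form x y)"
  by (cases x, cases y, force simp: sl_coeff_def sl_less_def root_form_sym)+

theorem basic_sl_q: "basic_T_Lie_algebra (sl_q n :: (nat \<times> nat, 'a::field_char_0 q_laurent) tlie_data)"
proof -
  let ?A = "sl_q n :: (nat \<times> nat, 'a q_laurent) tlie_data"
  note lin = linear_maps_def op_bvec_simps
  have le_pred: "k \<le> l - 1" if "k < l" for k l :: nat
    using that by simp
  show ?thesis
  proof (unfold_locales)
    show "irreflp_on (tbasis ?A) (tless ?A)" "transp_on (tbasis ?A) (tless ?A)" "totalp_on (tbasis ?A) (tless ?A)"
      by (auto simp: irreflp_on_def transp_on_def totalp_on_def sl_less_def)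
    show S: "tS ?A \<in> linear_maps (free_module (tbasis ?A \<times> tbasis ?A)) (free_module (tbasis ?A \<times> tbasis ?A))"
      unfolding sl_q_lin_ext by (rule lin_ext_linear_maps) (auto simp: sl_S_basis_eq)
    show P: "tpair ?A \<in> linear_maps (free_module (tbasis ?A \<times> tbasis ?A)) (free_module (tbasis ?A \<times> tbasis ?A))"
      unfolding sl_q_lin_ext by (rule lin_ext_linear_maps) (auto simp: sl_pair_basis_eq sl_basis_def)
    show "tT ?A \<in> linear_maps (free_module (tbasis ?A \<times> tbasis ?A)) (free_module (tbasis ?A \<times> tbasis ?A))"
      using S P by (auto simp: linear_maps_def sl_q_lin_ext(4) smul.scale_right_distrib)
    show "tbr ?A \<in> linear_maps (free_module (tbasis ?A \<times> tbasis ?A)) (free_module (tbasis ?A))"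
      unfolding sl_q_lin_ext by (rule lin_ext_linear_maps) (auto simp: sl_br_basis_eq, auto simp: sl_basis_def)
    show "\<forall>u\<in>free_module (tbasis ?A \<times> tbasis ?A). tS ?A (tS ?A u) = u"
    proof
      fix u :: "(nat \<times> nat) \<times> (nat \<times> nat) \<Rightarrow>\<^sub>0 'a q_laurent" assume "u \<in> free_module (tbasis ?A \<times> tbasis ?A)"
      then show "tS ?A (tS ?A u) = u"
        by (rule linear_maps_cong[rotated 2]) (auto simp: lin sl_S_basis_eq)
    qed
    show "\<forall>x\<in>tbasis ?A. \<forall>y\<in>tbasis ?A. \<exists>q. tS ?A (bvec (x, y)) = smul q (bvec (y, x))"
      by (auto simp: sl_S_basis_eq)
    let ?L3 = "{(x, y, z). x \<in> tbasis ?A \<and> y \<in> tbasis ?A \<and> z \<in> tbasis ?A \<and> tless ?A x y \<and> tless ?A y z}"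
    show "\<forall>u\<in>free_module ?L3. tS ?A (id_br (tbr ?A) u) = br_id (tbr ?A) (op23 (tS ?A) (op12 (tS ?A) u))"
    proof
      fix u :: "(nat \<times> nat) \<times> (nat \<times> nat) \<times> (nat \<times> nat) \<Rightarrow>\<^sub>0 'a q_laurent" assume "u \<in> free_module ?L3"
      then show "tS ?A (id_br (tbr ?A) u) = br_id (tbr ?A) (op23 (tS ?A) (op12 (tS ?A) u))"
      proof (rule linear_maps_cong[rotated 2], goal_cases)
        case (1 p)
        then obtain a b c d e f where p: "p = ((a, b), (c, d), (e, f))"
          and B: "(a, b) \<in> sl_basis n" "(c, d) \<in> sl_basis n" "(e, f) \<in> sl_basis n"
          and less: "sl_less (a, b) (c, d)" "sl_less (c, d) (e, f)" by auto
        show ?case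
        proof (cases "d = e")
          case True
          have B': "(c, f) \<in> sl_basis n" "sl_less (a, b) (c, f)" "sl_less (a, b) (e, f)" "f \<noteq> c"
            using B less True by (auto simp: sl_basis_def sl_less_def)
          \<comment> \<open>The bracket of adjacent intervals is the interval whose root is the sum
            of theirs, so the exponents of \<open>q\<close> add.\<close>
          have "root_form (a, b) (c, f) = root_form (a, b) (c, d) + root_form (a, b) (e, f)"
            using True by auto
          then show ?thesis
            using B B' less True by (simp add: p lin sl_br_basis_eq sl_S_basis_eq sl_coeff_eq qpow_add del: root_form_simp)
        next
          case False
          have "f \<noteq> c" using B less by (auto simp: sl_basis_def sl_less_def)
          with False show ?thesis
            using B by (simp add: p lin sl_br_basis_eq sl_S_basis_eq)
        qed
      qed (auto simp: lin)
    qed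
    show "\<forall>u\<in>free_module ?L3. tS ?A (br_id (tbr ?A) u) = id_br (tbr ?A) (op12 (tS ?A) (op23 (tS ?A) u))"
    proof
      fix u :: "(nat \<times> nat) \<times> (nat \<times> nat) \<times> (nat \<times> nat) \<Rightarrow>\<^sub>0 'a q_laurent" assume "u \<in> free_module ?L3"
      then show "tS ?A (br_id (tbr ?A) u) = id_br (tbr ?A) (op12 (tS ?A) (op23 (tS ?A) u))"
      proof (rule linear_maps_cong[rotated 2], goal_cases)
        case (1 p)
        then obtain a b c d e f where p: "p = ((a, b), (c, d), (e, f))"
          and B: "(a, b) \<in> sl_basis n" "(c, d) \<in> sl_basis n" "(e, f) \<in> sl_basis n"
          and less: "sl_less (a, b) (c, d)" "sl_less (c, d) (e, f)" by auto
        show ?case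
        proof (cases "b = c")
          case True
          have B': "(a, d) \<in> sl_basis n" "sl_less (a, d) (e, f)" "sl_less (a, b) (e, f)" "d \<noteq> a"
            using B less True by (auto simp: sl_basis_def sl_less_def)
          have "root_form (a, d) (e, f) = root_form (c, d) (e, f) + root_form (a, b) (e, f)"
            using True by auto
          then show ?thesis
            using B B' less True by (simp add: p lin sl_br_basis_eq sl_S_basis_eq sl_coeff_eq qpow_add del: root_form_simp)
        next
          case False
          have "d \<noteq> a" using B less by (auto simp: sl_basis_def sl_less_def)
          with False show ?thesis
            using B by (simp add: p lin sl_br_basis_eq sl_S_basis_eq)
        qed
      qed (auto simp: lin)
    qed
    show "\<forall>x\<in>tbasis ?A. 1 \<le> tdeg ?A x"
      by (auto simp: sl_basis_def)
    show "\<forall>d1\<ge>1. \<forall>d2\<ge>1. \<forall>u\<in>free_module (degree_part ?A d1 \<times> degree_part ?A d2).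
        tbr ?A u \<in> free_module {x \<in> tbasis ?A. tdeg ?A x \<le> d1 + d2 - 1}"
    proof (intro allI impI ballI)
      fix d1 d2 and u :: "(nat \<times> nat) \<times> (nat \<times> nat) \<Rightarrow>\<^sub>0 'a q_laurent"
      assume u: "u \<in> free_module (degree_part ?A d1 \<times> degree_part ?A d2)"
      have "sl_br_basis n (a, b) (c, d) \<in> free_module {x \<in> tbasis ?A. tdeg ?A x \<le> d1 + d2 - 1}"
        if "(a, b) \<in> degree_part ?A d1" "(c, d) \<in> degree_part ?A d2" for a b c d
      proof -
        have B: "(a, b) \<in> sl_basis n" "(c, d) \<in> sl_basis n" and deg: "d1 = a * (b - a)" "d2 = c * (d - c)"
          using that by (auto simp: degree_part_def)
        then show ?thesis
          using adjacent_degree[of a b d] adjacent_degree[of c d b]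
          by (auto simp: sl_br_basis_eq intro!: free_module_bvec free_module_uminus free_module_smul) (auto simp: sl_basis_def)
      qed
      then show "tbr ?A u \<in> free_module {x \<in> tbasis ?A. tdeg ?A x \<le> d1 + d2 - 1}"
        unfolding sl_q_lin_ext by (intro free_module_lin_ext[OF u]) auto
    qed
    show "\<forall>d1\<ge>1. \<forall>d2\<ge>1. \<forall>u\<in>free_module (degree_part ?A d1 \<times> degree_part ?A d2).
        tpair ?A u \<in> free_module {(x, y). x \<in> tbasis ?A \<and> y \<in> tbasis ?A \<and> tdeg ?A x + tdeg ?A y \<le> d1 + d2 - 1}"
    proof (intro allI impI ballI)
      fix d1 d2 and u :: "(nat \<times> nat) \<times> (nat \<times> nat) \<Rightarrow>\<^sub>0 'a q_laurent"
      assume u: "u \<in> free_module (degree_part ?A d1 \<times> degree_part ?A d2)"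
      have "sl_pair_basis (a, b) (c, d) \<in> free_module {(x, y). x \<in> tbasis ?A \<and> y \<in> tbasis ?A \<and> tdeg ?A x + tdeg ?A y \<le> d1 + d2 - 1}"
        if "(a, b) \<in> degree_part ?A d1" "(c, d) \<in> degree_part ?A d2" for a b c d
      proof -
        have B: "(a, b) \<in> sl_basis n" "(c, d) \<in> sl_basis n" and deg: "d1 = a * (b - a)" "d2 = c * (d - c)"
          using that by (auto simp: degree_part_def)
        then show ?thesis
          using crossing_degree[of a c b d, THEN le_pred] crossing_degree[of c a d b, THEN le_pred]
          by (auto simp: sl_pair_basis_eq sl_basis_def add.commute intro!: free_module_bvec free_module_smul)
      qed
      then show "tpair ?A u \<in> free_module {(x, y). x \<in> tbasis ?A \<and> y \<in> tbasis ?A \<and> tdeg ?A x + tdeg ?A y \<le> d1 + d2 - 1}"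
        unfolding sl_q_lin_ext by (intro free_module_lin_ext[OF u]) auto
    qed
    show "\<forall>u\<in>free_module (tbasis ?A \<times> tbasis ?A). tT ?A u = tS ?A u + tpair ?A u"
      by (simp add: sl_q_lin_ext(4))
    have br_S: "tbr ?A (tS ?A u) = - tbr ?A u" and pair_S: "tpair ?A (tS ?A u) = - tpair ?A u"
      and br_pair: "tbr ?A (tpair ?A u) = 0" if u: "u \<in> free_module (tbasis ?A \<times> tbasis ?A)" for u :: "(nat \<times> nat) \<times> (nat \<times> nat) \<Rightarrow>\<^sub>0 'a q_laurent"
    proof -
      show "tbr ?A (tS ?A u) = - tbr ?A u"
        using u
      proof (rule linear_maps_cong[rotated 2], goal_cases)
        case (1 p)
        then obtain a b c d where p: "p = ((a, b), (c, d))" and B: "(a, b) \<in> sl_basis n" "(c, d) \<in> sl_basis n" by auto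
        have "sl_coeff (a, b) (b, d) = (qvar_inv :: 'a q_laurent)" if "b = c"
          using B that by (auto simp: sl_coeff_def sl_less_def sl_basis_def)
        moreover have "sl_coeff (a, b) (c, a) = (qvar :: 'a q_laurent)" if "d = a"
          using B that by (auto simp: sl_coeff_def sl_less_def sl_basis_def)
        ultimately show ?case
          using B by (auto simp: p sl_br_basis_eq sl_S_basis_eq sl_basis_def mult.commute)
      qed (auto simp: lin)
      show "tpair ?A (tS ?A u) = - tpair ?A u"
        using u
      proof (rule linear_maps_cong[rotated 2], goal_cases)
        case (1 p)
        then obtain a b c d where p: "p = ((a, b), (c, d))" and B: "(a, b) \<in> sl_basis n" "(c, d) \<in> sl_basis n" by auto
        \<comment> \<open>Crossing intervals have orthogonal roots, so \<open>S\<close> is the plain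
          flip on them.\<close>
        have "sl_coeff (a, b) (c, d) = (1 :: 'a q_laurent)" if "a < c \<and> c < b \<and> b < d \<or> c < a \<and> a < d \<and> d < b"
          using B that by (auto simp: sl_coeff_def sl_less_def sl_basis_def)
        then show ?case
          using B by (auto simp: p sl_pair_basis_eq sl_S_basis_eq smul.scale_left_diff_distrib)
      qed (auto simp: lin)
      show "tbr ?A (tpair ?A u) = 0"
        using u
      proof (rule linear_maps_cong[rotated 2], goal_cases)
        case (1 p)
        then obtain a b c d where p: "p = ((a, b), (c, d))" and B: "(a, b) \<in> sl_basis n" "(c, d) \<in> sl_basis n" by auto
        \<comment> \<open>The pairing produces strictly nested intervals; they share no end point,
          so their bracket vanishes.\<close>
        have "(a, d) \<in> sl_basis n \<and> (c, b) \<in> sl_basis n" if "a < c \<and> c < b \<and> b < d \<or> c < a \<and> a < d \<and> d < b"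
          using B that by (auto simp: sl_basis_def)
        then show ?case
          using B by (auto simp: p sl_pair_basis_eq sl_br_basis_eq)
      qed (auto simp: lin)
    qed
    show "\<forall>u\<in>free_module (tbasis ?A \<times> tbasis ?A). tbr ?A (tT ?A u) = - tbr ?A u"
      by (simp add: sl_q_lin_ext(4) br_S[simplified] br_pair[simplified])
    show "\<forall>u\<in>free_module (tbasis ?A \<times> tbasis ?A). tpair ?A (tS ?A u) = - tpair ?A u"
      using pair_S by blast
    show "\<forall>u\<in>free_module (tbasis ?A \<times> tbasis ?A). tbr ?A (tpair ?A u) = 0"
      using br_pair by blast
    show "\<forall>u\<in>free_module {(x, y, z). x \<in> tbasis ?A \<and> y \<in> tbasis ?A \<and> z \<in> tbasis ?A \<and> tless ?A y x \<and> tless ?A z y}.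
         tbr ?A (id_br (tbr ?A) (op12 (tS ?A) (op23 (tS ?A) u))
                - br_id (tbr ?A) (op23 (tS ?A) (op12 (tS ?A) u))
                + id_br (tbr ?A) (op23 (tS ?A) (op12 (tS ?A) u))) = 0"
    proof
      fix u :: "(nat \<times> nat) \<times> (nat \<times> nat) \<times> (nat \<times> nat) \<Rightarrow>\<^sub>0 'a q_laurent"
      assume "u \<in> free_module {(x, y, z). x \<in> tbasis ?A \<and> y \<in> tbasis ?A \<and> z \<in> tbasis ?A \<and> tless ?A y x \<and> tless ?A z y}"
      then show "tbr ?A (id_br (tbr ?A) (op12 (tS ?A) (op23 (tS ?A) u))
                - br_id (tbr ?A) (op23 (tS ?A) (op12 (tS ?A) u))
                + id_br (tbr ?A) (op23 (tS ?A) (op12 (tS ?A) u))) = 0"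
      proof (rule linear_maps_cong[rotated 2], goal_cases)
        case (1 p)
        then obtain a b c d e f where p: "p = ((e, f), (c, d), (a, b))"
          and B: "(a, b) \<in> sl_basis n" "(c, d) \<in> sl_basis n" "(e, f) \<in> sl_basis n"
          and less: "sl_less (a, b) (c, d)" "sl_less (c, d) (e, f)" by auto
        \<comment> \<open>These inequalities leave nonzero terms only for a chain
          \<open>b = c\<close>, \<open>d = e\<close> of adjacent intervals. There the first two
          terms cancel, since both adjacent exchanges carry the factor \<open>q\<close>.\<close>
        have ne: "f \<noteq> c" "d \<noteq> a" "f \<noteq> a"
          using B less by (auto simp: sl_basis_def sl_less_def)
        have B': "d = e \<Longrightarrow> (c, f) \<in> sl_basis n" "b = c \<Longrightarrow> (a, d) \<in> sl_basis n" "b = e \<Longrightarrow> (a, f) \<in> sl_basis n"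
          using B by (auto simp: sl_basis_def)
        have coeff: "sl_coeff (e, f) (c, d) = (qvar :: 'a q_laurent)" if "d = e"
          using B that ne less by (auto simp: sl_coeff_eq sl_basis_def)
        have coeff': "sl_coeff (c, d) (a, b) = (qvar :: 'a q_laurent)" if "b = c"
          using B that ne less by (auto simp: sl_coeff_eq sl_basis_def)
        have "id_br (tbr ?A) (op12 (tS ?A) (op23 (tS ?A) (bvec p)))
                - br_id (tbr ?A) (op23 (tS ?A) (op12 (tS ?A) (bvec p)))
                + id_br (tbr ?A) (op23 (tS ?A) (op12 (tS ?A) (bvec p)))
          = smul (sl_coeff (c, d) (a, b) * sl_coeff (e, f) (a, b)) (tens (bvec (a, b)) (sl_br_basis n (e, f) (c, d)))
          - smul (sl_coeff (e, f) (c, d) * sl_coeff (e, f) (a, b)) (tens (sl_br_basis n (c, d) (a, b)) (bvec (e, f)))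
          + smul (sl_coeff (e, f) (c, d) * sl_coeff (e, f) (a, b)) (tens (bvec (c, d)) (sl_br_basis n (a, b) (e, f)))"
          using B by (simp add: p lin sl_S_basis_eq)
        then show ?case
          using B B' ne coeff coeff' by (simp add: sl_br_basis_eq) (auto simp: sl_br_basis_eq sl_basis_def)
      qed (auto simp: lin algebra_simps)
    qed
  qed
qed

lemma unital_sl_q: "unital_T_Lie_algebra (sl_q n :: (nat \<times> nat, 'a::field_char_0 q_laurent) tlie_data)"
  using basic_sl_q[of n, where 'a = 'a]
  by (auto simp: unital_T_Lie_algebra_def unital_T_Lie_algebra_axioms_def q_coeff_sl_q sl_coeff_def)

lemma adequate_sl_q: "adequate (sl_q n :: (nat \<times> nat, 'a::field_char_0 q_laurent) tlie_data)"
proof -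
  interpret sl: unital_T_Lie_algebra "sl_q n :: (nat \<times> nat, 'a q_laurent) tlie_data"
    by (rule unital_sl_q)
  \<comment> \<open>The order of the basis and the lexicographic order disagree only on strictly
    nested intervals. Their roots are orthogonal, so the scalar is 1 either way.\<close>
  have coeff: "sl_coeff (u, v) (i, j) = (if j = u then qvar else if i = u \<or> j = v then qvar_inv else (1 :: 'a q_laurent))"
    if "(i, j) \<in> sl_basis n" "(u, v) \<in> sl_basis n" "i < u \<or> i = u \<and> j < v" for i j u v
    using that by (auto simp: sl_coeff_def sl_less_def sl_basis_def)
  have comm: "sl.comm_act Y (u, v) (i, j) z =
      (if j = u then - smul qvar (vact Y (bvec (i, v)) z)
       else if i < u \<and> u < j \<and> j < v then smul (qvar_inv - qvar) (vact Y (bvec (i, v)) (vact Y (bvec (u, j)) z)) else 0)"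
    if "(i, j) \<in> sl_basis n" "(u, v) \<in> sl_basis n" "i < u \<or> i = u \<and> j < v" for Y i j u v z
    using that by (auto simp: sl_br_basis_eq sl_pair_basis_eq, auto simp: sl_basis_def)
  show ?thesis
  proof (rule sl.adequateI)
    fix r Y and x y w :: "nat \<times> nat" and z
    assume Y: "sl.filtered r Y" and rel: "sl.relations_upto r Y"
      and B: "x \<in> tbasis (sl_q n :: (_, 'a q_laurent) tlie_data)" "y \<in> tbasis (sl_q n :: (_, 'a q_laurent) tlie_data)"
        "w \<in> tbasis (sl_q n :: (_, 'a q_laurent) tlie_data)"
      and less: "tless (sl_q n :: (_, 'a q_laurent) tlie_data) y x" "tless (sl_q n :: (_, 'a q_laurent) tlie_data) w y"
      and z: "z \<in> sl.fil (r + 1) (tdeg (sl_q n :: (_, 'a q_laurent) tlie_data) x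
        + tdeg (sl_q n :: (_, 'a q_laurent) tlie_data) y + tdeg (sl_q n :: (_, 'a q_laurent) tlie_data) w)"
    define E where "E i j = vact Y (bvec (i, j))" for i j
    define d :: "nat \<Rightarrow> nat \<Rightarrow> nat" where "d i j = i * (j - i)" for i j
    have exchange: "E u v (E i j z) = smul (sl_coeff (u, v) (i, j)) (E i j (E u v z)) + sl.comm_act Y (u, v) (i, j) z"
      if "(i, j) \<in> sl_basis n" "(u, v) \<in> sl_basis n" "z \<in> sl.fil r (d i j + d u v)" for i j u v z
    proof -
      have "z \<in> sl.fil r (tdeg (sl_q n :: (_, 'a q_laurent) tlie_data) (u, v) + tdeg (sl_q n :: (_, 'a q_laurent) tlie_data) (i, j))"
        using that(3) by (simp add: d_def add.commute)
      then have "E u v (E i j z) = smul (q_coeff (sl_q n) (u, v) (i, j)) (E i j (E u v z)) + sl.comm_act Y (u, v) (i, j) z"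
        using rel[unfolded sl.relations_upto_def, rule_format, of "(u, v)" "(i, j)" z] that(1,2)
        by (simp only: E_def sl_q_simps)
      then show ?thesis using that(1,2) by (simp only: q_coeff_sl_q)
    qed
    interpret interval_operators E "sl.fil r" d "n + 1" qvar qvar_inv
    proof unfold_locales
      fix i j u v k e x z
      show "qvar * qvar_inv = (1 :: 'a q_laurent)" by simp
      show "E i j (x + y) = E i j x + E i j y" for y by (simp add: E_def)
      show "E i j (smul c x) = smul c (E i j x)" for c by (simp add: E_def)
      show "0 < d i j" if "1 \<le> i" "i < j" using that by (simp add: d_def)
      show "d i k < d i j + d j k" if "1 \<le> i" "i < j" "j < k"
        using adjacent_degree that by (simp add: d_def)
      show "d i v + d u j < d i j + d u v" if "1 \<le> i" "i < u" "u < j" "j < v"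
        using crossing_degree that by (simp add: d_def)
      show "E i j z \<in> sl.fil r e" if "1 \<le> i" "i < j" "j \<le> n + 1" "z \<in> sl.fil r (e + d i j)"
        using that unfolding E_def d_def by (intro sl.vact_fil_basis[OF Y]) (auto simp: sl_basis_def)
      show "E i k (E i j z) = smul qvar_inv (E i j (E i k z))"
        if "1 \<le> i" "i < j" "j < k" "k \<le> n + 1" "z \<in> sl.fil r (d i j + d i k)"
        using exchange[of i j i k z] coeff[of i j i k] comm[of i j i k Y z] that by (simp add: sl_basis_def)
      show "E j k (E i k z) = smul qvar_inv (E i k (E j k z))"
        if "1 \<le> i" "i < j" "j < k" "k \<le> n + 1" "z \<in> sl.fil r (d i k + d j k)"
        using exchange[of i k j k z] coeff[of i k j k] comm[of i k j k Y z] that by (simp add: sl_basis_def)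
      show "E j k (E i j z) = smul qvar (E i j (E j k z)) - smul qvar (E i k z)"
        if "1 \<le> i" "i < j" "j < k" "k \<le> n + 1" "z \<in> sl.fil r (d i j + d j k)"
        using exchange[of i j j k z] coeff[of i j j k] comm[of i j j k Y z] that by (simp add: sl_basis_def E_def)
      show "E u k (E i j z) = E i j (E u k z)"
        if "1 \<le> i" "i < j" "j < u" "u < k" "k \<le> n + 1" "z \<in> sl.fil r (d i j + d u k)"
        using exchange[of i j u k z] coeff[of i j u k] comm[of i j u k Y z] that by (simp add: sl_basis_def)
      show "E u k (E i j z) = E i j (E u k z)"
        if "1 \<le> i" "i < u" "u < k" "k < j" "j \<le> n + 1" "z \<in> sl.fil r (d i j + d u k)"
        using exchange[of i j u k z] coeff[of i j u k] comm[of i j u k Y z] that by (simp add: sl_basis_def)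
      show "E u k (E i j z) = E i j (E u k z) + smul (qvar_inv - qvar) (E i k (E u j z))"
        if "1 \<le> i" "i < u" "u < j" "j < k" "k \<le> n + 1" "z \<in> sl.fil r (d i j + d u k)"
        using exchange[of i j u k z] coeff[of i j u k] comm[of i j u k Y z] that by (simp add: sl_basis_def E_def)
    qed
    have sorted: "sl.overlap Y (p, s) (u, v) (i, j) z = 0"
      if "(i, j) \<in> sl_basis n" "(u, v) \<in> sl_basis n" "(p, s) \<in> sl_basis n"
        "i < u \<or> i = u \<and> j < v" "u < p \<or> u = p \<and> v < s"
        "z \<in> sl.fil (r + 1) (d i j + d u v + d p s)" for i j u v p s
    proof -
      have "i < p \<or> i = p \<and> j < s" using that by auto
      note 1 = coeff[OF that(1,2,4), folded twist_def] coeff[OF that(2,3,5), folded twist_def]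
        coeff[OF that(1,3) this, folded twist_def]
      note 2 = comm[OF that(1,2,4), where Y = Y, folded E_def, folded comm_def]
        comm[OF that(2,3,5), where Y = Y, folded E_def, folded comm_def]
        comm[OF that(1,3) \<open>i < p \<or> i = p \<and> j < s\<close>, where Y = Y, folded E_def, folded comm_def]
      \<comment> \<open>The bound \<open>r + 1\<close> on the three degrees gives membership in
        \<open>sl.fil r c\<close> for every \<open>c\<close> strictly below their sum.\<close>
      show ?thesis
        unfolding sl.overlap_def 2 using that(1-3)
        by (simp only: q_coeff_sl_q 1 E_def[symmetric]) (rule overlap_zero, use that in \<open>auto simp: sl_basis_def elim!: sl.fil_mono\<close>)
    qed
    define lex where "lex a b \<longleftrightarrow> fst a < fst b \<or> fst a = fst b \<and> snd a < snd b" for a b :: "nat \<times> nat"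
    have lex_total: "lex a b \<or> lex b a" if "a \<noteq> b" for a b
      using that by (auto simp: lex_def prod_eq_iff)
    have lex_trans: "lex a c" if "lex a b" "lex b c" for a b c
      using that by (auto simp: lex_def)
    have lex_irrefl: "\<not> lex a a" for a
      by (simp add: lex_def)
    \<comment> \<open>The multiset equation says that \<open>a\<close>, \<open>b\<close>,
      \<open>c\<close> rearrange the given triple; it yields both membership in the basis and
      invariance of the total degree.\<close>
    have zero: "sl.overlap Y c b a z = 0"
      if "add_mset a (add_mset b {#c#}) = add_mset x (add_mset y {#w#})" "lex a b" "lex b c" for a b c
    proof -
      have "{a, b, c} = {x, y, w}"
        using arg_cong[OF that(1), of set_mset] by simp
      then have abc: "a \<in> sl_basis n" "b \<in> sl_basis n" "c \<in> sl_basis n"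
        using B by auto
      have "(\<Sum>p\<in>#add_mset a (add_mset b {#c#}). case_prod d p) = (\<Sum>p\<in>#add_mset x (add_mset y {#w#}). case_prod d p)"
        by (simp only: that(1))
      then have "z \<in> sl.fil (r + 1) (d (fst a) (snd a) + d (fst b) (snd b) + d (fst c) (snd c))"
        using z by (cases x, cases y, cases w) (simp add: d_def case_prod_unfold add.assoc)
      then show ?thesis
        using sorted[of "fst a" "snd a" "fst b" "snd b" "fst c" "snd c"] that(2,3) abc
        by (simp add: lex_def)
    qed
    note swaps = sl.overlap_swap12[of _ _ _ Y z] sl.overlap_swap23[of _ _ _ Y z]
    have "x \<noteq> y" "y \<noteq> w" "x \<noteq> w"
      using less by (auto simp: sl_less_def)
    \<comment> \<open>Nested pairs may be ordered differently by the two orders, so all six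
      arrangements are treated. At most three adjacent exchanges lead to the lexicographically
      decreasing one, and each exchange only multiplies zero by a scalar.\<close>
    then consider "lex w y" "lex y x" | "lex y w" "lex w x" | "lex w x" "lex x y"
      | "lex x w" "lex w y" | "lex y x" "lex x w" | "lex x y" "lex y w"
      using lex_total lex_trans by metis
    then show "sl.overlap Y x y w z = 0"
    proof cases
      case 1
      then show ?thesis by (intro zero) auto
    next
      case 2
      then have "sl.overlap Y x w y z = 0" by (intro zero) auto
      then show ?thesis using swaps(2)[of x w y] B by simp
    next
      case 3
      then have "sl.overlap Y y x w z = 0" by (intro zero) auto
      then show ?thesis using swaps(1)[of y x w] B by simp
    next
      case 4
      then have "sl.overlap Y y w x z = 0" by (intro zero) auto
      then show ?thesis using swaps(2)[of y w x] swaps(1)[of y x w] B by simp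
    next
      case 5
      then have "sl.overlap Y w x y z = 0" by (intro zero) auto
      then show ?thesis using swaps(1)[of w x y] swaps(2)[of x w y] B by simp
    next
      case 6
      then have "sl.overlap Y w y x z = 0" by (intro zero) auto
      then show ?thesis using swaps(1)[of w y x] swaps(2)[of y w x] swaps(1)[of y x w] B by simp
    qed
  qed
qed

theorem theorem10p2:
  fixes n :: nat
  assumes "n \<ge> 1"
  shows "basic_T_Lie_algebra (sl_q n :: (nat \<times> nat, 'a::field_char_0 q_laurent) tlie_data)
       \<and> adequate (sl_q n :: (nat \<times> nat, 'a q_laurent) tlie_data)"
  using basic_sl_q adequate_sl_q by blast

end
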